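(* Let $E=\{0,1,\dots,n\}$ and let $M$ be a loopless matroid of rank $r+1$ on $E$. Let $d_0,\dots,d_n$ be nonnegative integers with $d_0+\dots+d_n=r$. Then \[\deg_M(\Lambda_0^{d_0}\cdots\Lambda_n^{d_n})=\sum_{w}(-1)^{n-r+\mathrm{des}(w)},\] where the sum is over all bijections $w:E\to E$ with $\mathrm{Des}(w)=I'_{(d_0,\dots,d_n),K(w)}$.
   Context: The Chow ring $A^*(M)$ (real coefficients) is $\mathbb{R}[x_F : F \text{ a nonempty proper flat of } M]$ modulo the ideal generated by all $x_{F_1}x_{F_2}$ with $F_1,F_2$ incomparable and all $\sum_{F\ni i}x_F-\sum_{F\ni j}x_F$ for $i,j\in E$; $\deg_M:A^r(M)\to\mathbb{R}$ is the linear map with value $1$ on $x_{F_1}\cdots x_{F_r}$ for each complete flag of flats. For $S\subseteq E$, $x_S$ means the generator if $S$ is a nonempty proper flat and $0$ otherwise. Hypersimplex classes: $\gamma_k=\sum_S\left(\min(|S|,k)-\frac{k}{n+1}|S|\right)x_S$ for $1\le k\le n$ (sum over nonempty proper $S\subsetneq E$), and $\gamma_0=\gamma_{n+1}=0$. For $0\le k\le n$, $\Lambda_k=\gamma_k-\gamma_{k+1}\in A^1(M)$ (in the paper, the image of the piecewise-linear function $\lambda_k$, $x\mapsto$ ($(k+1)$st largest coordinate of $x$) $-x_n$, on the permutohedral fan). For a bijection $w:E\to E$: $\mathrm{Des}(w)=\{i\in\{0,\dots,n-1\}: w(i)>w(i+1)\}$, $\mathrm{des}(w)=|\mathrm{Des}(w)|$,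 and $K(w)$ is the set of $i\in E$ such that the closure in $M$ of $\{w(0),\dots,w(i-1)\}$ differs from the closure of $\{w(0),\dots,w(i)\}$ (so $0\in K(w)$ and $|K(w)|=r+1$). For $K\subseteq E$ with $|K|=r+1$, let $c_i=d_i$ if $i\in K$ and $c_i=d_i+1$ if $i\notin K$, and $I'_{(d_0,\dots,d_n),K}=\{i\in\{0,\dots,n-1\}: c_0+\dots+c_i<i+1\}$.
   Formalization: The classes are taken as Λ_k = γ_{k+1} − γ_k (the image of λ_k) instead of γ_k − γ_{k+1}; with the latter sign the identity fails for odd r, e.g. n = r = 1, M = U_{2,2}, d = (1,0) gives −1 on the left and +1 on the right. *)

theory Defs
  imports
    Complex_Main
    "HOL-Algebra.QuotRing"
    "HOL-Library.Poly_Mapping"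
    "HOL-Combinatorics.Permutations"
begin

section \<open>Matroids\<close>

definition matroid :: "'a set \<Rightarrow> 'a set set \<Rightarrow> bool" where
  "matroid E \<I> \<longleftrightarrow>
     finite E \<and> \<I> \<subseteq> Pow E \<and> {} \<in> \<I> \<and>
     (\<forall>X\<in>\<I>. \<forall>Y. Y \<subseteq> X \<longrightarrow> Y \<in> \<I>) \<and>
     (\<forall>X\<in>\<I>. \<forall>Y\<in>\<I>. card X < card Y \<longrightarrow> (\<exists>y\<in>Y - X. insert y X \<in> \<I>))"

definition loopless :: "'a set \<Rightarrow> 'a set set \<Rightarrow> bool" where
  "loopless E \<I> \<longleftrightarrow> (\<forall>e\<in>E. {e} \<in> \<I>)"

definition mrank :: "'a set set \<Rightarrow> 'a set \<Rightarrow> nat" where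
  "mrank \<I> S = Max (card ` {X \<in> \<I>. X \<subseteq> S})"

definition mclosure :: "'a set \<Rightarrow> 'a set set \<Rightarrow> 'a set \<Rightarrow> 'a set" where
  "mclosure E \<I> S = {e \<in> E. mrank \<I> (insert e S) = mrank \<I> S}"

definition proper_flats :: "'a set \<Rightarrow> 'a set set \<Rightarrow> 'a set set" where
  "proper_flats E \<I> = {F. F \<noteq> {} \<and> F \<subset> E \<and> mclosure E \<I> F = F}"

definition complete_flag :: "'a set \<Rightarrow> 'a set set \<Rightarrow> 'a set set \<Rightarrow> bool" where
  "complete_flag E \<I> C \<longleftrightarrow>
     C \<subseteq> proper_flats E \<I> \<and> (\<forall>F\<in>C. \<forall>G\<in>C. F \<subseteq> G \<or> G \<subseteq> F) \<and>
     card C + 1 = mrank \<I> E"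


section \<open>The Chow ring and its degree map\<close>

text \<open>
  Polynomials with real coefficients are finitely supported maps from monomials to
  coefficients, a monomial being a finitely supported map from variables to exponents.
\<close>

type_synonym 'v rpoly = "('v \<Rightarrow>\<^sub>0 nat) \<Rightarrow>\<^sub>0 real"

definition pvar :: "'v \<Rightarrow> 'v rpoly" where
  "pvar v = Poly_Mapping.single (Poly_Mapping.single v 1) 1"

definition pconst :: "real \<Rightarrow> 'v rpoly" where
  "pconst c = Poly_Mapping.single 0 c"

definition rpoly_ring :: "'v set \<Rightarrow> 'v rpoly ring" where
  "rpoly_ring V =
     \<lparr>carrier = {p. \<forall>m\<in>Poly_Mapping.keys p. Poly_Mapping.keys m \<subseteq> V},
      monoid.mult = (*), one = 1, zero = 0, add = (+)\<rparr>"

definition homogeneous :: "nat \<Rightarrow> 'v rpoly \<Rightarrow> bool" where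
  "homogeneous k p \<longleftrightarrow>
     (\<forall>m\<in>Poly_Mapping.keys p. (\<Sum>v\<in>Poly_Mapping.keys m. Poly_Mapping.lookup m v) = k)"

definition chow_poly_ring :: "'a set \<Rightarrow> 'a set set \<Rightarrow> 'a set rpoly ring" where
  "chow_poly_ring E \<I> = rpoly_ring (proper_flats E \<I>)"

definition chow_relations :: "'a set \<Rightarrow> 'a set set \<Rightarrow> 'a set rpoly set" where
  "chow_relations E \<I> =
     {pvar F * pvar G | F G. F \<in> proper_flats E \<I> \<and> G \<in> proper_flats E \<I> \<and>
        \<not> F \<subseteq> G \<and> \<not> G \<subseteq> F} \<union>
     {(\<Sum>F\<in>{F \<in> proper_flats E \<I>. i \<in> F}. pvar F) -
      (\<Sum>F\<in>{F \<in> proper_flats E \<I>. j \<in> F}. pvar F) | i j. i \<in> E \<and> j \<in> E}"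

definition chow_ideal :: "'a set \<Rightarrow> 'a set set \<Rightarrow> 'a set rpoly set" where
  "chow_ideal E \<I> = Idl\<^bsub>chow_poly_ring E \<I>\<^esub> (chow_relations E \<I>)"

definition chow_ring :: "'a set \<Rightarrow> 'a set set \<Rightarrow> 'a set rpoly set ring" where
  "chow_ring E \<I> = chow_poly_ring E \<I> Quot chow_ideal E \<I>"

definition chow_class :: "'a set \<Rightarrow> 'a set set \<Rightarrow> 'a set rpoly \<Rightarrow> 'a set rpoly set" where
  "chow_class E \<I> p = chow_ideal E \<I> +>\<^bsub>chow_poly_ring E \<I>\<^esub> p"

definition chow_piece :: "'a set \<Rightarrow> 'a set set \<Rightarrow> nat \<Rightarrow> 'a set rpoly set set" where
  "chow_piece E \<I> k =
     chow_class E \<I> ` {p \<in> carrier (chow_poly_ring E \<I>). homogeneous k p}"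

text \<open>
  Extensionality pins the map down outside the top graded piece, so that it is
  unique as a HOL function.
\<close>

definition is_degree_map ::
    "'a set \<Rightarrow> 'a set set \<Rightarrow> ('a set rpoly set \<Rightarrow> real) \<Rightarrow> bool" where
  "is_degree_map E \<I> f \<longleftrightarrow>
     (let A = chow_ring E \<I>; T = chow_piece E \<I> (mrank \<I> E - 1) in
       f \<in> extensional T \<and>
       (\<forall>a\<in>T. \<forall>b\<in>T. f (a \<oplus>\<^bsub>A\<^esub> b) = f a + f b) \<and>
       (\<forall>c. \<forall>a\<in>T. f (chow_class E \<I> (pconst c) \<otimes>\<^bsub>A\<^esub> a) = c * f a) \<and>
       (\<forall>C. complete_flag E \<I> C \<longrightarrow> f (chow_class E \<I> (\<Prod>F\<in>C. pvar F)) = 1))"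

definition chow_deg :: "'a set \<Rightarrow> 'a set set \<Rightarrow> 'a set rpoly set \<Rightarrow> real" where
  "chow_deg E \<I> = (THE f. is_degree_map E \<I> f)"


section \<open>Hypersimplex classes\<close>

definition xgen :: "'a set \<Rightarrow> 'a set set \<Rightarrow> 'a set \<Rightarrow> 'a set rpoly" where
  "xgen E \<I> S = (if S \<in> proper_flats E \<I> then pvar S else 0)"

definition hyp_gamma :: "'a set \<Rightarrow> 'a set set \<Rightarrow> nat \<Rightarrow> 'a set rpoly set" where
  "hyp_gamma E \<I> k =
     (if 1 \<le> k \<and> k < card E
      then chow_class E \<I>
        (\<Sum>S\<in>{S. S \<noteq> {} \<and> S \<subset> E}.
           pconst (real (min (card S) k) - real k / real (card E) * real (card S)) *
           xgen E \<I> S)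
      else \<zero>\<^bsub>chow_ring E \<I>\<^esub>)"

text \<open>
  A piecewise linear function \<open>\<phi>\<close> on the permutohedral fan is sent to the class
  \<open>\<Sum>S. \<phi>(e_S) x_S\<close>, where \<open>e_S\<close> is the indicator vector of \<open>S\<close>.  Up to a linear function,
  \<open>hyp_gamma k\<close> is the image of the sum of the \<open>k\<close> largest coordinates.  Hence the image of
  the \<open>(k+1)\<close>st largest coordinate (minus the last coordinate) is the difference below,
  in this order.  With the opposite order the degree of a product of \<open>r\<close> such
  classes changes by \<open>(-1)^r\<close>.
\<close>

definition hyp_Lambda :: "'a set \<Rightarrow> 'a set set \<Rightarrow> nat \<Rightarrow> 'a set rpoly set" where
  "hyp_Lambda E \<I> k = hyp_gamma E \<I> (k + 1) \<ominus>\<^bsub>chow_ring E \<I>\<^esub> hyp_gamma E \<I> k"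


section \<open>Permutation statistics on \<open>{0..n}\<close>\<close>

definition Des :: "nat \<Rightarrow> (nat \<Rightarrow> nat) \<Rightarrow> nat set" where
  "Des n w = {i. i < n \<and> w i > w (i + 1)}"

definition K_set :: "nat \<Rightarrow> nat set set \<Rightarrow> (nat \<Rightarrow> nat) \<Rightarrow> nat set" where
  "K_set n \<I> w =
     {i \<in> {0..n}. mclosure {0..n} \<I> (w ` {..<i}) \<noteq> mclosure {0..n} \<I> (w ` {..i})}"

definition I_prime :: "nat \<Rightarrow> (nat \<Rightarrow> nat) \<Rightarrow> nat set \<Rightarrow> nat set" where
  "I_prime n d K = {i. i < n \<and> (\<Sum>j\<le>i. if j \<in> K then d j else d j + 1) < i + 1}"

end

theory Submission
  imports Defs "HOL-Combinatorics.Multiset_Permutations"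
begin

text \<open>
  Torus localization on the permutohedral variety, made elementary.  Fix distinct complex numbers
  \<open>t e\<close>.  An ordering \<open>w\<close> of \<open>E\<close> is a fixed point, where \<open>x_S\<close> takes the value
  \<open>t (w i) - t (w (i + 1))\<close> if \<open>S = {w 0, ..., w i}\<close> and \<open>0\<close> otherwise, and where the Bergman class
  of the matroid is, up to sign, the product of the \<open>t (w i)\<close> with \<open>i \<notin> K(w)\<close>.  Summing over all
  \<open>w\<close>, divided by the product of the \<open>t (w i) - t (w (i + 1))\<close>, gives a linear functional on
  polynomials in the \<open>x_S\<close>.  Inserting one element \<open>a\<close> into all positions of an ordering of the other
  elements telescopes: the result is zero if \<open>a\<close> is a loop or a coloop and it deletes \<open>a\<close> up to sign
  otherwise.  Hence the functional kills every squarefree chain monomial of degree at most \<open>r\<close> except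
  the complete flags of flats, and in degree \<open>r\<close> it is the degree map up to sign, for every \<open>t\<close>.

  The class \<open>\<Lambda>_k\<close> takes the value \<open>t (w k)\<close> minus a constant at \<open>w\<close>, and constants do not matter in
  top degree.  So the degree is a sum over \<open>w\<close> of Laurent monomials divided by products of differences,
  which does not depend on \<open>t\<close>; the theorem is read off from the constant term of each summand,
  expanded where \<open>t 0\<close> dominates \<open>t 1\<close>, which dominates \<open>t 2\<close>, and so on.
\<close>

section \<open>Rank and span\<close>

text \<open>\<open>chow_deg\<close> is a definite description, so existence and uniqueness of the
  degree map both have to be proved. Uniqueness is a rewriting of monomials inside the Chow ring.
  Existence comes from the localized functional, which has to be shown to respect the ideal. There
  the linear relations hold only up to the scalar \<open>t i - t j\<close>, so a monomial is
  rewritten into monomials of the same degree and of one degree less; this is why everything below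
  degree \<open>r\<close> has to vanish as well.

  The exponents arise as follows. The \<open>w i\<close> with \<open>i\<close> in
  \<open>K(w)\<close> form the basis picked greedily along \<open>w\<close>, so the Bergman factor
  adds one power of \<open>t (w i)\<close> for each \<open>i\<close> outside \<open>K(w)\<close>:
  this is the passage from \<open>d\<close> to \<open>c\<close>. These \<open>n - r\<close> factors
  join \<open>r\<close> factors from the classes, so numerator and denominator both have degree
  \<open>n\<close>. Every summand is then a function of the ratios
  \<open>t (w i) / t (w (i + 1))\<close>, and the partial sums of \<open>c\<close> are compared with
  \<open>i\<close> because both are exponents of these ratios.\<close>

locale finite_matroid =
  fixes E :: "'a set" and \<I> :: "'a set set"
  assumes matroid: "matroid E \<I>"
begin

abbreviation rk :: "'a set \<Rightarrow> nat" where "rk \<equiv> mrank \<I>"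

abbreviation spans :: "'a set \<Rightarrow> 'a \<Rightarrow> bool" where
  "spans Y e \<equiv> rk (insert e Y) = rk Y"

lemma finite_E: "finite E"
  using matroid by (simp add: matroid_def)

lemma finite_indep_sets: "finite \<I>"
  using matroid finite_E unfolding matroid_def by (meson finite_Pow_iff finite_subset)

lemma finite_indep: "X \<in> \<I> \<Longrightarrow> finite X"
  using matroid finite_E unfolding matroid_def by (meson PowD finite_subset subsetD)

lemma indep_subset: "X \<in> \<I> \<Longrightarrow> Y \<subseteq> X \<Longrightarrow> Y \<in> \<I>"
  using matroid unfolding matroid_def by blast

lemma indep_augment:
  "X \<in> \<I> \<Longrightarrow> Y \<in> \<I> \<Longrightarrow> card X < card Y \<Longrightarrow> \<exists>y\<in>Y - X. insert y X \<in> \<I>"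
  using matroid unfolding matroid_def by blast

lemma card_le_rk: "X \<in> \<I> \<Longrightarrow> X \<subseteq> S \<Longrightarrow> card X \<le> rk S"
  unfolding mrank_def using finite_indep_sets by (intro Max_ge) auto

lemma rk_attained: obtains X where "X \<in> \<I>" "X \<subseteq> S" "card X = rk S"
proof -
  have "{} \<in> {X \<in> \<I>. X \<subseteq> S}"
    using matroid by (simp add: matroid_def)
  then have "rk S \<in> card ` {X \<in> \<I>. X \<subseteq> S}"
    unfolding mrank_def using finite_indep_sets by (intro Max_in) auto
  then show thesis using that by auto
qed

lemma basis_extension:
  assumes "X \<in> \<I>" "X \<subseteq> S"
  obtains Y where "Y \<in> \<I>" "X \<subseteq> Y" "Y \<subseteq> S" "card Y = rk S"
proof -
  define A where "A = {Y \<in> \<I>. X \<subseteq> Y \<and> Y \<subseteq> S}"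
  have "finite A" "A \<noteq> {}"
    using finite_indep_sets assms by (auto simp: A_def)
  then have "Max (card ` A) \<in> card ` A" by (intro Max_in) auto
  then obtain Y where "Y \<in> A" "card Y = Max (card ` A)" by auto
  then have Y: "Y \<in> A" "\<And>Z. Z \<in> A \<Longrightarrow> card Z \<le> card Y"
    using \<open>finite A\<close> by auto
  have "card Y = rk S"
  proof (rule ccontr)
    assume "card Y \<noteq> rk S"
    moreover have "card Y \<le> rk S"
      using Y(1) by (auto simp: A_def intro: card_le_rk)
    ultimately have less: "card Y < rk S" by simp
    obtain Z where Z: "Z \<in> \<I>" "Z \<subseteq> S" "card Z = rk S" by (rule rk_attained)
    obtain y where "y \<in> Z - Y" "insert y Y \<in> \<I>"
      using indep_augment[of Y Z] Y(1) Z less by (auto simp: A_def)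
    moreover from this have "insert y Y \<in> A"
      using Y(1) Z by (auto simp: A_def)
    ultimately show False
      using Y(2)[of "insert y Y"] finite_indep[of Y] Y(1) by (auto simp: A_def)
  qed
  then show thesis using that Y(1) by (auto simp: A_def)
qed

lemma rk_mono: "S \<subseteq> T \<Longrightarrow> rk S \<le> rk T"
  by (metis card_le_rk rk_attained subset_trans)

lemma rk_empty: "rk {} = 0"
  by (metis card.empty rk_attained subset_empty)

lemma rk_insert_le: "rk (insert e S) \<le> Suc (rk S)"
proof -
  obtain X where X: "X \<in> \<I>" "X \<subseteq> insert e S" "card X = rk (insert e S)"
    by (rule rk_attained)
  have "card (X - {e}) \<le> rk S"
    using X by (intro card_le_rk) (auto intro: indep_subset)
  then show ?thesis
    using X(3) finite_indep[OF X(1)] by (cases "e \<in> X") auto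
qed

lemma rk_insert_cases: "rk (insert e S) = rk S \<or> rk (insert e S) = Suc (rk S)"
  using rk_insert_le[of e S] rk_mono[OF subset_insertI, of S e] by linarith

text \<open>Submodularity in the form used throughout. A basis \<open>B\<close> of \<open>Y\<close>
  extends to a basis \<open>C\<close> of \<open>Z\<close>. If \<open>a\<close> raised the rank of
  \<open>Z\<close>, augmenting \<open>C\<close> inside \<open>insert a Z\<close> could only add
  \<open>a\<close> itself, so \<open>insert a B\<close> would be independent and too large for
  \<open>insert a Y\<close>.\<close>

lemma spans_mono:
  assumes "spans Y a" "Y \<subseteq> Z"
  shows "spans Z a"
proof (rule ccontr)
  assume nsp: "\<not> spans Z a"
  then have "a \<notin> Z" by (metis insert_absorb)
  have less: "rk Z < rk (insert a Z)"
    using nsp rk_insert_cases by force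
  obtain B where B: "B \<in> \<I>" "B \<subseteq> Y" "card B = rk Y" by (rule rk_attained)
  obtain C where C: "C \<in> \<I>" "B \<subseteq> C" "C \<subseteq> Z" "card C = rk Z"
    using basis_extension[of B Z] B assms(2) by auto
  obtain W where W: "W \<in> \<I>" "W \<subseteq> insert a Z" "card W = rk (insert a Z)" by (rule rk_attained)
  obtain y where y: "y \<in> W - C" "insert y C \<in> \<I>"
    using indep_augment[OF C(1) W(1)] C(4) W(3) less by auto
  have "y = a"
  proof (rule ccontr)
    assume "y \<noteq> a"
    then have "card (insert y C) \<le> rk Z"
      using y W C by (intro card_le_rk) auto
    then show False using C(4) y finite_indep[OF C(1)] by simp
  qed
  then have "insert a B \<in> \<I>"
    using y(2) C(2) by (auto intro: indep_subset)
  then have "card (insert a B) \<le> rk (insert a Y)"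
    using B(2) by (intro card_le_rk) auto
  moreover have "a \<notin> B" using C \<open>a \<notin> Z\<close> by auto
  ultimately show False
    using B(3) assms(1) finite_indep[OF B(1)] by simp
qed

text \<open>Steinitz exchange by counting ranks: adding \<open>a\<close> alone or \<open>y\<close>
  alone raises the rank of \<open>Y\<close> by one, and adding both raises it no further.\<close>

lemma spans_exchange:
  assumes "\<not> spans Y a" "spans (insert y Y) a"
  shows "\<not> spans Y y" "spans (insert a Y) y"
proof -
  have 1: "rk (insert a Y) = Suc (rk Y)"
    using assms(1) rk_insert_cases by auto
  have 2: "rk (insert a Y) \<le> rk (insert a (insert y Y))"
    by (rule rk_mono) auto
  show "\<not> spans Y y" using 1 2 assms(2) by auto
  then have "rk (insert y Y) = Suc (rk Y)"
    using rk_insert_cases by auto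
  then show "spans (insert a Y) y" using 1 assms(2) by (simp add: insert_commute)
qed

lemma spans_insert_spanned:
  assumes "spans Y a"
  shows "spans (insert a Y) e \<longleftrightarrow> spans Y e"
proof
  assume "spans (insert a Y) e"
  moreover have "rk (insert e Y) \<le> rk (insert e (insert a Y))"
    by (rule rk_mono) auto
  moreover have "rk Y \<le> rk (insert e Y)"
    by (rule rk_mono) auto
  ultimately show "spans Y e" using assms by simp
qed (auto intro: spans_mono)

lemma mem_mclosure_iff: "e \<in> mclosure E \<I> S \<longleftrightarrow> e \<in> E \<and> spans S e"
  by (simp add: mclosure_def)

lemma proper_flats_iff:
  "F \<in> proper_flats E \<I> \<longleftrightarrow> F \<noteq> {} \<and> F \<subset> E \<and> (\<forall>e\<in>E - F. \<not> spans F e)"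
proof -
  have "mclosure E \<I> F = F \<longleftrightarrow> (\<forall>e\<in>E - F. \<not> spans F e)" if "F \<subset> E"
    using that by (auto simp: mclosure_def insert_absorb)
  then show ?thesis by (auto simp: proper_flats_def)
qed

end


section \<open>Sums over orderings\<close>

text \<open>The inverse Euler class of the tangent space at a fixed point of the permutohedral
  variety, up to a sign that depends only on the length.\<close>

fun inv_diffs :: "('a \<Rightarrow> 'f::field) \<Rightarrow> 'a list \<Rightarrow> 'f" where
  "inv_diffs t [] = 1"
| "inv_diffs t [x] = 1"
| "inv_diffs t (x # y # ys) = inv_diffs t (y # ys) / (t x - t y)"

lemma inv_diffs_append:
  "u \<noteq> [] \<Longrightarrow> v \<noteq> [] \<Longrightarrow>
    inv_diffs t (u @ v) = inv_diffs t u * inv_diffs t v / (t (last u) - t (hd v))"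
proof (induction t u rule: inv_diffs.induct)
  case (2 t x)
  then show ?case by (cases v) auto
qed auto

definition insert_at :: "'a \<Rightarrow> nat \<Rightarrow> 'a list \<Rightarrow> 'a list" where
  "insert_at a i xs = take i xs @ a # drop i xs"

text \<open>Isolates the position of one element; the inner sum is the one that telescopes.\<close>

lemma sum_permutations_insert_at:
  assumes "finite B" "a \<in> B"
  shows "(\<Sum>w\<in>permutations_of_set B. g w) =
    (\<Sum>\<tau>\<in>permutations_of_set (B - {a}). \<Sum>i\<le>length \<tau>. g (insert_at a i \<tau>))"
proof -
  let ?P = "SIGMA \<tau>:permutations_of_set (B - {a}). {..length \<tau>}"
  have "bij_betw (\<lambda>(\<tau>, i). insert_at a i \<tau>) ?P (permutations_of_set B)"
  proof (rule bij_betw_imageI)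
    show "inj_on (\<lambda>(\<tau>, i). insert_at a i \<tau>) ?P"
    proof (rule inj_onI, clarify)
      fix \<tau> i \<tau>' j
      assume \<tau>: "\<tau> \<in> permutations_of_set (B - {a})" "i \<le> length \<tau>"
        and \<tau>': "\<tau>' \<in> permutations_of_set (B - {a})" "j \<le> length \<tau>'"
        and eq: "insert_at a i \<tau> = insert_at a j \<tau>'"
      have "a \<notin> set \<tau>" "a \<notin> set \<tau>'"
        using \<tau> \<tau>' by (auto dest: permutations_of_setD)
      then have "take i \<tau> = take j \<tau>' \<and> drop i \<tau> = drop j \<tau>'"
        using eq append_Cons_eq_iff[of a "take i \<tau>" "drop i \<tau>" "take j \<tau>'" "drop j \<tau>'"]
        by (auto simp: insert_at_def dest: in_set_takeD in_set_dropD)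
      then show "\<tau> = \<tau>' \<and> i = j"
        using \<tau>(2) \<tau>'(2) by (metis append_take_drop_id length_take min.absorb2)
    qed
    show "(\<lambda>(\<tau>, i). insert_at a i \<tau>) ` ?P = permutations_of_set B"
    proof (intro equalityI subsetI)
      fix w assume "w \<in> (\<lambda>(\<tau>, i). insert_at a i \<tau>) ` ?P"
      then obtain \<tau> i where \<tau>: "\<tau> \<in> permutations_of_set (B - {a})" "w = insert_at a i \<tau>"
        by auto
      have "set \<tau> = B - {a}" "distinct \<tau>"
        using \<tau>(1) by (auto dest: permutations_of_setD)
      moreover have "set (take i \<tau>) \<union> set (drop i \<tau>) = set \<tau>"
        by (metis append_take_drop_id set_append)
      moreover have "set (take i \<tau>) \<inter> set (drop i \<tau>) = {}"
        using \<open>distinct \<tau>\<close> by (metis append_take_drop_id distinct_append)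
      ultimately show "w \<in> permutations_of_set B"
        using assms(2) unfolding \<tau>(2) insert_at_def
        by (intro permutations_of_setI) (auto simp: Un_commute)
    next
      fix w assume w: "w \<in> permutations_of_set B"
      then have "a \<in> set w" using assms(2) by (auto dest: permutations_of_setD)
      then obtain u v where uv: "w = u @ a # v" by (meson split_list)
      have "u @ v \<in> permutations_of_set (B - {a})"
        using w unfolding uv permutations_of_set_def by auto
      then show "w \<in> (\<lambda>(\<tau>, i). insert_at a i \<tau>) ` ?P"
        by (intro image_eqI[of _ _ "(u @ v, length u)"]) (auto simp: uv insert_at_def)
    qed
  qed
  then have "(\<Sum>w\<in>permutations_of_set B. g w) = (\<Sum>x\<in>?P. g (case x of (\<tau>, i) \<Rightarrow> insert_at a i \<tau>))"
    by (rule sum.reindex_bij_betw[symmetric])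
  also have "\<dots> = (\<Sum>\<tau>\<in>permutations_of_set (B - {a}). \<Sum>i\<le>length \<tau>. g (insert_at a i \<tau>))"
    by (subst sum.Sigma) (auto simp: split_beta)
  finally show ?thesis .
qed

text \<open>Telescoping. Inserting \<open>a\<close> between two neighbours contributes, by partial
  fractions, the right-hand side at the later neighbour minus the one at the earlier neighbour;
  inserting it in front gives the first value.\<close>

lemma sum_inv_diffs_insert_at_prefix:
  assumes "inj_on t (insert a (set \<tau>))" "distinct (a # \<tau>)" "q < length \<tau>"
  shows "(\<Sum>i\<le>q. inv_diffs t (insert_at a i \<tau>)) = inv_diffs t \<tau> / (t a - t (\<tau> ! q))"
  using assms(3)
proof (induction q)
  case 0
  then show ?case by (cases \<tau>) (auto simp: insert_at_def)
next
  case (Suc q)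
  let ?u = "take (Suc q) \<tau>" and ?v = "drop (Suc q) \<tau>"
  have ne: "?u \<noteq> []" "?v \<noteq> []" using Suc.prems by auto
  have lst: "last ?u = \<tau> ! q" "hd ?v = \<tau> ! Suc q"
    using Suc.prems by (auto simp: take_Suc_conv_app_nth hd_drop_conv_nth)
  have neq: "t a \<noteq> t (\<tau> ! q)" "t a \<noteq> t (\<tau> ! Suc q)" "t (\<tau> ! q) \<noteq> t (\<tau> ! Suc q)"
    using assms(1,2) Suc.prems
    by (auto simp: inj_on_eq_iff[OF assms(1)] nth_eq_iff_index_eq)
  have \<tau>: "inv_diffs t \<tau> = inv_diffs t ?u * inv_diffs t ?v / (t (\<tau> ! q) - t (\<tau> ! Suc q))"
    using inv_diffs_append[OF ne, of t] lst by simp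
  have av: "inv_diffs t (a # ?v) = inv_diffs t ?v / (t a - t (\<tau> ! Suc q))"
    using ne(2) lst(2) by (cases ?v) auto
  have "inv_diffs t (insert_at a (Suc q) \<tau>) =
      inv_diffs t ?u * (inv_diffs t ?v / (t a - t (\<tau> ! Suc q))) / (t (\<tau> ! q) - t a)"
    unfolding insert_at_def using inv_diffs_append[OF ne(1), of "a # ?v" t] lst av by simp
  also have "\<dots> = inv_diffs t \<tau> / (t a - t (\<tau> ! Suc q)) - inv_diffs t \<tau> / (t a - t (\<tau> ! q))"
  proof -
    \<comment> \<open>Here \<open>y\<close> stands for \<open>t a\<close>, and \<open>z\<close> and
      \<open>x\<close> for the values at its left and right neighbour.\<close>
    have id: "1 / (y - x) / (z - y) = 1 / (z - x) / (y - x) - 1 / (z - x) / (y - z)"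
      if "y \<noteq> x" "y \<noteq> z" "z \<noteq> x" for x y z :: 'b
      using that by (simp add: divide_simps) (simp add: algebra_simps)
    show ?thesis
      using arg_cong[OF id[OF neq(2,1) neq(3)], of "\<lambda>c. inv_diffs t ?u * inv_diffs t ?v * c"]
      unfolding \<tau> by (simp add: algebra_simps)
  qed
  finally show ?case using Suc by (simp del: take_Suc drop_Suc)
qed

text \<open>Appending \<open>a\<close> at the end contributes the negative of the telescoped value.
  For an empty \<open>\<tau>\<close> the only term would be 1.\<close>

lemma sum_inv_diffs_insert_at:
  assumes "inj_on t (insert a (set \<tau>))" "distinct (a # \<tau>)" "\<tau> \<noteq> []"
  shows "(\<Sum>i\<le>length \<tau>. inv_diffs t (insert_at a i \<tau>)) = 0"
proof -
  let ?q = "length \<tau> - 1"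
  have len: "length \<tau> = Suc ?q" and q: "?q < length \<tau>" using assms(3) by auto
  have neq: "t a \<noteq> t (\<tau> ! ?q)"
    using assms(2) q by (auto simp: inj_on_eq_iff[OF assms(1)])
  have "(\<Sum>i\<le>length \<tau>. inv_diffs t (insert_at a i \<tau>)) =
      (\<Sum>i\<le>?q. inv_diffs t (insert_at a i \<tau>)) + inv_diffs t (insert_at a (length \<tau>) \<tau>)"
    by (metis len sum.atMost_Suc)
  also have "\<dots> = inv_diffs t \<tau> / (t a - t (\<tau> ! ?q)) + inv_diffs t \<tau> / (t (\<tau> ! ?q) - t a)"
    using inv_diffs_append[OF assms(3), of "[a]" t] assms(3)
      sum_inv_diffs_insert_at_prefix[OF assms(1,2) q]
    by (simp add: insert_at_def last_conv_nth)
  also have "\<dots> = 0"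
    using neq by (simp add: divide_simps) (simp add: algebra_simps)
  finally show ?thesis .
qed

lemma sum_inv_diffs_insert_at_suffix:
  assumes "inj_on t (insert a (set \<tau>))" "distinct (a # \<tau>)" "q < length \<tau>"
  shows "(\<Sum>i=Suc q..length \<tau>. inv_diffs t (insert_at a i \<tau>)) =
    - (inv_diffs t \<tau> / (t a - t (\<tau> ! q)))"
proof -
  have "(\<Sum>i\<le>length \<tau>. inv_diffs t (insert_at a i \<tau>)) =
      (\<Sum>i\<le>q. inv_diffs t (insert_at a i \<tau>)) +
      (\<Sum>i=Suc q..length \<tau>. inv_diffs t (insert_at a i \<tau>))"
    using assms(3) by (subst sum.union_disjoint[symmetric]) (auto intro!: sum.cong)
  moreover have "\<tau> \<noteq> []" using assms(3) by auto
  ultimately show ?thesis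
    using sum_inv_diffs_insert_at_prefix[OF assms] sum_inv_diffs_insert_at[OF assms(1,2)]
    by (simp add: eq_neg_iff_add_eq_0 add.commute)
qed

section \<open>Weighted sums over orderings: deleting one element of a minor\<close>

locale weighted_matroid = finite_matroid E \<I>
  for E :: "'a set" and \<I> :: "'a set set" +
  fixes t :: "'a \<Rightarrow> 'f::field"
  assumes inj_t: "inj_on t E"
begin

text \<open>The greedy algorithm: the letters that contribute are those outside the basis picked
  along the list. The accumulator \<open>X\<close> holds what has been read and acts as a contracted
  set.\<close>

primrec nonbasis_prod :: "'a set \<Rightarrow> 'a list \<Rightarrow> 'f" where
  "nonbasis_prod X [] = 1"
| "nonbasis_prod X (y # ys) = (if spans X y then t y else 1) * nonbasis_prod (insert y X) ys"

lemma nonbasis_prod_append: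
  "nonbasis_prod X (u @ v) = nonbasis_prod X u * nonbasis_prod (X \<union> set u) v"
  by (induction u arbitrary: X) (simp_all add: mult.assoc)

text \<open>An element that is already spanned alters none of the later rank tests.\<close>

lemma nonbasis_prod_insert_spanned:
  "spans Y a \<Longrightarrow> nonbasis_prod (insert a Y) v = nonbasis_prod Y v"
proof (induction v arbitrary: Y)
  case (Cons y ys)
  have "spans (insert y Y) a" using Cons.prems by (rule spans_mono) auto
  then show ?case
    using Cons.IH[of "insert y Y"] spans_insert_spanned[OF Cons.prems, of y]
    by (simp add: insert_commute)
qed simp

text \<open>By exchange, \<open>a\<close> could make a later letter redundant only if that letter,
  together with those before it, spanned \<open>a\<close>.\<close>

lemma nonbasis_prod_insert_coloop:
  "\<not> spans (Y \<union> set v) a \<Longrightarrow> nonbasis_prod (insert a Y) v = nonbasis_prod Y v"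
proof (induction v arbitrary: Y)
  case (Cons y ys)
  have n: "\<not> spans (insert y Y) a" "\<not> spans Y a"
    using Cons.prems spans_mono[of a _ "Y \<union> set (y # ys)"] by auto
  have "spans (insert a Y) y \<longleftrightarrow> spans Y y"
    using spans_mono[of y Y "insert a Y"] spans_exchange(2)[of y Y a] n by auto
  then show ?case
    using Cons.IH[of "insert y Y"] Cons.prems by (simp add: insert_commute)
qed simp

text \<open>The letter \<open>v ! k\<close> is the one that makes \<open>a\<close> spanned. There
  the roles swap: it is a basis element without \<open>a\<close> and redundant with
  \<open>a\<close>. Before it the tests agree by the exchange property, after it because
  \<open>a\<close> is spanned.\<close>

lemma nonbasis_prod_insert_exchange:
  "\<not> spans (Y \<union> set (take k v)) a \<Longrightarrow> spans (Y \<union> set (take (Suc k) v)) a \<Longrightarrow>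
    k < length v \<Longrightarrow> nonbasis_prod (insert a Y) v = t (v ! k) * nonbasis_prod Y v"
proof (induction v arbitrary: Y k)
  case (Cons y ys)
  show ?case
  proof (cases k)
    case 0
    then have 1: "\<not> spans Y a" "spans (insert y Y) a" using Cons.prems by auto
    from nonbasis_prod_insert_spanned[OF 1(2)] spans_exchange[OF 1] 0
    show ?thesis by (simp add: insert_commute)
  next
    case (Suc k')
    have n: "\<not> spans (insert y Y) a" "\<not> spans Y a"
      using Cons.prems(1) Suc spans_mono[of a _ "Y \<union> set (take k (y # ys))"] by auto
    have "spans (insert a Y) y \<longleftrightarrow> spans Y y"
      using spans_mono[of y Y "insert a Y"] spans_exchange(2)[of y Y a] n by auto
    then show ?thesis
      using Cons.IH[of "insert y Y" k'] Cons.prems Suc by (simp add: insert_commute)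
  qed
qed simp

text \<open>\<open>X\<close> plays the role of a contracted set and \<open>B\<close> that of the
  ground set of the minor; the value is the localized integral of the constant 1.\<close>

definition order_sum :: "'a set \<Rightarrow> 'a set \<Rightarrow> 'f" where
  "order_sum X B = (\<Sum>w\<in>permutations_of_set B. nonbasis_prod X w * inv_diffs t w)"

text \<open>The weight does not depend on where \<open>a\<close> is inserted: it gains the factor
  \<open>t a\<close> for a loop and no factor for a coloop. The sum over the positions therefore
  vanishes.\<close>

lemma order_sum_loop_or_coloop:
  assumes "B \<subseteq> E" "a \<in> B" "B \<noteq> {a}" "spans X a \<or> \<not> spans (X \<union> (B - {a})) a"
  shows "order_sum X B = 0"
proof -
  have fin: "finite B" using assms(1) finite_E finite_subset by auto
  have "(\<Sum>i\<le>length \<tau>. nonbasis_prod X (insert_at a i \<tau>) * inv_diffs t (insert_at a i \<tau>)) = 0"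
    if \<tau>: "\<tau> \<in> permutations_of_set (B - {a})" for \<tau>
  proof -
    have set: "set \<tau> = B - {a}" and dist: "distinct \<tau>"
      using \<tau> by (auto dest: permutations_of_setD)
    define c where "c = (if spans X a then t a else 1)"
    have "nonbasis_prod X (insert_at a i \<tau>) = c * nonbasis_prod X \<tau>" for i
    proof -
      let ?Y = "X \<union> set (take i \<tau>)"
      have un: "?Y \<union> set (drop i \<tau>) = X \<union> (B - {a})"
        by (metis append_take_drop_id set_append set sup_assoc)
      have "(if spans ?Y a then t a else 1) * nonbasis_prod (insert a ?Y) (drop i \<tau>) =
          c * nonbasis_prod ?Y (drop i \<tau>)"
      proof (cases "spans X a")
        case True
        then have "spans ?Y a" by (rule spans_mono) auto
        then show ?thesis using True nonbasis_prod_insert_spanned by (simp add: c_def)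
      next
        case False
        then have "\<not> spans (?Y \<union> set (drop i \<tau>)) a" using assms(4) un by simp
        moreover from this have "\<not> spans ?Y a"
          using spans_mono[of a ?Y "?Y \<union> set (drop i \<tau>)"] by auto
        ultimately show ?thesis using False nonbasis_prod_insert_coloop by (simp add: c_def)
      qed
      then have "nonbasis_prod X (insert_at a i \<tau>) =
          c * (nonbasis_prod X (take i \<tau>) * nonbasis_prod ?Y (drop i \<tau>))"
        by (simp add: insert_at_def nonbasis_prod_append algebra_simps)
      then show ?thesis by (simp flip: nonbasis_prod_append)
    qed
    moreover have "inj_on t (insert a (set \<tau>))"
      using inj_t by (rule inj_on_subset) (use assms set in auto)
    moreover have "\<tau> \<noteq> []" using set assms(2,3) by fastforce
    ultimately show ?thesis
      using sum_inv_diffs_insert_at[of t a \<tau>] set dist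
      by (simp add: mult.assoc flip: sum_distrib_left)
  qed
  then show ?thesis
    unfolding order_sum_def by (subst sum_permutations_insert_at[OF fin assms(2)]) simp
qed

text \<open>Let \<open>\<tau> ! q\<close> be the letter at which \<open>a\<close> becomes spanned.
  Inserted before that letter, \<open>a\<close> enters the basis and the weight gains
  \<open>t (\<tau> ! q)\<close>; inserted after it, the weight gains \<open>t a\<close>. The two
  groups of positions have opposite sums, and the difference of the two factors cancels the
  denominator \<open>t a - t (\<tau> ! q)\<close> up to the sign.\<close>

lemma order_sum_delete:
  assumes "B \<subseteq> E" "a \<in> B" "\<not> spans X a" "spans (X \<union> (B - {a})) a"
  shows "order_sum X B = - order_sum X (B - {a})"
proof -
  have fin: "finite B" using assms(1) finite_E finite_subset by auto
  have "(\<Sum>i\<le>length \<tau>. nonbasis_prod X (insert_at a i \<tau>) * inv_diffs t (insert_at a i \<tau>)) =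
      - (nonbasis_prod X \<tau> * inv_diffs t \<tau>)"
    if \<tau>: "\<tau> \<in> permutations_of_set (B - {a})" for \<tau>
  proof -
    have set: "set \<tau> = B - {a}" and dist: "distinct \<tau>"
      using \<tau> by (auto dest: permutations_of_setD)
    have inj: "inj_on t (insert a (set \<tau>))"
      using inj_t by (rule inj_on_subset) (use assms set in auto)
    have dist': "distinct (a # \<tau>)" using dist set by simp
    define P where "P = (\<lambda>k. spans (X \<union> set (take k \<tau>)) a)"
    have "P (length \<tau>)" "\<not> P 0" using assms(3,4) set by (auto simp: P_def)
    then obtain q where q: "q < length \<tau>" "\<forall>i\<le>q. \<not> P i" "P (Suc q)"
      using ex_least_nat_less[of P "length \<tau>"] by auto
    have "t a \<noteq> t (\<tau> ! q)"
      using dist' q(1) by (auto simp: inj_on_eq_iff[OF inj])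
    then have cancel: "t (\<tau> ! q) * (1 / (t a - t (\<tau> ! q))) - t a * (1 / (t a - t (\<tau> ! q))) = - 1"
      by (simp add: divide_simps)
    have low: "nonbasis_prod X (insert_at a i \<tau>) = t (\<tau> ! q) * nonbasis_prod X \<tau>" if "i \<le> q" for i
    proof -
      let ?Y = "X \<union> set (take i \<tau>)" and ?v = "drop i \<tau>"
      have un: "?Y \<union> set (take k ?v) = X \<union> set (take (i + k) \<tau>)" for k
        by (simp add: take_add Un_assoc)
      have "nonbasis_prod (insert a ?Y) ?v = t (?v ! (q - i)) * nonbasis_prod ?Y ?v"
        using q that unfolding P_def by (intro nonbasis_prod_insert_exchange) (auto simp: un Suc_diff_le)
      moreover have "\<not> spans ?Y a" using q(2) that by (auto simp: P_def)
      ultimately have "nonbasis_prod X (insert_at a i \<tau>) =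
          t (\<tau> ! q) * (nonbasis_prod X (take i \<tau>) * nonbasis_prod ?Y ?v)"
        using that q(1) by (simp add: insert_at_def nonbasis_prod_append algebra_simps)
      then show ?thesis by (simp flip: nonbasis_prod_append)
    qed
    have high: "nonbasis_prod X (insert_at a i \<tau>) = t a * nonbasis_prod X \<tau>" if "Suc q \<le> i" for i
    proof -
      let ?Y = "X \<union> set (take i \<tau>)" and ?v = "drop i \<tau>"
      have "spans ?Y a"
        using q(3) unfolding P_def
        by (rule spans_mono) (use set_take_subset_set_take[OF that, of \<tau>] in auto)
      then have "nonbasis_prod X (insert_at a i \<tau>) =
          t a * (nonbasis_prod X (take i \<tau>) * nonbasis_prod ?Y ?v)"
        using nonbasis_prod_insert_spanned
        by (simp add: insert_at_def nonbasis_prod_append algebra_simps)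
      then show ?thesis by (simp flip: nonbasis_prod_append)
    qed
    have "{..length \<tau>} = {..q} \<union> {Suc q..length \<tau>}" using q(1) by auto
    then have "(\<Sum>i\<le>length \<tau>. nonbasis_prod X (insert_at a i \<tau>) * inv_diffs t (insert_at a i \<tau>)) =
        (\<Sum>i\<le>q. nonbasis_prod X (insert_at a i \<tau>) * inv_diffs t (insert_at a i \<tau>)) +
        (\<Sum>i=Suc q..length \<tau>. nonbasis_prod X (insert_at a i \<tau>) * inv_diffs t (insert_at a i \<tau>))"
      by (simp only:) (rule sum.union_disjoint, auto)
    also have "\<dots> = t (\<tau> ! q) * nonbasis_prod X \<tau> * (\<Sum>i\<le>q. inv_diffs t (insert_at a i \<tau>)) +
        t a * nonbasis_prod X \<tau> * (\<Sum>i=Suc q..length \<tau>. inv_diffs t (insert_at a i \<tau>))"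
      using low high by (simp add: sum_distrib_left)
    also have "\<dots> = nonbasis_prod X \<tau> * inv_diffs t \<tau> *
        (t (\<tau> ! q) * (1 / (t a - t (\<tau> ! q))) - t a * (1 / (t a - t (\<tau> ! q))))"
      unfolding sum_inv_diffs_insert_at_prefix[OF inj dist' q(1)]
        sum_inv_diffs_insert_at_suffix[OF inj dist' q(1)]
      by (simp add: algebra_simps)
    also have "\<dots> = - (nonbasis_prod X \<tau> * inv_diffs t \<tau>)"
      by (simp only: cancel) simp
    finally show ?thesis .
  qed
  then show ?thesis
    unfolding order_sum_def
    by (subst sum_permutations_insert_at[OF fin assms(2)]) (simp add: sum_negf)
qed

text \<open>Elements are deleted one at a time, each at the price of a sign, until a single one
  remains with value 1; this makes \<open>card B - 1\<close> signs. The strict inequality of ranks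
  excludes minors of rank zero, where the sum can be nonzero: a single loop \<open>b\<close> gives
  \<open>t b\<close>.\<close>

lemma order_sum_eq:
  assumes "B \<subseteq> E" "B \<noteq> {}" "rk X < rk (X \<union> B)"
  shows "order_sum X B =
    (if rk (X \<union> B) = Suc (rk X) \<and> (\<forall>b\<in>B. \<not> spans X b) then (-1) ^ (card B + 1) else 0)"
  using assms
proof (induction "card B" arbitrary: B rule: less_induct)
  case less
  have fin: "finite B" using less.prems(1) finite_E finite_subset by auto
  consider (single) b where "B = {b}"
    | (loop) b where "b \<in> B" "B \<noteq> {b}" "spans X b"
    | (coloop) b where "b \<in> B" "B \<noteq> {b}" "\<forall>b\<in>B. \<not> spans X b" "\<not> spans (X \<union> (B - {b})) b"
    | (delete) b where "b \<in> B" "B \<noteq> {b}" "\<forall>b\<in>B. \<not> spans X b" "spans (X \<union> (B - {b})) b"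
    using less.prems(2) by (metis all_not_in_conv)
  then show ?case
  proof cases
    case single
    then show ?thesis
      using less.prems(3) rk_insert_cases[of b X] by (auto simp: order_sum_def)
  next
    case loop
    then show ?thesis using order_sum_loop_or_coloop[of B b X] less.prems by auto
  next
    case coloop
    \<comment> \<open>A second element that is not a loop: together with the coloop \<open>b\<close>
      it forces rank at least two, so the right-hand side is zero as well.\<close>
    from coloop(1,2) obtain c where c: "c \<in> B" "c \<noteq> b" by blast
    have "rk (X \<union> B) = Suc (rk (X \<union> (B - {b})))"
      using coloop(1,4) rk_insert_cases[of b "X \<union> (B - {b})"]
      by (metis Un_insert_right insert_Diff)
    moreover have "rk (insert c X) \<le> rk (X \<union> (B - {b}))"
      using c by (intro rk_mono) auto
    moreover have "rk (insert c X) = Suc (rk X)"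
      using coloop(3) c rk_insert_cases by auto
    ultimately show ?thesis
      using order_sum_loop_or_coloop[of B b X] less.prems coloop by auto
  next
    case delete
    have rk: "rk (X \<union> (B - {b})) = rk (X \<union> B)"
      using delete(1,4) by (metis Un_insert_right insert_Diff)
    have "order_sum X B = - order_sum X (B - {b})"
      using order_sum_delete[of B b X] less.prems delete by auto
    also have "order_sum X (B - {b}) =
      (if rk (X \<union> B) = Suc (rk X) \<and> (\<forall>b\<in>B - {b}. \<not> spans X b) then (-1) ^ (card (B - {b}) + 1) else 0)"
      unfolding rk[symmetric]
    proof (rule less.hyps)
      show "card (B - {b}) < card B" using delete(1) fin by (metis card_Diff1_less)
      show "B - {b} \<subseteq> E" "B - {b} \<noteq> {}" using less.prems delete by auto
      show "rk X < rk (X \<union> (B - {b}))" using less.prems(3) rk by simp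
    qed
    moreover have "card B = Suc (card (B - {b}))"
      using delete(1) fin by (rule card.remove[rotated])
    ultimately show ?thesis
      using delete(3) by (simp split: if_splits)
  qed
qed

end


section \<open>Chains of subsets\<close>

definition prefix_diff :: "('a \<Rightarrow> 'f::field) \<Rightarrow> 'a list \<Rightarrow> 'a set \<Rightarrow> 'f" where
  "prefix_diff t w S =
    (if S = set (take (card S) w) \<and> 0 < card S \<and> card S < length w
     then t (w ! (card S - 1)) - t (w ! card S) else 0)"

lemma prefix_diff_append_eq:
  assumes "distinct (u @ v)" "u \<noteq> []" "v \<noteq> []"
  shows "prefix_diff t (u @ v) (set u) = t (last u) - t (hd v)"
  using assms by (auto simp: prefix_diff_def distinct_card nth_append last_conv_nth hd_conv_nth)

text \<open>As \<open>T\<close> is strictly larger than \<open>set u\<close>, both letters that are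
  compared come after \<open>u\<close>.\<close>

lemma prefix_diff_append_superset:
  assumes "distinct (u @ v)" "set u \<subset> T" "finite T"
  shows "prefix_diff t (u @ v) T = prefix_diff t v (T - set u)"
proof -
  let ?k = "card (T - set u)"
  have cu: "card (set u) = length u" using assms(1) by (simp add: distinct_card)
  have card: "card T = length u + ?k"
    using assms(2,3) cu card_Diff_subset[of "set u" T] card_mono[of T "set u"] by auto
  have k: "0 < ?k" using assms(2,3) by (auto simp: card_gt_0_iff)
  have "T = set (take (card T) (u @ v)) \<longleftrightarrow> T - set u = set (take ?k v)"
  proof -
    have "set (take (card T) (u @ v)) = set u \<union> set (take ?k v)" by (simp add: card)
    moreover have "set u \<inter> set (take ?k v) = {}"
      using assms(1) set_take_subset[of ?k v] by auto
    ultimately show ?thesis using assms(2) by blast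
  qed
  moreover have "(u @ v) ! (card T - 1) = v ! (?k - 1)" "(u @ v) ! card T = v ! ?k"
    using k by (auto simp: card nth_append)
  ultimately show ?thesis
    using k by (simp add: prefix_diff_def card)
qed

text \<open>Only orderings that begin with \<open>S\<close> contribute, and such an ordering is a
  pair: an ordering of \<open>S\<close> and one of the rest.\<close>

lemma sum_permutations_split:
  assumes "finite B" "S \<subseteq> B"
    and zero: "\<And>w. w \<in> permutations_of_set B \<Longrightarrow> set (take (card S) w) \<noteq> S \<Longrightarrow> g w = 0"
  shows "(\<Sum>w\<in>permutations_of_set B. g w) =
    (\<Sum>u\<in>permutations_of_set S. \<Sum>v\<in>permutations_of_set (B - S). g (u @ v))"
proof -
  have finS: "finite S" using assms(2,1) by (rule finite_subset)
  let ?P = "permutations_of_set S \<times> permutations_of_set (B - S)"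
  let ?W = "{w \<in> permutations_of_set B. set (take (card S) w) = S}"
  have len: "length u = card S" if "u \<in> permutations_of_set S" for u
    using that finS length_finite_permutations_of_set by auto
  have "bij_betw (\<lambda>(u, v). u @ v) ?P ?W"
  proof (rule bij_betw_imageI)
    show "inj_on (\<lambda>(u, v). u @ v) ?P"
      by (rule inj_onI) (use len in auto)
    show "(\<lambda>(u, v). u @ v) ` ?P = ?W"
    proof (intro equalityI subsetI)
      fix w assume "w \<in> (\<lambda>(u, v). u @ v) ` ?P"
      then obtain u v where "u \<in> permutations_of_set S" "v \<in> permutations_of_set (B - S)" "w = u @ v"
        by auto
      then show "w \<in> ?W"
        using len[of u] assms(2) by (auto simp: permutations_of_set_def)
    next
      fix w assume w: "w \<in> ?W"
      let ?u = "take (card S) w" and ?v = "drop (card S) w"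
      have d: "distinct (?u @ ?v)" "set (?u @ ?v) = B"
        using w by (auto simp: permutations_of_set_def simp del: set_append)
      moreover have "set ?u = S" using w by auto
      ultimately have "set ?v = B - S"
        unfolding set_append distinct_append by blast
      then have "(?u, ?v) \<in> ?P"
        using w by (auto simp: permutations_of_set_def)
      then show "w \<in> (\<lambda>(u, v). u @ v) ` ?P"
        by (rule image_eqI[rotated]) simp
    qed
  qed
  then have "(\<Sum>x\<in>?P. g (case x of (u, v) \<Rightarrow> u @ v)) = (\<Sum>w\<in>?W. g w)"
    by (rule sum.reindex_bij_betw)
  also have "\<dots> = (\<Sum>w\<in>permutations_of_set B. g w)"
    using zero by (intro sum.mono_neutral_left) auto
  finally show ?thesis by (simp add: sum.cartesian_product split_beta)
qed

definition subset_chain :: "'a set \<Rightarrow> 'a set set \<Rightarrow> bool" where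
  "subset_chain B C \<longleftrightarrow> finite C \<and> (\<forall>S\<in>C. S \<noteq> {} \<and> S \<subset> B) \<and> (\<forall>S\<in>C. \<forall>T\<in>C. S \<subseteq> T \<or> T \<subseteq> S)"

text \<open>The chain that remains after contracting its least member \<open>S\<close>, as a chain
  of subsets of the remaining ground set.\<close>

definition peel :: "'a set \<Rightarrow> 'a set set \<Rightarrow> 'a set set" where
  "peel S C = (\<lambda>T. T - S) ` (C - {S})"

lemma subset_chain_least:
  assumes "subset_chain B C" "C \<noteq> {}"
  obtains S where "S \<in> C" "\<forall>T\<in>C. S \<subseteq> T"
proof -
  obtain S where "S \<in> C" "\<forall>T\<in>C. T \<subseteq> S \<longrightarrow> S = T"
    using assms finite_has_minimal[of C] by (auto simp: subset_chain_def)
  then show thesis using assms(1) that unfolding subset_chain_def by (metis order_refl)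
qed

lemma inj_on_peel: "\<forall>T\<in>C. S \<subseteq> T \<Longrightarrow> inj_on (\<lambda>T. T - S) (C - {S})"
  by (rule inj_onI) blast

lemma
  assumes "subset_chain B C" "S \<in> C" "\<forall>T\<in>C. S \<subseteq> T"
  shows subset_chain_peel: "subset_chain (B - S) (peel S C)"
    and card_peel: "card C = Suc (card (peel S C))"
proof -
  have fin: "finite C" using assms(1) by (simp add: subset_chain_def)
  show "subset_chain (B - S) (peel S C)"
    unfolding subset_chain_def
  proof (intro conjI ballI)
    show "finite (peel S C)" using fin by (simp add: peel_def)
  next
    fix T' assume "T' \<in> peel S C"
    then obtain T where "T \<in> C" "T \<noteq> S" "T' = T - S" by (auto simp: peel_def)
    moreover from this have "S \<subseteq> T" "T \<subset> B" using assms by (auto simp: subset_chain_def)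
    ultimately show "T' \<noteq> {}" "T' \<subset> B - S" by blast+
  next
    fix T1 T2 assume "T1 \<in> peel S C" "T2 \<in> peel S C"
    then show "T1 \<subseteq> T2 \<or> T2 \<subseteq> T1"
      using assms(1) unfolding peel_def subset_chain_def by (smt (verit) Diff_iff Diff_mono imageE order_refl)
  qed
  show "card C = Suc (card (peel S C))"
    unfolding peel_def card_image[OF inj_on_peel[OF assms(3)]]
    using fin assms(2) by (rule card.remove)
qed

section \<open>Evaluation of squarefree chain monomials\<close>

context weighted_matroid
begin

definition chain_sum :: "'a set \<Rightarrow> 'a set \<Rightarrow> 'a set set \<Rightarrow> 'f" where
  "chain_sum X B C = (\<Sum>w\<in>permutations_of_set B.
     nonbasis_prod X w * inv_diffs t w * (\<Prod>S\<in>C. prefix_diff t w S))"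

lemma chain_sum_empty: "chain_sum X B {} = order_sum X B"
  by (simp add: chain_sum_def order_sum_def)

text \<open>The factor at \<open>S\<close> kills every ordering that does not begin with
  \<open>S\<close>. On the others it equals the difference across the junction of \<open>u\<close>
  and \<open>v\<close>, which is exactly the denominator that couples the two parts, so the sum
  becomes a product.\<close>

lemma chain_sum_peel:
  assumes "B \<subseteq> E" "subset_chain B C" "S \<in> C" "\<forall>T\<in>C. S \<subseteq> T"
  shows "chain_sum X B C = order_sum X S * chain_sum (X \<union> S) (B - S) (peel S C)"
proof -
  have finB: "finite B" using assms(1) finite_E finite_subset by auto
  have S: "S \<noteq> {}" "S \<subset> B" and finC: "finite C"
    using assms(2,3) by (auto simp: subset_chain_def)
  have "chain_sum X B C = (\<Sum>u\<in>permutations_of_set S. \<Sum>v\<in>permutations_of_set (B - S).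
      nonbasis_prod X (u @ v) * inv_diffs t (u @ v) * (\<Prod>S\<in>C. prefix_diff t (u @ v) S))"
    unfolding chain_sum_def
  proof (rule sum_permutations_split[OF finB])
    fix w assume "set (take (card S) w) \<noteq> S"
    then have "prefix_diff t w S = 0" by (auto simp: prefix_diff_def)
    then have "(\<Prod>S\<in>C. prefix_diff t w S) = 0" using finC assms(3) by auto
    then show "nonbasis_prod X w * inv_diffs t w * (\<Prod>S\<in>C. prefix_diff t w S) = 0" by simp
  qed (use S in auto)
  also have "\<dots> = (\<Sum>u\<in>permutations_of_set S. \<Sum>v\<in>permutations_of_set (B - S).
      (nonbasis_prod X u * inv_diffs t u) *
      (nonbasis_prod (X \<union> S) v * inv_diffs t v * (\<Prod>S\<in>peel S C. prefix_diff t v S)))"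
  proof (intro sum.cong refl)
    fix u v assume "u \<in> permutations_of_set S" "v \<in> permutations_of_set (B - S)"
    then have u: "set u = S" "distinct u" and v: "set v = B - S" "distinct v"
      by (auto dest: permutations_of_setD)
    then have ne: "u \<noteq> []" "v \<noteq> []" and dist: "distinct (u @ v)" using S by auto
    have "last u \<in> set u" "hd v \<in> set v" using ne by auto
    then have "last u \<in> E" "hd v \<in> E" "last u \<noteq> hd v"
      using u v S assms(1) by auto
    then have neq: "t (last u) \<noteq> t (hd v)"
      using inj_on_eq_iff[OF inj_t] by blast
    have "(\<Prod>T\<in>C. prefix_diff t (u @ v) T) =
        prefix_diff t (u @ v) S * (\<Prod>T\<in>C - {S}. prefix_diff t (u @ v) T)"
      using finC assms(3) by (rule prod.remove)
    also have "(\<Prod>T\<in>C - {S}. prefix_diff t (u @ v) T) = (\<Prod>T\<in>C - {S}. prefix_diff t v (T - S))"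
    proof (rule prod.cong[OF refl])
      fix T assume "T \<in> C - {S}"
      then have "set u \<subset> T" "T \<subset> B"
        using assms(2,4) u unfolding subset_chain_def by blast+
      moreover from this have "finite T" using finB finite_subset[of T B] by auto
      ultimately show "prefix_diff t (u @ v) T = prefix_diff t v (T - S)"
        using prefix_diff_append_superset[OF dist, of T t] u(1) by simp
    qed
    also have "\<dots> = (\<Prod>T\<in>peel S C. prefix_diff t v T)"
      unfolding peel_def by (simp add: prod.reindex[OF inj_on_peel[OF assms(4)]])
    also have "prefix_diff t (u @ v) S = t (last u) - t (hd v)"
      using prefix_diff_append_eq[OF dist ne] u(1) by simp
    finally have "(\<Prod>T\<in>C. prefix_diff t (u @ v) T) =
      (t (last u) - t (hd v)) * (\<Prod>T\<in>peel S C. prefix_diff t v T)" .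
    then show "nonbasis_prod X (u @ v) * inv_diffs t (u @ v) * (\<Prod>S\<in>C. prefix_diff t (u @ v) S) =
      (nonbasis_prod X u * inv_diffs t u) *
      (nonbasis_prod (X \<union> S) v * inv_diffs t v * (\<Prod>S\<in>peel S C. prefix_diff t v S))"
      using neq by (simp add: nonbasis_prod_append inv_diffs_append[OF ne] u(1))
  qed
  also have "\<dots> = order_sum X S * chain_sum (X \<union> S) (B - S) (peel S C)"
    unfolding order_sum_def chain_sum_def by (rule sum_product[symmetric])
  finally show ?thesis .
qed

text \<open>In the minor with \<open>X\<close> contracted and ground set \<open>B\<close>, the empty
  set and all members of \<open>C\<close> are flats.\<close>

definition closed_chain :: "'a set \<Rightarrow> 'a set \<Rightarrow> 'a set set \<Rightarrow> bool" where
  "closed_chain X B C \<longleftrightarrow> (\<forall>b\<in>B. \<not> spans X b) \<and> (\<forall>S\<in>C. \<forall>b\<in>B - S. \<not> spans (X \<union> S) b)"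

lemma closed_chain_peel:
  assumes "S \<in> C" "\<forall>T\<in>C. S \<subseteq> T" "S \<subseteq> B"
  shows "closed_chain X B C \<longleftrightarrow> (\<forall>b\<in>S. \<not> spans X b) \<and> closed_chain (X \<union> S) (B - S) (peel S C)"
proof
  assume cl: "closed_chain X B C"
  have "\<not> spans (X \<union> S \<union> T') b" if "T' \<in> peel S C" "b \<in> B - S - T'" for T' b
  proof -
    from that(1) obtain T where T: "T \<in> C" "T' = T - S" by (auto simp: peel_def)
    then have "X \<union> S \<union> T' = X \<union> T" "b \<in> B - T" using assms(2) that(2) by auto
    then show ?thesis using cl T(1) by (auto simp: closed_chain_def)
  qed
  then show "(\<forall>b\<in>S. \<not> spans X b) \<and> closed_chain (X \<union> S) (B - S) (peel S C)"
    using cl assms(1,3) by (auto simp: closed_chain_def)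
next
  assume cl: "(\<forall>b\<in>S. \<not> spans X b) \<and> closed_chain (X \<union> S) (B - S) (peel S C)"
  have "\<not> spans X b" if "b \<in> B" for b
  proof (cases "b \<in> S")
    case False
    then have "\<not> spans (X \<union> S) b" using cl that by (auto simp: closed_chain_def)
    then show ?thesis using spans_mono[of b X "X \<union> S"] by auto
  qed (use cl in auto)
  moreover have "\<not> spans (X \<union> T) b" if "T \<in> C" "b \<in> B - T" for T b
  proof (cases "T = S")
    case False
    then have "T - S \<in> peel S C" "b \<in> B - S - (T - S)" "X \<union> S \<union> (T - S) = X \<union> T"
      using that assms(2) by (auto simp: peel_def)
    then show ?thesis using cl unfolding closed_chain_def by metis
  qed (use cl that in \<open>auto simp: closed_chain_def\<close>)
  ultimately show "closed_chain X B C" by (auto simp: closed_chain_def)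
qed

text \<open>The rank rises strictly at every step from \<open>X\<close> through the chain to
  \<open>B\<close>. Applied to the peeled chain, this excludes a closed chain of maximal length
  whose first step raises the rank by more than one.\<close>

lemma closed_chain_rk:
  assumes "subset_chain B C" "B \<noteq> {}" "closed_chain X B C"
  shows "rk X + card C < rk (X \<union> B)"
  using assms
proof (induction "card C" arbitrary: X B C)
  case 0
  then obtain b where "b \<in> B" "\<not> spans X b" by (auto simp: closed_chain_def)
  then show ?case
    using 0 rk_mono[of "insert b X" "X \<union> B"] rk_insert_cases[of b X] by auto
next
  case (Suc m)
  then have "C \<noteq> {}" by auto
  with Suc.prems(1) obtain S where S: "S \<in> C" "\<forall>T\<in>C. S \<subseteq> T" by (rule subset_chain_least)
  then have SB: "S \<noteq> {}" "S \<subset> B" using Suc.prems(1) by (auto simp: subset_chain_def)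
  note card = card_peel[OF Suc.prems(1) S]
  have cl: "\<forall>b\<in>S. \<not> spans X b" "closed_chain (X \<union> S) (B - S) (peel S C)"
    using closed_chain_peel[OF S, of B X] SB Suc.prems(3) by auto
  have "rk (X \<union> S) + card (peel S C) < rk (X \<union> S \<union> (B - S))"
    using Suc.hyps(1)[of "peel S C" "B - S" "X \<union> S"] card Suc.hyps(2)
      subset_chain_peel[OF Suc.prems(1) S] SB cl(2) by auto
  moreover have "X \<union> S \<union> (B - S) = X \<union> B" using SB by auto
  moreover have "rk X < rk (X \<union> S)"
  proof -
    obtain s where "s \<in> S" using SB by auto
    then show ?thesis
      using cl(1) rk_mono[of "insert s X" "X \<union> S"] rk_insert_cases[of s X] by force
  qed
  ultimately show ?case using card by simp
qed

text \<open>Peeling off the least member leaves a factor from \<open>order_sum_eq\<close>, which is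
  nonzero only if the rank rises by one, and a shorter chain. The signs multiply correctly because
  \<open>card B\<close> is additive and the chain loses one member.\<close>

lemma chain_sum_eq:
  assumes "B \<subseteq> E" "B \<noteq> {}" "subset_chain B C" "rk X + card C < rk (X \<union> B)"
  shows "chain_sum X B C =
    (if closed_chain X B C \<and> rk (X \<union> B) = Suc (rk X + card C)
     then (-1) ^ (card B + card C + 1) else 0)"
  using assms
proof (induction "card C" arbitrary: X B C)
  case 0
  then have "C = {}" by (auto simp: subset_chain_def)
  then show ?case
    using order_sum_eq[of B X] 0 by (auto simp: chain_sum_empty closed_chain_def)
next
  case (Suc m)
  then have "C \<noteq> {}" by auto
  with Suc.prems(3) obtain S where S: "S \<in> C" "\<forall>T\<in>C. S \<subseteq> T" by (rule subset_chain_least)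
  then have SB: "S \<noteq> {}" "S \<subset> B" using Suc.prems(3) by (auto simp: subset_chain_def)
  note card = card_peel[OF Suc.prems(3) S]
  note chain = subset_chain_peel[OF Suc.prems(3) S]
  note eq = chain_sum_peel[OF Suc.prems(1,3) S, of X]
  have XB: "X \<union> S \<union> (B - S) = X \<union> B" using SB by auto
  have IH: "chain_sum (X \<union> S) (B - S) (peel S C) =
    (if closed_chain (X \<union> S) (B - S) (peel S C) \<and> rk (X \<union> B) = Suc (rk (X \<union> S) + card (peel S C))
     then (-1) ^ (card (B - S) + card (peel S C) + 1) else 0)"
    if "rk (X \<union> S) + card (peel S C) < rk (X \<union> B)"
    unfolding XB[symmetric]
  proof (rule Suc.hyps(1))
    show "m = card (peel S C)" using card Suc.hyps(2) by simp
    show "B - S \<subseteq> E" "B - S \<noteq> {}" using Suc.prems(1) SB by auto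
    show "rk (X \<union> S) + card (peel S C) < rk (X \<union> S \<union> (B - S))" using that XB by simp
  qed (rule chain)
  have cl: "closed_chain X B C \<longleftrightarrow> (\<forall>b\<in>S. \<not> spans X b) \<and> closed_chain (X \<union> S) (B - S) (peel S C)"
    using closed_chain_peel[OF S, of B X] SB by auto
  have SE: "S \<subseteq> E" using SB Suc.prems(1) by auto
  have mono: "rk X \<le> rk (X \<union> S)" by (rule rk_mono) auto
  show ?case
  proof (cases "rk (X \<union> S) = Suc (rk X)")
    case True
    note os = order_sum_eq[OF SE SB(1), of X]
    have finB: "finite B" using Suc.prems(1) finite_E finite_subset by auto
    have "card B = card S + card (B - S)"
      using card_Un_disjoint[of S "B - S"] SB finB finite_subset[of S B]
      by (auto simp: Un_absorb1)
    then show ?thesis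
      using eq IH os Suc.prems(4) card cl True by (auto simp: power_add)
  next
    case False
    \<comment> \<open>If \<open>X\<close> spans \<open>S\<close>, nothing is known about
      \<open>order_sum X S\<close>, but the second factor vanishes: the rank left over exceeds by at
      least one what the peeled chain can use up. If the rank jumps by two or more, the first factor
      vanishes.\<close>
    have zero: "chain_sum X B C = 0"
    proof (cases "rk (X \<union> S) = rk X")
      case True
      then show ?thesis using IH eq Suc.prems(4) card by auto
    next
      case neq: False
      then show ?thesis using order_sum_eq[OF SE SB(1), of X] False mono eq by auto
    qed
    have "\<not> (closed_chain X B C \<and> rk (X \<union> B) = Suc (rk X + card C))"
    proof
      assume a: "closed_chain X B C \<and> rk (X \<union> B) = Suc (rk X + card C)"
      have "rk (X \<union> S) + card (peel S C) < rk (X \<union> B)"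
        using closed_chain_rk[OF chain, of "X \<union> S"] a cl SB unfolding XB by auto
      moreover have "rk X < rk (X \<union> S)"
        using closed_chain_rk[of S "{}" X] a cl SB by (auto simp: closed_chain_def subset_chain_def)
      ultimately show False using a card False by auto
    qed
    then show ?thesis using zero by simp
  qed
qed

end


section \<open>Localization of monomials\<close>

definition mono_deg :: "('v \<Rightarrow>\<^sub>0 nat) \<Rightarrow> nat" where
  "mono_deg m = (\<Sum>v\<in>Poly_Mapping.keys m. Poly_Mapping.lookup m v)"

definition mono_eval :: "('v \<Rightarrow> 'f::comm_semiring_1) \<Rightarrow> ('v \<Rightarrow>\<^sub>0 nat) \<Rightarrow> 'f" where
  "mono_eval f m = (\<Prod>v\<in>Poly_Mapping.keys m. f v ^ Poly_Mapping.lookup m v)"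

lemma keys_add_nat:
  "Poly_Mapping.keys (a + b :: 'v \<Rightarrow>\<^sub>0 nat) = Poly_Mapping.keys a \<union> Poly_Mapping.keys b"
  by (auto simp: in_keys_iff lookup_add)

lemma mono_deg_superset:
  "finite K \<Longrightarrow> Poly_Mapping.keys m \<subseteq> K \<Longrightarrow> mono_deg m = (\<Sum>v\<in>K. Poly_Mapping.lookup m v)"
  unfolding mono_deg_def by (intro sum.mono_neutral_left) (auto simp: in_keys_iff)

lemma mono_eval_superset:
  "finite K \<Longrightarrow> Poly_Mapping.keys m \<subseteq> K \<Longrightarrow>
    mono_eval f m = (\<Prod>v\<in>K. f v ^ Poly_Mapping.lookup m v)"
  unfolding mono_eval_def by (intro prod.mono_neutral_left) (auto simp: in_keys_iff)

lemma mono_deg_add: "mono_deg (a + b) = mono_deg a + mono_deg b"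
proof -
  let ?K = "Poly_Mapping.keys a \<union> Poly_Mapping.keys b"
  have "mono_deg (a + b) = (\<Sum>v\<in>?K. Poly_Mapping.lookup (a + b) v)"
    by (rule mono_deg_superset) (auto simp: keys_add_nat)
  then show ?thesis
    by (simp add: lookup_add sum.distrib mono_deg_superset[of ?K a] mono_deg_superset[of ?K b])
qed

lemma mono_eval_add: "mono_eval f (a + b) = mono_eval f a * mono_eval f b"
proof -
  let ?K = "Poly_Mapping.keys a \<union> Poly_Mapping.keys b"
  have "mono_eval f (a + b) = (\<Prod>v\<in>?K. f v ^ Poly_Mapping.lookup (a + b) v)"
    by (rule mono_eval_superset) (auto simp: keys_add_nat)
  then show ?thesis
    by (simp add: lookup_add power_add prod.distrib mono_eval_superset[of ?K a]
        mono_eval_superset[of ?K b])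
qed

lemma mono_deg_zero [simp]: "mono_deg 0 = 0" by (simp add: mono_deg_def)
lemma mono_eval_zero [simp]: "mono_eval f 0 = 1" by (simp add: mono_eval_def)
lemma mono_deg_single [simp]: "mono_deg (Poly_Mapping.single v k) = k"
  by (simp add: mono_deg_def)
lemma mono_eval_single [simp]: "mono_eval f (Poly_Mapping.single v k) = f v ^ k"
  by (simp add: mono_eval_def)

lemma mono_eval_eq_0:
  fixes f :: "'v \<Rightarrow> 'f::semidom"
  assumes "v \<in> Poly_Mapping.keys m" "f v = 0"
  shows "mono_eval f m = 0"
  using assms by (auto simp: mono_eval_def in_keys_iff)

lemma card_keys_le_mono_deg: "card (Poly_Mapping.keys m) \<le> mono_deg m"
proof -
  have "card (Poly_Mapping.keys m) = (\<Sum>v\<in>Poly_Mapping.keys m. 1)" by simp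
  also have "\<dots> \<le> mono_deg m"
    unfolding mono_deg_def by (intro sum_mono) (auto simp: in_keys_iff)
  finally show ?thesis .
qed

text \<open>Splitting off one copy of a repeated variable keeps the support, so in the rewriting
  below the support can change only through the variable that replaces it.\<close>

lemma mono_split_square:
  fixes m :: "'v \<Rightarrow>\<^sub>0 nat"
  assumes "2 \<le> Poly_Mapping.lookup m v"
  obtains m' where "m = m' + Poly_Mapping.single v 1" "Poly_Mapping.keys m' = Poly_Mapping.keys m"
proof
  let ?m' = "m - Poly_Mapping.single v 1"
  show "m = ?m' + Poly_Mapping.single v 1"
    using assms
    by (intro poly_mapping_eqI) (auto simp: lookup_add lookup_minus lookup_single when_def)
  show "Poly_Mapping.keys ?m' = Poly_Mapping.keys m"
    using assms by (auto simp: in_keys_iff lookup_minus lookup_single when_def split: if_splits)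
qed

text \<open>Take \<open>i\<close> in \<open>F\<close> outside the largest member below
  \<open>F\<close>, and \<open>j\<close> outside \<open>F\<close> in the smallest member above it,
  or in \<open>E\<close> if there is none. In the linear relation for \<open>i\<close> and
  \<open>j\<close>, after cancelling common sets, \<open>F\<close> is then the only member of the
  chain.\<close>

lemma chain_separate:
  assumes "finite C" "\<forall>S\<in>C. \<forall>T\<in>C. S \<subseteq> T \<or> T \<subseteq> S" "\<forall>S\<in>C. S \<subseteq> E" "F \<in> C" "F \<noteq> {}" "F \<noteq> E"
  obtains i j where "i \<in> F" "j \<in> E" "j \<notin> F" "\<forall>G\<in>C. i \<in> G \<and> j \<notin> G \<longrightarrow> G = F"
    "\<forall>G\<in>C. j \<in> G \<longrightarrow> i \<in> G"
proof -
  have "\<exists>i\<in>F. \<forall>G\<in>C. G \<subset> F \<longrightarrow> i \<notin> G"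
  proof (cases "{G \<in> C. G \<subset> F} = {}")
    case False
    then obtain H where H: "H \<in> {G \<in> C. G \<subset> F}" "\<forall>G\<in>{G \<in> C. G \<subset> F}. H \<subseteq> G \<longrightarrow> H = G"
      using finite_has_maximal[of "{G \<in> C. G \<subset> F}"] assms(1) by auto
    then obtain i where "i \<in> F" "i \<notin> H" by blast
    moreover have "G \<subseteq> H" if "G \<in> C" "G \<subset> F" for G
      using H that assms(2) by (metis (mono_tags, lifting) mem_Collect_eq order_refl)
    ultimately show ?thesis by blast
  qed (use assms(5) in auto)
  then obtain i where i: "i \<in> F" "\<forall>G\<in>C. G \<subset> F \<longrightarrow> i \<notin> G" by auto
  have "\<exists>j\<in>E - F. \<forall>G\<in>C. F \<subset> G \<longrightarrow> j \<in> G"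
  proof (cases "{G \<in> C. F \<subset> G} = {}")
    case False
    then obtain H where H: "H \<in> {G \<in> C. F \<subset> G}" "\<forall>G\<in>{G \<in> C. F \<subset> G}. G \<subseteq> H \<longrightarrow> H = G"
      using finite_has_minimal[of "{G \<in> C. F \<subset> G}"] assms(1) by auto
    then obtain j where "j \<in> H" "j \<notin> F" by blast
    moreover have "H \<subseteq> G" if "G \<in> C" "F \<subset> G" for G
      using H that assms(2) by (metis (mono_tags, lifting) mem_Collect_eq order_refl)
    ultimately show ?thesis using H(1) assms(3) by blast
  qed (use assms(3,4,6) in auto)
  then obtain j where j: "j \<in> E - F" "\<forall>G\<in>C. F \<subset> G \<longrightarrow> j \<in> G" by auto
  show thesis
  proof (rule that[OF i(1), of j])
    have cases: "G \<subset> F \<or> G = F \<or> F \<subset> G" if "G \<in> C" for G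
      using that assms(2,4) by (metis psubsetI)
    show "\<forall>G\<in>C. i \<in> G \<and> j \<notin> G \<longrightarrow> G = F"
      using cases i(2) j(2) by metis
    show "\<forall>G\<in>C. j \<in> G \<longrightarrow> i \<in> G"
      using cases i(1) j(1) by (metis DiffE psubsetE subsetD)
  qed (use j in auto)
qed

definition proper_subsets :: "'a set \<Rightarrow> 'a set set" where
  "proper_subsets E = {S. S \<noteq> {} \<and> S \<subset> E}"

lemma finite_proper_subsets: "finite E \<Longrightarrow> finite (proper_subsets E)"
  unfolding proper_subsets_def by (rule finite_subset[of _ "Pow E"]) auto

text \<open>Two prefixes of one list are nested; hence the quadratic relations hold at every
  ordering.\<close>

lemma prefix_diff_incomparable:
  assumes "\<not> S \<subseteq> T" "\<not> T \<subseteq> S"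
  shows "prefix_diff t w S = 0 \<or> prefix_diff t w T = 0"
proof -
  have "S \<subseteq> T \<or> T \<subseteq> S" if "S = set (take (card S) w)" "T = set (take (card T) w)"
    using that set_take_subset_set_take[of "card S" "card T" w]
      set_take_subset_set_take[of "card T" "card S" w]
    by (metis nat_le_linear)
  then show ?thesis using assms by (auto simp: prefix_diff_def)
qed

text \<open>Along a fixed ordering the proper nonempty prefixes are indexed by their length, so a
  sum over all subsets collapses to one that can telescope.\<close>

lemma sum_prefix_diff:
  assumes "finite E" "w \<in> permutations_of_set E"
  shows "(\<Sum>S\<in>proper_subsets E. h S * prefix_diff t w S) =
    (\<Sum>k<length w - 1. h (set (take (Suc k) w)) * (t (w ! k) - t (w ! Suc k)))"
proof -
  have w: "set w = E" "distinct w" using assms(2) by (auto dest: permutations_of_setD)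
  have len: "length w = card E" using w by (metis distinct_card)
  let ?P = "\<lambda>k. set (take (Suc k) w)" and ?N = "{..<length w - 1}"
  have card: "card (?P k) = Suc k" if "k \<in> ?N" for k
    using that w(2) by (subst distinct_card) auto
  have inj: "inj_on ?P ?N" by (rule inj_onI) (metis card nat.inject)
  have "(\<Sum>S\<in>proper_subsets E. h S * prefix_diff t w S) = (\<Sum>S\<in>?P ` ?N. h S * prefix_diff t w S)"
  proof (rule sum.mono_neutral_right)
    show "?P ` ?N \<subseteq> proper_subsets E"
    proof (rule image_subsetI)
      fix k assume k: "k \<in> ?N"
      then have "?P k \<noteq> {}" "card (?P k) < card E" using card[OF k] len by force+
      moreover have "?P k \<subseteq> E" using w set_take_subset by metis
      ultimately show "?P k \<in> proper_subsets E" by (auto simp: proper_subsets_def)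
    qed
    show "\<forall>S\<in>proper_subsets E - ?P ` ?N. h S * prefix_diff t w S = 0"
    proof
      fix S assume S: "S \<in> proper_subsets E - ?P ` ?N"
      have "prefix_diff t w S = 0"
      proof (rule ccontr)
        assume "prefix_diff t w S \<noteq> 0"
        then have "S = set (take (card S) w)" "0 < card S" "card S < length w"
          by (auto simp: prefix_diff_def split: if_splits)
        then have "S = ?P (card S - 1)" "card S - 1 \<in> ?N" by auto
        then show False using S by blast
      qed
      then show "h S * prefix_diff t w S = 0" by simp
    qed
  qed (use assms finite_proper_subsets in auto)
  also have "\<dots> = (\<Sum>k\<in>?N. h (?P k) * prefix_diff t w (?P k))"
    unfolding sum.reindex[OF inj] by simp
  also have "\<dots> = (\<Sum>k\<in>?N. h (?P k) * (t (w ! k) - t (w ! Suc k)))"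
  proof (rule sum.cong[OF refl])
    fix k assume k: "k \<in> ?N"
    have "prefix_diff t w (?P k) = t (w ! k) - t (w ! Suc k)"
      using k unfolding prefix_diff_def card[OF k] by auto
    then show "h (?P k) * prefix_diff t w (?P k) = h (?P k) * (t (w ! k) - t (w ! Suc k))" by simp
  qed
  finally show ?thesis .
qed

text \<open>The prefixes that contain \<open>i\<close> start at its position, and the differences
  telescope from there to the last letter. In the difference for \<open>i\<close> and
  \<open>j\<close> the last letter drops out: the linear relation holds up to the constant
  \<open>t i - t j\<close>.\<close>

lemma sum_prefix_diff_containing:
  assumes "finite E" "w \<in> permutations_of_set E" "i \<in> E"
  shows "(\<Sum>S\<in>{S \<in> proper_subsets E. i \<in> S}. prefix_diff t w S) = t i - t (last w)"
proof -
  have w: "set w = E" "distinct w" using assms(2) by (auto dest: permutations_of_setD)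
  obtain p where p: "p < length w" "w ! p = i" using assms(3) w by (metis in_set_conv_nth)
  have mem: "i \<in> set (take (Suc k) w) \<longleftrightarrow> p \<le> k" if "k < length w - 1" for k
  proof
    show "p \<le> k" if "i \<in> set (take (Suc k) w)"
      using that p w(2) by (auto simp: in_set_conv_nth nth_eq_iff_index_eq)
    show "i \<in> set (take (Suc k) w)" if "p \<le> k"
      using that p by (auto simp: in_set_conv_nth intro!: exI[of _ p])
  qed
  have "(\<Sum>S\<in>{S \<in> proper_subsets E. i \<in> S}. prefix_diff t w S) =
      (\<Sum>S\<in>proper_subsets E. (if i \<in> S then 1 else 0) * prefix_diff t w S)"
    unfolding sum.inter_filter[OF finite_proper_subsets[OF assms(1)]] by (intro sum.cong) auto
  also have "\<dots> = (\<Sum>k<length w - 1. (if p \<le> k then 1 else 0) * (t (w ! k) - t (w ! Suc k)))"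
    unfolding sum_prefix_diff[OF assms(1,2)] using mem by (intro sum.cong) auto
  also have "\<dots> = (\<Sum>k\<in>{p..<length w - 1}. t (w ! k) - t (w ! Suc k))"
    by (rule sum.mono_neutral_cong_right) auto
  also have "\<dots> = - (\<Sum>k\<in>{p..<length w - 1}. t (w ! Suc k) - t (w ! k))"
    by (simp flip: sum_negf)
  also have "\<dots> = t i - t (last w)"
    using p sum_Suc_diff'[of p "length w - 1" "\<lambda>k. t (w ! k)"]
    by (subst last_conv_nth) auto
  finally show ?thesis .
qed

lemma sum_indicator_diff:
  fixes f :: "'a set \<Rightarrow> 'f::ab_group_add"
  assumes "finite P"
  shows "(\<Sum>S\<in>{S \<in> P. i \<in> S}. f S) - (\<Sum>S\<in>{S \<in> P. j \<in> S}. f S) =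
    (\<Sum>S\<in>{S \<in> P. i \<in> S \<and> j \<notin> S}. f S) - (\<Sum>S\<in>{S \<in> P. j \<in> S \<and> i \<notin> S}. f S)"
proof -
  have split: "(\<Sum>S\<in>{S \<in> P. a \<in> S}. f S) =
      (\<Sum>S\<in>{S \<in> P. a \<in> S \<and> b \<notin> S}. f S) + (\<Sum>S\<in>{S \<in> P. a \<in> S \<and> b \<in> S}. f S)" for a b
  proof -
    have "{S \<in> P. a \<in> S} = {S \<in> P. a \<in> S \<and> b \<notin> S} \<union> {S \<in> P. a \<in> S \<and> b \<in> S}" by auto
    then show ?thesis using assms by (simp only:) (rule sum.union_disjoint, auto)
  qed
  show ?thesis unfolding split[of i j] split[of j i] by (simp add: conj_commute)
qed

section \<open>The localized functional and its vanishing below top degree\<close>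

locale loopless_weighted_matroid = weighted_matroid E \<I> t
  for E :: "'a set" and \<I> :: "'a set set" and t :: "'a \<Rightarrow> 'f::field" +
  fixes r :: nat
  assumes loopless: "loopless E \<I>" and rk_E: "mrank \<I> E = Suc r"
begin

text \<open>Defined on arbitrary functions of an ordering, not only on polynomials in the
  \<open>prefix_diff\<close>, because \<open>t (last w)\<close> occurs as a factor and cancels only
  later, in differences.\<close>

definition localize :: "('a list \<Rightarrow> 'f) \<Rightarrow> 'f" where
  "localize \<phi> = (\<Sum>w\<in>permutations_of_set E. nonbasis_prod {} w * inv_diffs t w * \<phi> w)"

lemma localize_cong:
  "(\<And>w. w \<in> permutations_of_set E \<Longrightarrow> \<phi> w = \<psi> w) \<Longrightarrow> localize \<phi> = localize \<psi>"
  unfolding localize_def by (rule sum.cong) auto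

lemma localize_add: "localize (\<lambda>w. \<phi> w + \<psi> w) = localize \<phi> + localize \<psi>"
  by (simp add: localize_def sum.distrib algebra_simps)

lemma localize_diff: "localize (\<lambda>w. \<phi> w - \<psi> w) = localize \<phi> - localize \<psi>"
  by (simp add: localize_def sum_subtractf algebra_simps)

lemma localize_cmult: "localize (\<lambda>w. c * \<phi> w) = c * localize \<phi>"
  by (simp add: localize_def sum_distrib_left algebra_simps)

lemma localize_sum: "localize (\<lambda>w. \<Sum>i\<in>A. \<phi> i w) = (\<Sum>i\<in>A. localize (\<phi> i))"
  unfolding localize_def sum_distrib_left by (rule sum.swap)

abbreviation pd :: "'a list \<Rightarrow> 'a set \<Rightarrow> 'f" where "pd \<equiv> prefix_diff t"

lemma E_nonempty: "E \<noteq> {}"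
proof
  assume "E = {}"
  moreover obtain X where "X \<subseteq> E" "card X = rk E" by (rule rk_attained)
  ultimately show False using rk_E by simp
qed

lemma not_spans_empty: "b \<in> E \<Longrightarrow> \<not> spans {} b"
  using loopless card_le_rk[of "{b}" "{b}"] rk_empty by (auto simp: loopless_def)

lemma proper_flats_subset: "proper_flats E \<I> \<subseteq> proper_subsets E"
  by (auto simp: proper_flats_def proper_subsets_def)

lemma closed_chain_iff_flats:
  "C \<subseteq> proper_subsets E \<Longrightarrow> closed_chain {} E C \<longleftrightarrow> C \<subseteq> proper_flats E \<I>"
  by (auto simp: closed_chain_def not_spans_empty proper_flats_iff proper_subsets_def)

lemma localize_chain:
  assumes "C \<subseteq> proper_subsets E" "\<forall>S\<in>C. \<forall>T\<in>C. S \<subseteq> T \<or> T \<subseteq> S" "card C \<le> r"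
  shows "localize (\<lambda>w. \<Prod>S\<in>C. pd w S) =
    (if C \<subseteq> proper_flats E \<I> \<and> card C = r then (-1) ^ (card E + r + 1) else 0)"
proof -
  have "subset_chain E C"
    using assms finite_subset[OF assms(1) finite_proper_subsets[OF finite_E]]
    by (auto simp: subset_chain_def proper_subsets_def)
  then have "chain_sum {} E C = (if closed_chain {} E C \<and> rk ({} \<union> E) = Suc (rk {} + card C)
     then (-1) ^ (card E + card C + 1) else 0)"
    using E_nonempty assms(3) rk_E rk_empty by (intro chain_sum_eq) auto
  then show ?thesis
    unfolding localize_def chain_sum_def[symmetric] closed_chain_iff_flats[OF assms(1)]
    by (auto simp: rk_E rk_empty)
qed

lemma sum_pd_diff:
  assumes "w \<in> permutations_of_set E" "i \<in> E" "j \<in> E"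
  shows "(\<Sum>S\<in>{S \<in> proper_subsets E. i \<in> S \<and> j \<notin> S}. pd w S) -
      (\<Sum>S\<in>{S \<in> proper_subsets E. j \<in> S \<and> i \<notin> S}. pd w S) = t i - t j"
  using sum_prefix_diff_containing[OF finite_E assms(1), of _ t] assms
  by (simp flip: sum_indicator_diff[OF finite_proper_subsets[OF finite_E]])

text \<open>A repeated \<open>F\<close> is rewritten by the linear relation for a separating pair
  \<open>i\<close>, \<open>j\<close>. The outcome is monomials of the same degree with one more set
  in the support, and \<open>t i - t j\<close> times a monomial of one degree less with the same
  support. Both decrease the measure: twice the degree minus the size of the support. A nonflat in
  the support stays there, so the second alternative of the hypothesis is preserved as well.\<close>

lemma localize_mono_eq_0:
  assumes "Poly_Mapping.keys m \<subseteq> proper_subsets E"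
    and "mono_deg m < r \<or> (mono_deg m = r \<and> \<not> Poly_Mapping.keys m \<subseteq> proper_flats E \<I>)"
  shows "localize (\<lambda>w. mono_eval (pd w) m) = 0"
  using assms
proof (induction "2 * mono_deg m - card (Poly_Mapping.keys m)" arbitrary: m rule: less_induct)
  case less
  let ?C = "Poly_Mapping.keys m"
  show ?case
  proof (cases "\<forall>S\<in>?C. \<forall>T\<in>?C. S \<subseteq> T \<or> T \<subseteq> S")
    case False
    then obtain S T where ST: "S \<in> ?C" "T \<in> ?C" "\<not> S \<subseteq> T" "\<not> T \<subseteq> S" by auto
    have "mono_eval (pd w) m = 0" for w
      using prefix_diff_incomparable[OF ST(3,4), of t w] ST(1,2) mono_eval_eq_0 by metis
    then show ?thesis by (simp add: localize_def)
  next
    case chain: True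
    show ?thesis
    proof (cases "\<forall>S\<in>?C. Poly_Mapping.lookup m S = 1")
      case True
      then have "mono_deg m = card ?C" "mono_eval (pd w) m = (\<Prod>S\<in>?C. pd w S)" for w
        by (simp_all add: mono_deg_def mono_eval_def)
      then show ?thesis
        using localize_chain[OF less.prems(1) chain] less.prems(2) by (auto split: if_splits)
    next
      case False
      then obtain F where F: "F \<in> ?C" "Poly_Mapping.lookup m F \<noteq> 1" by auto
      then have "2 \<le> Poly_Mapping.lookup m F" by (auto simp: in_keys_iff)
      then obtain m' where m': "m = m' + Poly_Mapping.single F 1" "Poly_Mapping.keys m' = ?C"
        by (rule mono_split_square)
      have deg: "mono_deg m = Suc (mono_deg m')" unfolding m'(1) by (simp add: mono_deg_add)
      have le: "card ?C \<le> mono_deg m'" using card_keys_le_mono_deg[of m'] m'(2) by simp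
      have "\<forall>S\<in>?C. S \<subseteq> E" "F \<noteq> {}" "F \<noteq> E"
        using less.prems(1) F(1) by (auto simp: proper_subsets_def)
      then obtain i j where ij: "i \<in> F" "j \<in> E" "j \<notin> F"
          "\<forall>G\<in>?C. i \<in> G \<and> j \<notin> G \<longrightarrow> G = F" "\<forall>G\<in>?C. j \<in> G \<longrightarrow> i \<in> G"
        using chain_separate[OF finite_keys chain _ F(1), of E] by metis
      have FE: "F \<in> proper_subsets E" and iE: "i \<in> E"
        using F(1) less.prems(1) ij(1) by (auto simp: proper_subsets_def)
      let ?A = "{S \<in> proper_subsets E. i \<in> S \<and> j \<notin> S}"
      let ?A' = "{S \<in> proper_subsets E. j \<in> S \<and> i \<notin> S}"
      have fin: "finite ?A" "finite ?A'" using finite_proper_subsets[OF finite_E] by auto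
      have new: "localize (\<lambda>w. mono_eval (pd w) m' * pd w S) = 0"
        if S: "S \<in> proper_subsets E" "S \<notin> ?C" for S
      proof -
        let ?m = "m' + Poly_Mapping.single S 1"
        have keys: "Poly_Mapping.keys ?m = insert S ?C" using m'(2) by (simp add: keys_add_nat)
        have deg': "mono_deg ?m = mono_deg m" by (simp add: deg mono_deg_add)
        have "localize (\<lambda>w. mono_eval (pd w) ?m) = 0"
        proof (rule less.hyps)
          show "2 * mono_deg ?m - card (Poly_Mapping.keys ?m) < 2 * mono_deg m - card ?C"
            using S(2) le deg unfolding keys deg' by simp
          show "Poly_Mapping.keys ?m \<subseteq> proper_subsets E" using keys S less.prems(1) by auto
          show "mono_deg ?m < r \<or> mono_deg ?m = r \<and> \<not> Poly_Mapping.keys ?m \<subseteq> proper_flats E \<I>"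
            using less.prems(2) deg' keys by auto
        qed
        then show ?thesis by (simp add: mono_eval_add)
      qed
      have old: "localize (\<lambda>w. mono_eval (pd w) m') = 0"
      proof (rule less.hyps)
        show "2 * mono_deg m' - card (Poly_Mapping.keys m') < 2 * mono_deg m - card ?C"
          using le deg unfolding m'(2) by simp
        show "Poly_Mapping.keys m' \<subseteq> proper_subsets E" using m'(2) less.prems(1) by simp
        show "mono_deg m' < r \<or> mono_deg m' = r \<and> \<not> Poly_Mapping.keys m' \<subseteq> proper_flats E \<I>"
          using less.prems(2) deg by auto
      qed
      have "localize (\<lambda>w. mono_eval (pd w) m) =
        localize (\<lambda>w. (t i - t j) * mono_eval (pd w) m' -
          (\<Sum>S\<in>?A - {F}. mono_eval (pd w) m' * pd w S) + (\<Sum>S\<in>?A'. mono_eval (pd w) m' * pd w S))"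
      proof (rule localize_cong)
        fix w assume w: "w \<in> permutations_of_set E"
        have "F \<in> ?A" using FE ij by auto
        then have "(\<Sum>S\<in>?A. pd w S) = pd w F + (\<Sum>S\<in>?A - {F}. pd w S)"
          by (rule sum.remove[OF fin(1)])
        then have "pd w F = (t i - t j) - (\<Sum>S\<in>?A - {F}. pd w S) + (\<Sum>S\<in>?A'. pd w S)"
          unfolding sum_pd_diff[OF w iE ij(2), symmetric] by simp
        then have "mono_eval (pd w) m = mono_eval (pd w) m' *
            ((t i - t j) - (\<Sum>S\<in>?A - {F}. pd w S) + (\<Sum>S\<in>?A'. pd w S))"
          unfolding m'(1) mono_eval_add by simp
        then show "mono_eval (pd w) m = (t i - t j) * mono_eval (pd w) m' -
          (\<Sum>S\<in>?A - {F}. mono_eval (pd w) m' * pd w S) + (\<Sum>S\<in>?A'. mono_eval (pd w) m' * pd w S)"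
          by (simp add: algebra_simps sum_distrib_left)
      qed
      also have "\<dots> = (t i - t j) * localize (\<lambda>w. mono_eval (pd w) m') -
          (\<Sum>S\<in>?A - {F}. localize (\<lambda>w. mono_eval (pd w) m' * pd w S)) +
          (\<Sum>S\<in>?A'. localize (\<lambda>w. mono_eval (pd w) m' * pd w S))"
        by (simp add: localize_add localize_diff localize_cmult localize_sum)
      \<comment> \<open>By the choice of \<open>i\<close> and \<open>j\<close>, no set in either
        remaining sum belongs to the chain.\<close>
      also have "(\<Sum>S\<in>?A - {F}. localize (\<lambda>w. mono_eval (pd w) m' * pd w S)) = 0"
        by (rule sum.neutral) (use ij in \<open>auto intro: new\<close>)
      also have "(\<Sum>S\<in>?A'. localize (\<lambda>w. mono_eval (pd w) m' * pd w S)) = 0"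
        by (rule sum.neutral) (use ij in \<open>auto intro: new\<close>)
      finally show ?thesis using old by simp
    qed
  qed
qed

text \<open>Here \<open>k\<close> only bounds the degree: constants belong to every level. Shifting
  linear factors by constants produces inhomogeneous products, which stay within this bound.\<close>

inductive poly_family :: "nat \<Rightarrow> ('a list \<Rightarrow> 'f) \<Rightarrow> bool" where
  const: "poly_family k (\<lambda>w. c)"
| mult: "poly_family k \<phi> \<Longrightarrow> S \<in> proper_subsets E \<Longrightarrow> poly_family (Suc k) (\<lambda>w. \<phi> w * pd w S)"
| add: "poly_family k \<phi> \<Longrightarrow> poly_family k \<psi> \<Longrightarrow> poly_family k (\<lambda>w. \<phi> w + \<psi> w)"

lemma poly_family_Suc: "poly_family k \<phi> \<Longrightarrow> poly_family (Suc k) \<phi>"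
proof (induction rule: poly_family.induct)
  case (const k c)
  show ?case by (rule poly_family.const)
qed (rule poly_family.mult poly_family.add; assumption)+

lemma poly_family_cmult: "poly_family k \<phi> \<Longrightarrow> poly_family k (\<lambda>w. \<phi> w * c)"
proof (induction rule: poly_family.induct)
  case (mult k \<phi> S)
  have "poly_family (Suc k) (\<lambda>w. (\<phi> w * c) * pd w S)"
    using mult by (intro poly_family.mult)
  then show ?case by (simp add: algebra_simps)
next
  case (add k \<phi> \<psi>)
  have "poly_family k (\<lambda>w. \<phi> w * c + \<psi> w * c)" using add by (intro poly_family.add)
  then show ?case by (simp add: algebra_simps)
qed (rule poly_family.const)

lemma poly_family_sum:
  "finite A \<Longrightarrow> (\<And>a. a \<in> A \<Longrightarrow> poly_family k (\<phi> a)) \<Longrightarrow> poly_family k (\<lambda>w. \<Sum>a\<in>A. \<phi> a w)"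
proof (induction A rule: finite_induct)
  case empty
  show ?case by (simp add: poly_family.const)
next
  case (insert a A)
  then have "poly_family k (\<lambda>w. \<phi> a w + (\<Sum>a\<in>A. \<phi> a w))" by (intro poly_family.add) auto
  then show ?case using insert.hyps by simp
qed

lemma poly_family_mult_linear:
  assumes "poly_family k \<phi>" "A \<subseteq> proper_subsets E"
  shows "poly_family (Suc k) (\<lambda>w. \<phi> w * (b + (\<Sum>S\<in>A. c S * pd w S)))"
proof -
  have "poly_family (Suc k) (\<lambda>w. \<phi> w * b + (\<Sum>S\<in>A. \<phi> w * c S * pd w S))"
  proof (intro poly_family.add poly_family_sum)
    show "finite A" using assms(2) finite_proper_subsets[OF finite_E] finite_subset by auto
    show "poly_family (Suc k) (\<lambda>w. \<phi> w * b)"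
      using assms(1) by (intro poly_family_Suc poly_family_cmult)
    show "poly_family (Suc k) (\<lambda>w. \<phi> w * c S * pd w S)" if "S \<in> A" for S
      using assms that by (intro poly_family.mult poly_family_cmult) auto
  qed
  then show ?thesis by (simp add: algebra_simps sum_distrib_left)
qed

text \<open>The monomial \<open>m\<close> collects the factors already taken off
  \<open>\<phi>\<close>; it is arbitrary in the induction so that each \<open>mult\<close> step can
  move its factor into it. A nonflat to be tested can be placed there from the start.\<close>

lemma localize_mono_family_eq_0:
  assumes "poly_family k \<phi>" "Poly_Mapping.keys m \<subseteq> proper_subsets E"
    and "mono_deg m + k < r \<or> (mono_deg m + k \<le> r \<and> \<not> Poly_Mapping.keys m \<subseteq> proper_flats E \<I>)"
  shows "localize (\<lambda>w. mono_eval (pd w) m * \<phi> w) = 0"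
  using assms
proof (induction arbitrary: m rule: poly_family.induct)
  case (const k c)
  then have "localize (\<lambda>w. mono_eval (pd w) m) = 0" by (intro localize_mono_eq_0) auto
  then show ?case using localize_cmult[of c "\<lambda>w. mono_eval (pd w) m"] by (simp add: mult.commute)
next
  case (mult k \<phi> S)
  have "localize (\<lambda>w. mono_eval (pd w) (m + Poly_Mapping.single S 1) * \<phi> w) = 0"
    using mult.prems mult.hyps by (intro mult.IH) (auto simp: keys_add_nat mono_deg_add)
  then show ?case by (simp add: mono_eval_add algebra_simps)
next
  case (add k \<phi> \<psi>)
  then show ?case by (simp add: distrib_left localize_add)
qed

lemma localize_family_eq_0: "poly_family k \<phi> \<Longrightarrow> k < r \<Longrightarrow> localize \<phi> = 0"
  using localize_mono_family_eq_0[of k \<phi> 0] by simp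

lemma localize_family_nonflat_eq_0:
  assumes "poly_family k \<phi>" "k < r" "S \<in> proper_subsets E - proper_flats E \<I>"
  shows "localize (\<lambda>w. \<phi> w * pd w S) = 0"
  using localize_mono_family_eq_0[OF assms(1), of "Poly_Mapping.single S 1"] assms(2,3)
  by (simp add: mult.commute)

text \<open>Nonflats and scalars die in top degree, so every factor may be completed to a sum over all
  proper subsets and shifted by a constant.\<close>

lemma localize_complete_factors:
  assumes "poly_family j \<phi>" "j + length ks = r"
  shows "localize (\<lambda>w. \<phi> w * prod_list (map (\<lambda>k. \<Sum>S\<in>proper_flats E \<I>. c k S * pd w S) ks)) =
    localize (\<lambda>w. \<phi> w * prod_list (map (\<lambda>k. b k + (\<Sum>S\<in>proper_subsets E. c k S * pd w S)) ks))"
  using assms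
proof (induction ks arbitrary: j \<phi>)
  case (Cons k ks)
  let ?G = "\<lambda>k w. \<Sum>S\<in>proper_flats E \<I>. c k S * pd w S"
  let ?T = "\<lambda>k w. b k + (\<Sum>S\<in>proper_subsets E. c k S * pd w S)"
  have G: "poly_family (Suc j) (\<lambda>w. \<phi> w * ?G k w)"
    using poly_family_mult_linear[OF Cons.prems(1) proper_flats_subset, of 0] by simp
  have T: "poly_family (i + length us) (\<lambda>w. \<psi> w * prod_list (map (\<lambda>k. ?T k w) us))"
    if "poly_family i \<psi>" for i \<psi> us
    using that
  proof (induction us arbitrary: i \<psi>)
    case (Cons u us)
    from Cons.IH[OF poly_family_mult_linear[OF Cons.prems order_refl, of "b u" "c u"]]
    show ?case by (simp add: algebra_simps)
  qed simp
  let ?R = "\<lambda>w. \<phi> w * prod_list (map (\<lambda>k. ?T k w) ks)"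
  have R: "poly_family (j + length ks) ?R" using T[OF Cons.prems(1)] .
  have small: "j + length ks < r" using Cons.prems(2) by simp
  have diff: "?T k w = b k + (?G k w + (\<Sum>S\<in>proper_subsets E - proper_flats E \<I>. c k S * pd w S))" for w
    using sum.subset_diff[OF proper_flats_subset finite_proper_subsets[OF finite_E],
        of "\<lambda>S. c k S * pd w S"] by (simp add: algebra_simps)
  have expand: "x * ((u + (g + (\<Sum>S\<in>A. a S * f S))) * P) =
      u * (x * P) + x * P * g + (\<Sum>S\<in>A. a S * (x * P * f S))"
    for x u g P :: 'f and a f and A :: "'a set set"
    by (simp add: distrib_left distrib_right sum_distrib_left sum_distrib_right mult_ac add_ac)
  have "localize (\<lambda>w. \<phi> w * prod_list (map (\<lambda>k. ?G k w) (k # ks))) =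
      localize (\<lambda>w. (\<phi> w * ?G k w) * prod_list (map (\<lambda>k. ?G k w) ks))"
    by (simp add: mult.assoc)
  \<comment> \<open>The tail is completed first. The current factor is then multiplied by
    \<open>?R\<close>, of degree at most \<open>r - 1\<close>, so that adding a scalar or a single
    nonflat to this factor changes nothing.\<close>
  also have "\<dots> = localize (\<lambda>w. (\<phi> w * ?G k w) * prod_list (map (\<lambda>k. ?T k w) ks))"
    using Cons.IH[OF G] Cons.prems(2) by simp
  also have "\<dots> = localize (\<lambda>w. ?R w * ?G k w)"
    by (simp add: mult_ac)
  also have "\<dots> = localize (\<lambda>w. b k * ?R w + ?R w * ?G k w +
      (\<Sum>S\<in>proper_subsets E - proper_flats E \<I>. c k S * (?R w * pd w S)))"
    using localize_family_eq_0[OF R small] localize_family_nonflat_eq_0[OF R small]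
    by (simp add: localize_add localize_cmult localize_sum)
  also have "\<dots> = localize (\<lambda>w. \<phi> w * prod_list (map (\<lambda>k. ?T k w) (k # ks)))"
    unfolding list.map prod_list.Cons diff expand ..
  finally show ?case .
qed simp

end


section \<open>Polynomials as finitely supported maps\<close>

definition rpoly_over :: "'v set \<Rightarrow> 'v rpoly set" where
  "rpoly_over V = {p. \<forall>m\<in>Poly_Mapping.keys p. Poly_Mapping.keys m \<subseteq> V}"

lemma rpoly_ring_simps [simp]:
  "carrier (rpoly_ring V) = rpoly_over V" "monoid.mult (rpoly_ring V) = (*)"
  "one (rpoly_ring V) = 1" "zero (rpoly_ring V) = 0" "add (rpoly_ring V) = (+)"
  by (simp_all add: rpoly_ring_def rpoly_over_def)

lemma rpoly_over_add: "p \<in> rpoly_over V \<Longrightarrow> q \<in> rpoly_over V \<Longrightarrow> p + q \<in> rpoly_over V"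
  using Poly_Mapping.keys_add[of p q] by (auto simp: rpoly_over_def)

lemma rpoly_over_uminus: "p \<in> rpoly_over V \<Longrightarrow> - p \<in> rpoly_over V"
  by (auto simp: rpoly_over_def in_keys_iff)

lemma rpoly_over_diff: "p \<in> rpoly_over V \<Longrightarrow> q \<in> rpoly_over V \<Longrightarrow> p - q \<in> rpoly_over V"
  using rpoly_over_add[of p V "- q"] rpoly_over_uminus[of q V] by simp

lemma rpoly_over_mult: "p \<in> rpoly_over V \<Longrightarrow> q \<in> rpoly_over V \<Longrightarrow> p * q \<in> rpoly_over V"
proof -
  assume pq: "p \<in> rpoly_over V" "q \<in> rpoly_over V"
  show ?thesis
    unfolding rpoly_over_def
  proof (intro CollectI ballI)
    fix m assume "m \<in> Poly_Mapping.keys (p * q)"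
    then obtain a b where "m = a + b" "a \<in> Poly_Mapping.keys p" "b \<in> Poly_Mapping.keys q"
      using keys_mult[of p q] by auto
    then show "Poly_Mapping.keys m \<subseteq> V"
      using pq by (auto simp: keys_add_nat rpoly_over_def)
  qed
qed

lemma rpoly_over_single: "Poly_Mapping.keys m \<subseteq> V \<Longrightarrow> Poly_Mapping.single m c \<in> rpoly_over V"
  by (auto simp: rpoly_over_def)

lemma rpoly_over_zero: "0 \<in> rpoly_over V" and rpoly_over_one: "1 \<in> rpoly_over V"
  by (auto simp: rpoly_over_def)

lemma rpoly_over_pconst: "pconst c \<in> rpoly_over V"
  unfolding pconst_def by (rule rpoly_over_single) simp

lemma rpoly_over_pvar: "v \<in> V \<Longrightarrow> pvar v \<in> rpoly_over V"
  unfolding pvar_def by (rule rpoly_over_single) simp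

lemma rpoly_over_sum: "(\<And>a. a \<in> A \<Longrightarrow> f a \<in> rpoly_over V) \<Longrightarrow> sum f A \<in> rpoly_over V"
  by (induction A rule: infinite_finite_induct) (auto intro: rpoly_over_zero rpoly_over_add)

lemma rpoly_over_power: "p \<in> rpoly_over V \<Longrightarrow> p ^ k \<in> rpoly_over V"
  by (induction k) (auto intro: rpoly_over_one rpoly_over_mult)

lemma rpoly_over_prod: "(\<And>a. a \<in> A \<Longrightarrow> f a \<in> rpoly_over V) \<Longrightarrow> prod f A \<in> rpoly_over V"
  by (induction A rule: infinite_finite_induct) (auto intro: rpoly_over_one rpoly_over_mult)

lemmas rpoly_over_intros = rpoly_over_add rpoly_over_uminus rpoly_over_diff rpoly_over_mult
  rpoly_over_zero rpoly_over_one rpoly_over_pconst rpoly_over_pvar rpoly_over_sum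
  rpoly_over_power rpoly_over_prod

lemma cring_rpoly_ring: "cring (rpoly_ring V)"
proof (rule cringI)
  show "abelian_group (rpoly_ring V)"
  proof (rule abelian_groupI)
    fix x assume "x \<in> carrier (rpoly_ring V)"
    then show "\<exists>y\<in>carrier (rpoly_ring V). y \<oplus>\<^bsub>rpoly_ring V\<^esub> x = \<zero>\<^bsub>rpoly_ring V\<^esub>"
      by (intro bexI[of _ "- x"]) (auto intro: rpoly_over_uminus)
  qed (auto simp: algebra_simps intro: rpoly_over_intros)
  show "comm_monoid (rpoly_ring V)"
    by (rule comm_monoidI) (auto simp: algebra_simps intro: rpoly_over_intros)
qed (auto simp: algebra_simps)

lemma rpoly_ring_minus:
  assumes "p \<in> rpoly_over V" "q \<in> rpoly_over V"
  shows "p \<ominus>\<^bsub>rpoly_ring V\<^esub> q = p - q"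
proof -
  interpret cring "rpoly_ring V" by (rule cring_rpoly_ring)
  have "\<ominus>\<^bsub>rpoly_ring V\<^esub> q = - q"
    using assms(2) by (intro minus_equality) (auto intro: rpoly_over_uminus)
  then show ?thesis by (simp add: a_minus_def)
qed

lemma rpoly_monomial_sum:
  fixes p :: "'v rpoly"
  shows "p = (\<Sum>m\<in>Poly_Mapping.keys p. Poly_Mapping.single m (Poly_Mapping.lookup p m))"
proof (rule poly_mapping_eqI)
  fix x
  have "Poly_Mapping.lookup (\<Sum>m\<in>Poly_Mapping.keys p. Poly_Mapping.single m (Poly_Mapping.lookup p m)) x =
      (\<Sum>m\<in>Poly_Mapping.keys p. if m = x then Poly_Mapping.lookup p m else 0)"
    by (simp add: lookup_sum lookup_single when_def)
  then show "Poly_Mapping.lookup p x =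
      Poly_Mapping.lookup (\<Sum>m\<in>Poly_Mapping.keys p. Poly_Mapping.single m (Poly_Mapping.lookup p m)) x"
    by (simp add: in_keys_iff)
qed

lemma single_times_pvar: "Poly_Mapping.single m 1 * pvar v = Poly_Mapping.single (m + Poly_Mapping.single v 1) 1"
  by (simp add: pvar_def mult_single)

lemma pconst_times_single: "pconst c * Poly_Mapping.single m d = Poly_Mapping.single m (c * d)"
  by (simp add: pconst_def mult_single)

lemma homogeneous_iff: "homogeneous k p \<longleftrightarrow> (\<forall>m\<in>Poly_Mapping.keys p. mono_deg m = k)"
  by (simp add: homogeneous_def mono_deg_def)

lemma homogeneous_add: "homogeneous k p \<Longrightarrow> homogeneous k q \<Longrightarrow> homogeneous k (p + q)"
  using Poly_Mapping.keys_add[of p q] by (auto simp: homogeneous_iff)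

lemma homogeneous_uminus: "homogeneous k p \<Longrightarrow> homogeneous k (- p)"
  by (auto simp: homogeneous_iff in_keys_iff)

lemma homogeneous_diff: "homogeneous k p \<Longrightarrow> homogeneous k q \<Longrightarrow> homogeneous k (p - q)"
  using homogeneous_add[of k p "- q"] homogeneous_uminus[of k q] by simp

lemma homogeneous_zero: "homogeneous k 0"
  by (simp add: homogeneous_iff)

lemma homogeneous_sum: "(\<And>a. a \<in> A \<Longrightarrow> homogeneous k (f a)) \<Longrightarrow> homogeneous k (sum f A)"
  by (induction A rule: infinite_finite_induct) (auto intro: homogeneous_zero homogeneous_add)

lemma homogeneous_mult: "homogeneous k p \<Longrightarrow> homogeneous l q \<Longrightarrow> homogeneous (k + l) (p * q)"
  using keys_mult[of p q] by (force simp: homogeneous_iff mono_deg_add)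

lemma homogeneous_single: "mono_deg m = k \<Longrightarrow> homogeneous k (Poly_Mapping.single m c)"
  by (auto simp: homogeneous_iff)

lemma homogeneous_one: "homogeneous 0 1"
  by (simp add: homogeneous_iff)

lemma homogeneous_pconst_mult: "homogeneous k p \<Longrightarrow> homogeneous k (pconst c * p)"
  using homogeneous_mult[of 0 "pconst c" k p] homogeneous_single[of 0 0 c] by (simp add: pconst_def)

lemma homogeneous_power: "homogeneous k p \<Longrightarrow> homogeneous (k * d) (p ^ d)"
  by (induction d) (auto intro: homogeneous_one homogeneous_mult)

lemma homogeneous_prod:
  "finite A \<Longrightarrow> (\<And>a. a \<in> A \<Longrightarrow> homogeneous (d a) (f a)) \<Longrightarrow> homogeneous (sum d A) (prod f A)"
  by (induction A rule: finite_induct) (auto intro: homogeneous_one homogeneous_mult)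

section \<open>Linear extension of weights on monomials, and evaluation\<close>

definition lin_ext :: "(('v \<Rightarrow>\<^sub>0 nat) \<Rightarrow> 'f::real_field) \<Rightarrow> 'v rpoly \<Rightarrow> 'f" where
  "lin_ext W p = (\<Sum>m\<in>Poly_Mapping.keys p. of_real (Poly_Mapping.lookup p m) * W m)"

lemma lin_ext_add: "lin_ext W (p + q) = lin_ext W p + lin_ext W q"
  unfolding lin_ext_def
  by (rule setsum_keys_plus_distrib[of "\<lambda>m c. of_real c * W m"]) (auto simp: algebra_simps)

lemma lin_ext_zero [simp]: "lin_ext W 0 = 0"
  by (simp add: lin_ext_def)

lemma lin_ext_uminus: "lin_ext W (- p) = - lin_ext W p"
  using lin_ext_add[of W p "- p"] by (simp add: eq_neg_iff_add_eq_0 add.commute)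

lemma lin_ext_diff: "lin_ext W (p - q) = lin_ext W p - lin_ext W q"
  using lin_ext_add[of W p "- q"] by (simp add: lin_ext_uminus)

lemma lin_ext_sum: "lin_ext W (sum f A) = (\<Sum>a\<in>A. lin_ext W (f a))"
  by (induction A rule: infinite_finite_induct) (auto simp: lin_ext_add)

lemma lin_ext_single [simp]: "lin_ext W (Poly_Mapping.single m c) = of_real c * W m"
  by (simp add: lin_ext_def)

lemma lin_ext_single_mult:
  "lin_ext W (Poly_Mapping.single m c * q) = of_real c * lin_ext (\<lambda>m'. W (m + m')) q"
proof -
  have "Poly_Mapping.single m c * q =
      (\<Sum>m'\<in>Poly_Mapping.keys q. Poly_Mapping.single (m + m') (c * Poly_Mapping.lookup q m'))"
    by (subst rpoly_monomial_sum[of q]) (simp add: sum_distrib_left mult_single)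
  then show ?thesis
    by (simp add: lin_ext_sum) (simp add: lin_ext_def sum_distrib_left mult.assoc)
qed

text \<open>Vanishing on all multiples of \<open>q\<close> can thus be tested on one monomial
  multiplier at a time, by shifting the weight.\<close>

lemma lin_ext_mult:
  "lin_ext W (p * q) =
    (\<Sum>m\<in>Poly_Mapping.keys p. of_real (Poly_Mapping.lookup p m) * lin_ext (\<lambda>m'. W (m + m')) q)"
  by (subst rpoly_monomial_sum[of p]) (simp add: sum_distrib_right lin_ext_sum lin_ext_single_mult)

definition rpoly_eval :: "('v \<Rightarrow> 'f::real_field) \<Rightarrow> 'v rpoly \<Rightarrow> 'f" where
  "rpoly_eval f = lin_ext (mono_eval f)"

lemma rpoly_eval_mult: "rpoly_eval f (p * q) = rpoly_eval f p * rpoly_eval f q"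
proof -
  have "lin_ext (\<lambda>m'. mono_eval f (m + m')) q = mono_eval f m * lin_ext (mono_eval f) q" for m
    by (simp add: lin_ext_def mono_eval_add sum_distrib_left algebra_simps)
  then show ?thesis
    unfolding rpoly_eval_def lin_ext_mult
    by (simp add: lin_ext_def[of _ p] sum_distrib_right mult.assoc)
qed

lemma rpoly_eval_one: "rpoly_eval f 1 = 1"
  using lin_ext_single[of "mono_eval f" 0 1] by (simp add: rpoly_eval_def)

lemma rpoly_eval_power: "rpoly_eval f (p ^ k) = rpoly_eval f p ^ k"
  by (induction k) (simp_all add: rpoly_eval_one rpoly_eval_mult)

lemma rpoly_eval_prod: "rpoly_eval f (prod g A) = (\<Prod>a\<in>A. rpoly_eval f (g a))"
  by (induction A rule: infinite_finite_induct) (simp_all add: rpoly_eval_one rpoly_eval_mult)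

lemma rpoly_eval_pconst: "rpoly_eval f (pconst c) = of_real c"
  by (simp add: rpoly_eval_def pconst_def)

lemma rpoly_eval_pvar: "rpoly_eval f (pvar v) = f v"
  by (simp add: rpoly_eval_def pvar_def)

lemma prod_pvar: "finite C \<Longrightarrow> (\<Prod>F\<in>C. pvar F) = Poly_Mapping.single (\<Sum>F\<in>C. Poly_Mapping.single F 1) 1"
  by (induction C rule: finite_induct) (auto simp: pvar_def mult_single)

lemma squarefree_monomial:
  fixes m :: "'v \<Rightarrow>\<^sub>0 nat"
  assumes "\<forall>v\<in>Poly_Mapping.keys m. Poly_Mapping.lookup m v = 1"
  shows "(\<Prod>F\<in>Poly_Mapping.keys m. pvar F) = Poly_Mapping.single m 1"
proof -
  have "(\<Sum>F\<in>Poly_Mapping.keys m. Poly_Mapping.single F 1) = m"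
  proof (rule poly_mapping_eqI)
    fix x
    have "Poly_Mapping.lookup (\<Sum>F\<in>Poly_Mapping.keys m. Poly_Mapping.single F 1) x =
        (\<Sum>F\<in>Poly_Mapping.keys m. if F = x then 1 else 0)"
      by (simp add: lookup_sum lookup_single when_def)
    also have "\<dots> = Poly_Mapping.lookup m x" using assms by (auto simp: in_keys_iff)
    finally show "Poly_Mapping.lookup (\<Sum>F\<in>Poly_Mapping.keys m. Poly_Mapping.single F 1) x =
      Poly_Mapping.lookup m x" .
  qed
  then show ?thesis by (simp add: prod_pvar)
qed


section \<open>The degree map\<close>

context finite_matroid
begin

abbreviation flats :: "'a set set" where "flats \<equiv> proper_flats E \<I>"

abbreviation cls :: "'a set rpoly \<Rightarrow> 'a set rpoly set" where "cls \<equiv> chow_class E \<I>"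

definition flat_forms :: "nat \<Rightarrow> 'a set rpoly set" where
  "flat_forms k = {p \<in> rpoly_over flats. homogeneous k p}"

lemma carrier_chow_poly_ring: "carrier (chow_poly_ring E \<I>) = rpoly_over flats"
  by (simp add: chow_poly_ring_def)

lemma chow_relations_subset: "chow_relations E \<I> \<subseteq> rpoly_over flats"
  unfolding chow_relations_def by (auto intro!: rpoly_over_intros)

lemma chow_ideal: "ideal (chow_ideal E \<I>) (chow_poly_ring E \<I>)"
proof -
  interpret cring "chow_poly_ring E \<I>" unfolding chow_poly_ring_def by (rule cring_rpoly_ring)
  show ?thesis
    unfolding chow_ideal_def
    by (rule genideal_ideal) (simp add: carrier_chow_poly_ring chow_relations_subset)
qed

lemma chow_relations_in_ideal: "chow_relations E \<I> \<subseteq> chow_ideal E \<I>"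
proof -
  interpret cring "chow_poly_ring E \<I>" unfolding chow_poly_ring_def by (rule cring_rpoly_ring)
  show ?thesis
    unfolding chow_ideal_def
    by (rule genideal_self) (simp add: carrier_chow_poly_ring chow_relations_subset)
qed

lemma chow_ideal_mult: "p \<in> chow_ideal E \<I> \<Longrightarrow> q \<in> rpoly_over flats \<Longrightarrow> q * p \<in> chow_ideal E \<I>"
  using ideal.I_l_closed[OF chow_ideal, of p q] by (simp add: chow_poly_ring_def)

lemma cring_chow_ring: "cring (chow_ring E \<I>)"
  unfolding chow_ring_def
  by (rule ideal.quotient_is_cring[OF chow_ideal])
    (simp add: chow_poly_ring_def cring_rpoly_ring)

lemma cls_ring_hom: "cls \<in> ring_hom (chow_poly_ring E \<I>) (chow_ring E \<I>)"
  using ideal.rcos_ring_hom[OF chow_ideal] unfolding chow_ring_def chow_class_def .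

lemma
  shows cls_closed: "p \<in> rpoly_over flats \<Longrightarrow> cls p \<in> carrier (chow_ring E \<I>)"
    and cls_mult: "p \<in> rpoly_over flats \<Longrightarrow> q \<in> rpoly_over flats \<Longrightarrow>
      cls (p * q) = cls p \<otimes>\<^bsub>chow_ring E \<I>\<^esub> cls q"
    and cls_add: "p \<in> rpoly_over flats \<Longrightarrow> q \<in> rpoly_over flats \<Longrightarrow>
      cls (p + q) = cls p \<oplus>\<^bsub>chow_ring E \<I>\<^esub> cls q"
    and cls_one: "cls 1 = \<one>\<^bsub>chow_ring E \<I>\<^esub>"
  using ring_hom_closed[OF cls_ring_hom] ring_hom_mult[OF cls_ring_hom] ring_hom_add[OF cls_ring_hom]
    ring_hom_one[OF cls_ring_hom]
  by (simp_all add: chow_poly_ring_def)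

lemma cls_zero: "cls 0 = \<zero>\<^bsub>chow_ring E \<I>\<^esub>"
proof -
  interpret A: cring "chow_ring E \<I>" by (rule cring_chow_ring)
  have "cls 0 = cls 0 \<oplus>\<^bsub>chow_ring E \<I>\<^esub> cls 0"
    using cls_add[OF rpoly_over_zero rpoly_over_zero] by simp
  then show ?thesis
    using cls_closed[OF rpoly_over_zero] A.add.r_cancel_one' by metis
qed

lemma cls_diff:
  assumes "p \<in> rpoly_over flats" "q \<in> rpoly_over flats"
  shows "cls (p - q) = cls p \<ominus>\<^bsub>chow_ring E \<I>\<^esub> cls q"
proof -
  interpret A: cring "chow_ring E \<I>" by (rule cring_chow_ring)
  have "cls p = cls (p - q) \<oplus>\<^bsub>chow_ring E \<I>\<^esub> cls q"
    using cls_add[OF rpoly_over_diff[OF assms] assms(2)] by simp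
  then show ?thesis
    using cls_closed[OF rpoly_over_diff[OF assms]] cls_closed[OF assms(2)]
    by (simp add: A.minus_eq A.a_assoc A.r_neg)
qed

lemma cls_power: "p \<in> rpoly_over flats \<Longrightarrow> cls (p ^ k) = cls p [^]\<^bsub>chow_ring E \<I>\<^esub> k"
proof (induction k)
  case (Suc k)
  interpret A: cring "chow_ring E \<I>" by (rule cring_chow_ring)
  show ?case
    using Suc cls_mult[OF Suc.prems rpoly_over_power[OF Suc.prems]]
      A.m_comm[OF cls_closed[OF Suc.prems] cls_closed[OF rpoly_over_power[OF Suc.prems]]]
    by simp
qed (simp add: cls_one)

lemma cls_prod:
  assumes "finite A" "\<And>a. a \<in> A \<Longrightarrow> f a \<in> rpoly_over flats"
  shows "cls (\<Prod>a\<in>A. f a) = (\<Otimes>\<^bsub>chow_ring E \<I>\<^esub>a\<in>A. cls (f a))"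
  using assms
proof (induction A rule: finite_induct)
  case empty
  interpret A: cring "chow_ring E \<I>" by (rule cring_chow_ring)
  show ?case by (simp add: cls_one)
next
  case (insert a A)
  interpret A: cring "chow_ring E \<I>" by (rule cring_chow_ring)
  have "cls (\<Prod>a\<in>insert a A. f a) = cls (f a) \<otimes>\<^bsub>chow_ring E \<I>\<^esub> cls (\<Prod>a\<in>A. f a)"
    using insert by (simp add: cls_mult rpoly_over_prod)
  then show ?case
    using insert by (simp add: A.finprod_insert cls_closed Pi_def)
qed

lemma cls_eq_iff:
  assumes "p \<in> rpoly_over flats" "q \<in> rpoly_over flats"
  shows "cls p = cls q \<longleftrightarrow> p - q \<in> chow_ideal E \<I>"
proof -
  interpret cring "chow_poly_ring E \<I>" unfolding chow_poly_ring_def by (rule cring_rpoly_ring)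
  show ?thesis
    unfolding chow_class_def
    using quotient_eq_iff_same_a_r_cos[OF chow_ideal, of p q] rpoly_ring_minus[OF assms] assms
    by (simp add: chow_poly_ring_def)
qed

lemma chow_piece_eq: "chow_piece E \<I> k = cls ` flat_forms k"
  by (simp add: chow_piece_def carrier_chow_poly_ring flat_forms_def)

lemma flat_forms_add: "p \<in> flat_forms k \<Longrightarrow> q \<in> flat_forms k \<Longrightarrow> p + q \<in> flat_forms k"
  by (auto simp: flat_forms_def intro: rpoly_over_add homogeneous_add)

lemma flat_forms_zero: "0 \<in> flat_forms k"
  by (auto simp: flat_forms_def intro: rpoly_over_zero homogeneous_zero)

lemma flat_forms_pconst_mult: "p \<in> flat_forms k \<Longrightarrow> pconst c * p \<in> flat_forms k"
  by (auto simp: flat_forms_def intro: rpoly_over_mult rpoly_over_pconst homogeneous_pconst_mult)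

lemma flat_forms_single:
  "Poly_Mapping.keys m \<subseteq> flats \<Longrightarrow> mono_deg m = k \<Longrightarrow> Poly_Mapping.single m c \<in> flat_forms k"
  by (auto simp: flat_forms_def intro: rpoly_over_single homogeneous_single)

text \<open>The conditions on a degree map, pulled back to homogeneous representatives, so that the
  argument for uniqueness runs on polynomials instead of cosets.\<close>

definition top_functional :: "nat \<Rightarrow> ('a set rpoly \<Rightarrow> real) \<Rightarrow> bool" where
  "top_functional r F \<longleftrightarrow>
     (\<forall>p\<in>flat_forms r. \<forall>q\<in>flat_forms r. F (p + q) = F p + F q) \<and>
     (\<forall>c. \<forall>p\<in>flat_forms r. F (pconst c * p) = c * F p) \<and>
     (\<forall>p\<in>flat_forms r. \<forall>q\<in>flat_forms r. p - q \<in> chow_ideal E \<I> \<longrightarrow> F p = F q) \<and>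
     (\<forall>C. complete_flag E \<I> C \<longrightarrow> F (\<Prod>F\<in>C. pvar F) = 1)"

lemma finite_flats: "finite flats"
  by (rule finite_subset[of _ "Pow E"]) (auto simp: proper_flats_def finite_E)

lemma complete_flag_in_flat_forms:
  assumes "complete_flag E \<I> C" "rk E = Suc r"
  shows "(\<Prod>F\<in>C. pvar F) \<in> flat_forms r"
proof -
  have C: "C \<subseteq> flats" "card C = r" using assms by (auto simp: complete_flag_def)
  have "finite C" using C(1) finite_flats finite_subset by auto
  moreover have "homogeneous 1 (pvar F)" for F :: "'a set"
    unfolding pvar_def by (rule homogeneous_single) simp
  ultimately have "homogeneous (\<Sum>F\<in>C. 1) (\<Prod>F\<in>C. pvar F :: 'a set rpoly)"
    by (intro homogeneous_prod)
  then show ?thesis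
    using C by (auto simp: flat_forms_def intro!: rpoly_over_prod rpoly_over_pvar)
qed

text \<open>The forms on which \<open>F\<close> and \<open>G\<close> agree are closed under linear
  combinations and under congruence modulo the ideal. Incomparable pairs put a monomial into the
  ideal, squarefree chains of degree \<open>r\<close> are complete flags, and a repeated flat is
  rewritten by the relation for a separating pair. This relation is homogeneous, so the support
  grows at fixed degree and \<open>r - card\<close> of the support decreases.\<close>

lemma top_functional_unique:
  assumes F: "top_functional r F" and G: "top_functional r G" and rk_E: "rk E = Suc r"
    and p: "p \<in> flat_forms r"
  shows "F p = G p"
proof -
  define Z where "Z = {p \<in> flat_forms r. F p = G p}"
  have Z_add: "p + q \<in> Z" if "p \<in> Z" "q \<in> Z" for p q
    using that F G by (auto simp: Z_def top_functional_def flat_forms_add)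
  have Z_cmult: "pconst c * p \<in> Z" if "p \<in> Z" for p c
    using that F G by (auto simp: Z_def top_functional_def flat_forms_pconst_mult)
  have Z_cong: "p \<in> Z" if "q \<in> Z" "p \<in> flat_forms r" "p - q \<in> chow_ideal E \<I>" for p q
  proof -
    have "F p = F q" "G p = G q" using that F G by (auto simp: Z_def top_functional_def)
    then show ?thesis using that by (auto simp: Z_def)
  qed
  have Z_flag: "(\<Prod>F\<in>C. pvar F) \<in> Z" if "complete_flag E \<I> C" for C
    using that F G complete_flag_in_flat_forms[OF that rk_E] by (auto simp: Z_def top_functional_def)
  have Z_zero: "0 \<in> Z"
  proof -
    have "F (pconst 0 * 0) = 0 * F 0" "G (pconst 0 * 0) = 0 * G 0"
      using F G flat_forms_zero unfolding top_functional_def by blast+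
    then show ?thesis by (simp add: Z_def flat_forms_zero)
  qed
  have Z_sum: "sum f A \<in> Z" if "\<And>a. a \<in> A \<Longrightarrow> f a \<in> Z" for f and A :: "'b set"
    using that by (induction A rule: infinite_finite_induct) (auto intro: Z_zero Z_add)
  have Z_uminus: "- p \<in> Z" if "p \<in> Z" for p
  proof -
    have "pconst (- 1) = (- 1 :: 'a set rpoly)"
      unfolding pconst_def by (simp add: single_uminus)
    then show ?thesis using Z_cmult[OF that, of "- 1"] by simp
  qed
  have Z_mono: "Poly_Mapping.single m 1 \<in> Z"
    if "Poly_Mapping.keys m \<subseteq> flats" "mono_deg m = r" for m
    using that
  proof (induction "r - card (Poly_Mapping.keys m)" arbitrary: m rule: less_induct)
    case less
    let ?C = "Poly_Mapping.keys m"
    have mem: "Poly_Mapping.single m 1 \<in> flat_forms r"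
      using less.prems by (rule flat_forms_single)
    show ?case
    proof (cases "\<forall>S\<in>?C. \<forall>T\<in>?C. S \<subseteq> T \<or> T \<subseteq> S")
      case False
      then obtain S T where ST: "S \<in> ?C" "T \<in> ?C" "\<not> S \<subseteq> T" "\<not> T \<subseteq> S" by auto
      let ?m = "m - Poly_Mapping.single S 1 - Poly_Mapping.single T 1"
      have "S \<noteq> T" using ST by auto
      then have m: "m = ?m + Poly_Mapping.single S 1 + Poly_Mapping.single T 1"
        using ST(1,2) by (intro poly_mapping_eqI)
          (auto simp: lookup_add lookup_minus lookup_single when_def in_keys_iff)
      have "pvar S * pvar T \<in> chow_ideal E \<I>"
        using ST less.prems(1) chow_relations_in_ideal unfolding chow_relations_def by blast
      moreover have "Poly_Mapping.keys ?m \<subseteq> ?C" by (auto simp: in_keys_iff lookup_minus)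
      then have "Poly_Mapping.single ?m 1 \<in> rpoly_over flats"
        using less.prems(1) by (intro rpoly_over_single) auto
      ultimately have "Poly_Mapping.single ?m 1 * (pvar S * pvar T) \<in> chow_ideal E \<I>"
        by (rule chow_ideal_mult)
      moreover have "Poly_Mapping.single ?m 1 * (pvar S * pvar T) = Poly_Mapping.single m 1"
        unfolding mult.assoc[symmetric] single_times_pvar using m by simp
      ultimately show ?thesis using Z_cong[OF Z_zero mem] by simp
    next
      case chain: True
      show ?thesis
      proof (cases "\<forall>S\<in>?C. Poly_Mapping.lookup m S = 1")
        case True
        then have "mono_deg m = card ?C" by (simp add: mono_deg_def)
        then have "complete_flag E \<I> ?C"
          using chain less.prems rk_E by (auto simp: complete_flag_def)
        then show ?thesis using Z_flag squarefree_monomial[OF True] by metis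
      next
        case False
        then obtain F where F: "F \<in> ?C" "Poly_Mapping.lookup m F \<noteq> 1" by auto
        then have "2 \<le> Poly_Mapping.lookup m F" by (auto simp: in_keys_iff)
        then obtain m' where m': "m = m' + Poly_Mapping.single F 1" "Poly_Mapping.keys m' = ?C"
          by (rule mono_split_square)
        have deg: "r = Suc (mono_deg m')"
          using less.prems(2) unfolding m'(1) by (simp add: mono_deg_add)
        have le: "card ?C \<le> mono_deg m'" using card_keys_le_mono_deg[of m'] m'(2) by simp
        have "\<forall>S\<in>?C. S \<subseteq> E" "F \<noteq> {}" "F \<noteq> E"
          using less.prems(1) F(1) by (auto simp: proper_flats_def)
        then obtain i j where ij: "i \<in> F" "j \<in> E" "j \<notin> F"
            "\<forall>G\<in>?C. i \<in> G \<and> j \<notin> G \<longrightarrow> G = F" "\<forall>G\<in>?C. j \<in> G \<longrightarrow> i \<in> G"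
          using chain_separate[OF finite_keys chain _ F(1), of E] by metis
        have Ff: "F \<in> flats" and iE: "i \<in> E"
          using F(1) less.prems(1) ij(1) by (auto simp: proper_flats_def)
        let ?x = "\<lambda>G. Poly_Mapping.single (m' + Poly_Mapping.single G 1) 1 :: 'a set rpoly"
        let ?A = "{S \<in> flats. i \<in> S \<and> j \<notin> S}" and ?A' = "{S \<in> flats. j \<in> S \<and> i \<notin> S}"
        have new: "?x S \<in> Z" if S: "S \<in> flats" "S \<notin> ?C" for S
        proof (rule less.hyps)
          let ?m = "m' + Poly_Mapping.single S 1"
          have keys: "Poly_Mapping.keys ?m = insert S ?C" using m'(2) by (simp add: keys_add_nat)
          then show "r - card (Poly_Mapping.keys ?m) < r - card ?C"
            using S(2) le deg by simp
          show "Poly_Mapping.keys ?m \<subseteq> flats" using keys S less.prems(1) by auto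
          show "mono_deg ?m = r" by (simp add: deg mono_deg_add)
        qed
        let ?R = "(\<Sum>F\<in>{F \<in> flats. i \<in> F}. pvar F) - (\<Sum>F\<in>{F \<in> flats. j \<in> F}. pvar F) :: 'a set rpoly"
        have "?R \<in> chow_ideal E \<I>"
          using iE ij(2) chow_relations_in_ideal unfolding chow_relations_def by blast
        then have "Poly_Mapping.single m' 1 * ?R \<in> chow_ideal E \<I>"
          using m'(2) less.prems(1) by (intro chow_ideal_mult rpoly_over_single) auto
        moreover have "Poly_Mapping.single m' 1 * ?R = (\<Sum>S\<in>?A. ?x S) - (\<Sum>S\<in>?A'. ?x S)"
          unfolding sum_indicator_diff[OF finite_flats] right_diff_distrib sum_distrib_left
            single_times_pvar ..
        ultimately have "(\<Sum>S\<in>?A. ?x S) - (\<Sum>S\<in>?A'. ?x S) \<in> chow_ideal E \<I>"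
          by (simp only:)
        moreover have "(\<Sum>S\<in>?A. ?x S) = ?x F + (\<Sum>S\<in>?A - {F}. ?x S)"
          using finite_flats Ff ij by (intro sum.remove) auto
        ultimately have "Poly_Mapping.single m 1 -
            ((\<Sum>S\<in>?A'. ?x S) + - (\<Sum>S\<in>?A - {F}. ?x S)) \<in> chow_ideal E \<I>"
          using m'(1) by (simp add: diff_diff_eq2 add_ac)
        moreover have "(\<Sum>S\<in>?A'. ?x S) + - (\<Sum>S\<in>?A - {F}. ?x S) \<in> Z"
          using ij by (intro Z_add Z_uminus Z_sum new) auto
        ultimately show ?thesis using Z_cong mem by blast
      qed
    qed
  qed
  have "p = (\<Sum>m\<in>Poly_Mapping.keys p. pconst (Poly_Mapping.lookup p m) * Poly_Mapping.single m 1)"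
    by (subst rpoly_monomial_sum) (simp add: pconst_times_single)
  also have "\<dots> \<in> Z"
    using p by (intro Z_sum Z_cmult Z_mono) (auto simp: flat_forms_def rpoly_over_def homogeneous_iff)
  finally show ?thesis by (simp add: Z_def)
qed

lemma is_degree_map_top_functional:
  assumes "is_degree_map E \<I> f" "rk E = Suc r"
  shows "top_functional r (\<lambda>p. f (cls p))"
proof -
  have f: "\<And>a b. a \<in> chow_piece E \<I> r \<Longrightarrow> b \<in> chow_piece E \<I> r \<Longrightarrow> f (a \<oplus>\<^bsub>chow_ring E \<I>\<^esub> b) = f a + f b"
    "\<And>c a. a \<in> chow_piece E \<I> r \<Longrightarrow> f (cls (pconst c) \<otimes>\<^bsub>chow_ring E \<I>\<^esub> a) = c * f a"
    "\<And>C. complete_flag E \<I> C \<Longrightarrow> f (cls (\<Prod>F\<in>C. pvar F)) = 1"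
    using assms by (auto simp: is_degree_map_def Let_def)
  show ?thesis
    unfolding top_functional_def
  proof (intro conjI ballI allI impI)
    fix p q assume pq: "p \<in> flat_forms r" "q \<in> flat_forms r"
    then show "f (cls (p + q)) = f (cls p) + f (cls q)"
      using f(1)[of "cls p" "cls q"] by (simp add: chow_piece_eq cls_add flat_forms_def)
    show "f (cls p) = f (cls q)" if "p - q \<in> chow_ideal E \<I>"
      using that cls_eq_iff[of p q] pq by (auto simp: flat_forms_def)
  next
    fix c p assume "p \<in> flat_forms r"
    then show "f (cls (pconst c * p)) = c * f (cls p)"
      using f(2)[of "cls p" c] by (simp add: chow_piece_eq cls_mult rpoly_over_pconst flat_forms_def)
  qed (use f(3) in auto)
qed

text \<open>\<open>F\<close> is constant on the representatives of a class, so an arbitrary choice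
  of representative defines the map; restricting it to the top piece makes it extensional.\<close>

lemma top_functional_is_degree_map:
  assumes F: "top_functional r F" and rk_E: "rk E = Suc r"
  shows "\<exists>f. is_degree_map E \<I> f"
proof -
  define f where "f = (\<lambda>a\<in>chow_piece E \<I> r. F (SOME p. p \<in> flat_forms r \<and> cls p = a))"
  have f_cls: "f (cls p) = F p" if p: "p \<in> flat_forms r" for p
  proof -
    let ?q = "SOME q. q \<in> flat_forms r \<and> cls q = cls p"
    have q: "?q \<in> flat_forms r \<and> cls ?q = cls p"
      by (rule someI[of "\<lambda>q. q \<in> flat_forms r \<and> cls q = cls p" p]) (use p in simp)
    then have "?q - p \<in> chow_ideal E \<I>"
      using p cls_eq_iff[of ?q p] by (simp add: flat_forms_def)
    then have "F ?q = F p" using F q p unfolding top_functional_def by blast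
    then show ?thesis using p by (simp add: f_def chow_piece_eq)
  qed
  have "is_degree_map E \<I> f"
    unfolding is_degree_map_def Let_def rk_E diff_Suc_1
  proof (intro conjI ballI allI impI)
    show "f \<in> extensional (chow_piece E \<I> r)" by (simp add: f_def)
  next
    fix a b assume "a \<in> chow_piece E \<I> r" "b \<in> chow_piece E \<I> r"
    then obtain p q where pq: "p \<in> flat_forms r" "q \<in> flat_forms r" "a = cls p" "b = cls q"
      by (auto simp: chow_piece_eq)
    then have "a \<oplus>\<^bsub>chow_ring E \<I>\<^esub> b = cls (p + q)" by (simp add: cls_add flat_forms_def)
    then show "f (a \<oplus>\<^bsub>chow_ring E \<I>\<^esub> b) = f a + f b"
      using pq F by (simp add: f_cls flat_forms_add top_functional_def)
  next
    fix c a assume "a \<in> chow_piece E \<I> r"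
    then obtain p where p: "p \<in> flat_forms r" "a = cls p" by (auto simp: chow_piece_eq)
    then have "cls (pconst c) \<otimes>\<^bsub>chow_ring E \<I>\<^esub> a = cls (pconst c * p)"
      by (simp add: cls_mult rpoly_over_pconst flat_forms_def)
    then show "f (cls (pconst c) \<otimes>\<^bsub>chow_ring E \<I>\<^esub> a) = c * f a"
      using p F by (simp add: f_cls flat_forms_pconst_mult top_functional_def)
  next
    fix C assume "complete_flag E \<I> C"
    then show "f (cls (\<Prod>F\<in>C. pvar F)) = 1"
      using F rk_E by (simp add: f_cls complete_flag_in_flat_forms top_functional_def)
  qed
  then show ?thesis by - (rule exI[of _ f])
qed

lemma is_degree_map_unique:
  assumes "is_degree_map E \<I> f" "is_degree_map E \<I> g" "rk E = Suc r"
  shows "f = g"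
proof (rule extensionalityI)
  show "f \<in> extensional (chow_piece E \<I> r)" "g \<in> extensional (chow_piece E \<I> r)"
    using assms by (auto simp: is_degree_map_def Let_def)
  fix a assume "a \<in> chow_piece E \<I> r"
  then obtain p where "p \<in> flat_forms r" "a = cls p" by (auto simp: chow_piece_eq)
  then show "f a = g a"
    using top_functional_unique[OF is_degree_map_top_functional is_degree_map_top_functional] assms
    by blast
qed

lemma chow_deg_cls:
  assumes "top_functional r F" "rk E = Suc r" "p \<in> flat_forms r"
  shows "chow_deg E \<I> (cls p) = F p"
proof -
  obtain f where f: "is_degree_map E \<I> f"
    using top_functional_is_degree_map[OF assms(1,2)] by blast
  then have "chow_deg E \<I> = f"
    unfolding chow_deg_def using is_degree_map_unique[OF _ f assms(2)] by (rule the_equality)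
  then show ?thesis
    using top_functional_unique[OF is_degree_map_top_functional[OF f assms(2)] assms] by simp
qed

end


section \<open>Hypersimplex classes\<close>

text \<open>Abel summation; it evaluates the part of the hypersimplex coefficients that is linear in
  \<open>card S\<close>.\<close>

lemma sum_weighted_diffs:
  fixes y :: "nat \<Rightarrow> 'b::comm_ring_1"
  shows "(\<Sum>j<N. of_nat (Suc j) * (y j - y (Suc j))) = (\<Sum>j\<le>N. y j) - of_nat (Suc N) * y N"
  by (induction N) (simp_all add: algebra_simps)

text \<open>The completion of factors inducts over a list of single factors. One list has to serve
  several functions \<open>h\<close>, namely the factors before and after completion, at every
  ordering.\<close>

lemma exponents_to_list:
  fixes d :: "'b \<Rightarrow> nat"
  assumes "finite K"
  shows "\<exists>ks. length ks = sum d K \<and>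
    (\<forall>h :: 'b \<Rightarrow> complex. prod_list (map h ks) = (\<Prod>k\<in>K. h k ^ d k))"
  using assms
proof (induction K rule: finite_induct)
  case (insert a K)
  then obtain ks where "length ks = sum d K"
    "\<forall>h :: 'b \<Rightarrow> complex. prod_list (map h ks) = (\<Prod>k\<in>K. h k ^ d k)" by auto
  then show ?case
    using insert.hyps by (intro exI[of _ "replicate (d a) a @ ks"]) simp
qed simp

section \<open>Existence of the degree map by localization\<close>

locale complex_localization = loopless_weighted_matroid E \<I> t r
  for E :: "'a set" and \<I> :: "'a set set" and t :: "'a \<Rightarrow> complex" and r :: nat
begin

text \<open>The sign normalizes complete flags to 1. The value 0 in all other degrees extends the
  functional to inhomogeneous polynomials, so that it can be tested on the whole ideal.\<close>

definition top_weight :: "('a set \<Rightarrow>\<^sub>0 nat) \<Rightarrow> complex" where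
  "top_weight m = (if mono_deg m = r
     then (-1) ^ (card E + r + 1) * localize (\<lambda>w. mono_eval (pd w) m) else 0)"

lemma lin_ext_top_weight:
  assumes "homogeneous r p"
  shows "lin_ext top_weight p = (-1) ^ (card E + r + 1) * localize (\<lambda>w. rpoly_eval (pd w) p)"
proof -
  have "lin_ext top_weight p = (\<Sum>m\<in>Poly_Mapping.keys p.
      of_real (Poly_Mapping.lookup p m) * ((-1) ^ (card E + r + 1) * localize (\<lambda>w. mono_eval (pd w) m)))"
    using assms by (auto simp: lin_ext_def top_weight_def homogeneous_iff intro!: sum.cong)
  also have "\<dots> = (-1) ^ (card E + r + 1) * (\<Sum>m\<in>Poly_Mapping.keys p.
      localize (\<lambda>w. of_real (Poly_Mapping.lookup p m) * mono_eval (pd w) m))"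
    by (simp only: sum_distrib_left localize_cmult mult.left_commute)
  also have "\<dots> = (-1) ^ (card E + r + 1) * localize (\<lambda>w. rpoly_eval (pd w) p)"
    by (simp only: rpoly_eval_def lin_ext_def localize_sum)
  finally show ?thesis .
qed

text \<open>Nonflats contribute zero, so each sum may run over all proper subsets, where it equals
  \<open>t i - t (last w)\<close>. The last letter cancels between \<open>i\<close> and
  \<open>j\<close>, and the remaining constant multiplies a monomial of degree \<open>r - 1\<close>,
  which localizes to zero.\<close>

lemma localize_mono_linear_relation:
  assumes m: "Poly_Mapping.keys m \<subseteq> flats" "Suc (mono_deg m) = r" and ij: "i \<in> E" "j \<in> E"
  shows "(\<Sum>F\<in>{F \<in> flats. i \<in> F}. localize (\<lambda>w. mono_eval (pd w) m * pd w F)) =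
    (\<Sum>F\<in>{F \<in> flats. j \<in> F}. localize (\<lambda>w. mono_eval (pd w) m * pd w F))"
proof -
  let ?M = "\<lambda>w. mono_eval (pd w) m" and ?P = "proper_subsets E"
  have keys: "Poly_Mapping.keys m \<subseteq> ?P" using m(1) proper_flats_subset by auto
  have zero: "localize ?M = 0" using keys m(2) by (intro localize_mono_eq_0) auto
  have "(\<Sum>F\<in>{F \<in> flats. i \<in> F}. localize (\<lambda>w. ?M w * pd w F)) =
      localize (\<lambda>w. (t i - t (last w)) * ?M w)" if i: "i \<in> E" for i
  proof -
    have nonflat: "localize (\<lambda>w. ?M w * pd w S) = 0" if "S \<in> ?P" "S \<notin> flats" for S
    proof -
      have "localize (\<lambda>w. mono_eval (pd w) (m + Poly_Mapping.single S 1)) = 0"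
        using keys m(2) that
        by (intro localize_mono_eq_0) (auto simp: keys_add_nat mono_deg_add)
      then show ?thesis by (simp add: mono_eval_add)
    qed
    have "(\<Sum>F\<in>{F \<in> flats. i \<in> F}. localize (\<lambda>w. ?M w * pd w F)) =
        (\<Sum>S\<in>{S \<in> ?P. i \<in> S}. localize (\<lambda>w. ?M w * pd w S))"
      using finite_proper_subsets[OF finite_E] proper_flats_subset nonflat
      by (intro sum.mono_neutral_left) auto
    also have "\<dots> = localize (\<lambda>w. ?M w * (\<Sum>S\<in>{S \<in> ?P. i \<in> S}. pd w S))"
      by (simp add: sum_distrib_left localize_sum)
    also have "\<dots> = localize (\<lambda>w. (t i - t (last w)) * ?M w)"
      by (rule localize_cong) (simp add: sum_prefix_diff_containing[OF finite_E _ i])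
    finally show ?thesis .
  qed
  moreover have "localize (\<lambda>w. (t i - t (last w)) * ?M w) - localize (\<lambda>w. (t j - t (last w)) * ?M w) =
      (t i - t j) * localize ?M"
    by (simp add: algebra_simps flip: localize_diff localize_cmult)
  ultimately show ?thesis using ij zero by simp
qed

lemma lin_ext_top_weight_relation:
  assumes "p \<in> chow_relations E \<I>" "q \<in> rpoly_over flats"
  shows "lin_ext top_weight (q * p) = 0"
proof -
  have "lin_ext (\<lambda>m'. top_weight (m + m')) p = 0" if m: "Poly_Mapping.keys m \<subseteq> flats" for m
    using assms(1) unfolding chow_relations_def
  proof (elim UnE CollectE exE conjE)
    fix F G assume FG: "p = pvar F * pvar G" "\<not> F \<subseteq> G" "\<not> G \<subseteq> F"
    let ?m = "m + (Poly_Mapping.single F 1 + Poly_Mapping.single G 1)"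
    have "mono_eval (pd w) ?m = 0" for w
      using prefix_diff_incomparable[OF FG(2,3), of t w] by (auto simp: mono_eval_add)
    then have "top_weight ?m = 0" by (simp add: top_weight_def localize_def)
    then show ?thesis by (simp add: FG(1) pvar_def mult_single)
  next
    fix i j assume ij: "i \<in> E" "j \<in> E"
      and p: "p = (\<Sum>F\<in>{F \<in> flats. i \<in> F}. pvar F) - (\<Sum>F\<in>{F \<in> flats. j \<in> F}. pvar F)"
    have tw: "top_weight (m + Poly_Mapping.single F 1) = (if Suc (mono_deg m) = r
      then (-1) ^ (card E + r + 1) * localize (\<lambda>w. mono_eval (pd w) m * pd w F) else 0)" for F
      by (simp add: top_weight_def mono_deg_add mono_eval_add)
    have "lin_ext (\<lambda>m'. top_weight (m + m')) p =
      (\<Sum>F\<in>{F \<in> flats. i \<in> F}. top_weight (m + Poly_Mapping.single F 1)) -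
      (\<Sum>F\<in>{F \<in> flats. j \<in> F}. top_weight (m + Poly_Mapping.single F 1))"
      unfolding p pvar_def by (simp add: lin_ext_diff lin_ext_sum)
    also have "\<dots> = 0"
    proof (cases "Suc (mono_deg m) = r")
      case True
      show ?thesis
        unfolding tw if_P[OF True] sum_distrib_left[symmetric]
          localize_mono_linear_relation[OF m True ij] by simp
    next
      case False
      show ?thesis unfolding tw if_not_P[OF False] by simp
    qed
    finally show ?thesis .
  qed
  then show ?thesis
    unfolding lin_ext_mult using assms(2) by (intro sum.neutral) (auto simp: rpoly_over_def)
qed

text \<open>\<open>Z\<close> is the largest ideal on which the functional vanishes; it contains the
  relations, hence the ideal they generate.\<close>

lemma lin_ext_top_weight_ideal:
  assumes "p \<in> chow_ideal E \<I>"
  shows "lin_ext top_weight p = 0"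
proof -
  interpret R: cring "chow_poly_ring E \<I>" unfolding chow_poly_ring_def by (rule cring_rpoly_ring)
  define Z where "Z = {p \<in> rpoly_over flats. \<forall>q\<in>rpoly_over flats. lin_ext top_weight (q * p) = 0}"
  have "ideal Z (chow_poly_ring E \<I>)"
  proof (rule idealI)
    show "subgroup Z (add_monoid (chow_poly_ring E \<I>))"
    proof (rule R.add.subgroupI)
      show "Z \<subseteq> carrier (chow_poly_ring E \<I>)" by (auto simp: Z_def carrier_chow_poly_ring)
      have "0 \<in> Z" by (simp add: Z_def rpoly_over_zero)
      then show "Z \<noteq> {}" by auto
    next
      fix a assume a: "a \<in> Z"
      then have "\<ominus>\<^bsub>chow_poly_ring E \<I>\<^esub> a = - a"
        by (intro R.minus_equality) (auto simp: Z_def chow_poly_ring_def intro: rpoly_over_uminus)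
      then show "\<ominus>\<^bsub>chow_poly_ring E \<I>\<^esub> a \<in> Z"
        using a by (auto simp: Z_def lin_ext_uminus intro: rpoly_over_uminus)
    next
      fix a b assume "a \<in> Z" "b \<in> Z"
      then show "a \<oplus>\<^bsub>chow_poly_ring E \<I>\<^esub> b \<in> Z"
        by (auto simp: Z_def chow_poly_ring_def distrib_left lin_ext_add intro: rpoly_over_add)
    qed
    fix a x assume a: "a \<in> Z" and "x \<in> carrier (chow_poly_ring E \<I>)"
    then have x: "x \<in> rpoly_over flats" by (simp add: carrier_chow_poly_ring)
    then have "lin_ext top_weight (q * (x * a)) = 0" if "q \<in> rpoly_over flats" for q
      using a that rpoly_over_mult[OF that x] by (simp add: Z_def flip: mult.assoc)
    then have "x * a \<in> Z" using a x by (auto simp: Z_def intro: rpoly_over_mult)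
    then show "x \<otimes>\<^bsub>chow_poly_ring E \<I>\<^esub> a \<in> Z" "a \<otimes>\<^bsub>chow_poly_ring E \<I>\<^esub> x \<in> Z"
      by (simp_all add: chow_poly_ring_def mult.commute)
  qed (rule R.ring_axioms)
  then have "chow_ideal E \<I> \<subseteq> Z"
    unfolding chow_ideal_def
    by (rule R.genideal_minimal)
      (use chow_relations_subset lin_ext_top_weight_relation in \<open>auto simp: Z_def\<close>)
  then have "lin_ext top_weight (1 * p) = 0"
    using assms rpoly_over_one unfolding Z_def by blast
  then show ?thesis by simp
qed

text \<open>This yields existence of the degree map. The real part is compatible with linearity,
  since all coefficients are real.\<close>

lemma top_functional_localize: "top_functional r (\<lambda>p. Re (lin_ext top_weight p))"
  unfolding top_functional_def
proof (intro conjI ballI allI impI)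
  fix p q assume "p \<in> flat_forms r" "q \<in> flat_forms r" "p - q \<in> chow_ideal E \<I>"
  then show "Re (lin_ext top_weight p) = Re (lin_ext top_weight q)"
    using lin_ext_top_weight_ideal[of "p - q"] by (simp add: lin_ext_diff)
next
  fix C assume C: "complete_flag E \<I> C"
  then have hom: "homogeneous r (\<Prod>F\<in>C. pvar F :: 'a set rpoly)"
    using complete_flag_in_flat_forms rk_E by (auto simp: flat_forms_def)
  have "localize (\<lambda>w. \<Prod>F\<in>C. pd w F) = (-1) ^ (card E + r + 1)"
    using C localize_chain[of C] proper_flats_subset rk_E by (auto simp: complete_flag_def)
  then show "Re (lin_ext top_weight (\<Prod>F\<in>C. pvar F)) = 1"
    by (simp add: lin_ext_top_weight[OF hom] rpoly_eval_prod rpoly_eval_pvar flip: power_mult_distrib)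
qed (simp_all add: lin_ext_add pconst_def lin_ext_single_mult)

section \<open>Values of the hypersimplex classes at an ordering\<close>

definition hyp_coeff :: "nat \<Rightarrow> 'a set \<Rightarrow> real" where
  "hyp_coeff k S = real (min (card S) k) - real k / real (card E) * real (card S)"

definition hyp_form :: "nat \<Rightarrow> 'a set rpoly" where
  "hyp_form k = (\<Sum>S\<in>proper_subsets E. pconst (hyp_coeff k S) * xgen E \<I> S)"

lemma xgen_homogeneous: "homogeneous 1 (xgen E \<I> S)"
  by (auto simp: xgen_def pvar_def homogeneous_zero intro: homogeneous_single)

lemma xgen_over: "xgen E \<I> S \<in> rpoly_over flats"
  by (auto simp: xgen_def intro: rpoly_over_zero rpoly_over_pvar)

lemma hyp_form_over: "hyp_form k \<in> rpoly_over flats"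
  unfolding hyp_form_def by (intro rpoly_over_sum rpoly_over_mult rpoly_over_pconst xgen_over)

lemma hyp_form_homogeneous: "homogeneous 1 (hyp_form k)"
  unfolding hyp_form_def by (intro homogeneous_sum homogeneous_pconst_mult xgen_homogeneous)

text \<open>At both ends, \<open>k = 0\<close> and \<open>k = card E\<close>, the coefficients
  vanish identically, so one formula covers the boundary convention.\<close>

lemma hyp_gamma_eq:
  assumes "k \<le> card E"
  shows "hyp_gamma E \<I> k = cls (hyp_form k)"
proof (cases "1 \<le> k \<and> k < card E")
  case True
  then show ?thesis by (simp add: hyp_gamma_def hyp_form_def hyp_coeff_def proper_subsets_def)
next
  case False
  then have k: "k = 0 \<or> k = card E" using assms by auto
  have "hyp_coeff k S = 0" if "S \<in> proper_subsets E" for S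
  proof -
    have "S \<subseteq> E" using that by (auto simp: proper_subsets_def)
    then have "card S \<le> card E" using finite_E by (rule card_mono[rotated])
    then show ?thesis using k by (auto simp: hyp_coeff_def)
  qed
  then have "hyp_form k = 0" by (simp add: hyp_form_def pconst_def)
  then show ?thesis using False cls_zero by (auto simp: hyp_gamma_def)
qed

lemma hyp_Lambda_eq: "k < card E \<Longrightarrow> hyp_Lambda E \<I> k = cls (hyp_form (Suc k) - hyp_form k)"
  by (simp add: hyp_Lambda_def hyp_gamma_eq cls_diff hyp_form_over)

lemma rpoly_eval_hyp_form:
  "rpoly_eval f (hyp_form k) = (\<Sum>S\<in>flats. of_real (hyp_coeff k S) * f S)"
proof -
  have "rpoly_eval f (hyp_form k) =
      (\<Sum>S\<in>proper_subsets E. rpoly_eval f (pconst (hyp_coeff k S) * xgen E \<I> S))"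
    unfolding hyp_form_def rpoly_eval_def by (rule lin_ext_sum)
  also have "\<dots> = (\<Sum>S\<in>flats. rpoly_eval f (pconst (hyp_coeff k S) * xgen E \<I> S))"
    using finite_proper_subsets[OF finite_E] proper_flats_subset
    by (intro sum.mono_neutral_right) (auto simp: xgen_def rpoly_eval_def)
  also have "\<dots> = (\<Sum>S\<in>flats. of_real (hyp_coeff k S) * f S)"
    by (intro sum.cong) (auto simp: xgen_def rpoly_eval_mult rpoly_eval_pconst rpoly_eval_pvar)
  finally show ?thesis .
qed

text \<open>Passing from \<open>k\<close> to \<open>Suc k\<close> raises
  \<open>min (card S) k\<close> exactly when \<open>k < card S\<close>; this indicator telescopes to
  \<open>y k - y N\<close>. The linear part gives \<open>y N\<close> minus the mean of
  \<open>t\<close> by Abel summation, so the boundary terms cancel and only the mean is left to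
  correct.\<close>

lemma sum_hyp_coeff_pd:
  assumes w: "w \<in> permutations_of_set E" and k: "k < card E"
  shows "(\<Sum>e\<in>E. t e) / of_nat (card E) +
    (\<Sum>S\<in>proper_subsets E. of_real (hyp_coeff (Suc k) S - hyp_coeff k S) * pd w S) = t (w ! k)"
proof -
  have ws: "set w = E" "distinct w" using w by (auto dest: permutations_of_setD)
  have len: "length w = card E" using ws by (metis distinct_card)
  obtain N where N: "card E = Suc N" using k by (cases "card E") auto
  define y where "y = (\<lambda>j. t (w ! j))"
  define g where "g = (\<lambda>s. (if k < s then 1 else 0) - of_nat s / of_nat (Suc N) :: complex)"
  have "(\<Sum>S\<in>proper_subsets E. of_real (hyp_coeff (Suc k) S - hyp_coeff k S) * pd w S) =
      (\<Sum>S\<in>proper_subsets E. g (card S) * pd w S)"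
  proof (rule sum.cong[OF refl])
    fix S assume "S \<in> proper_subsets E"
    have "hyp_coeff (Suc k) S - hyp_coeff k S = (if k < card S then 1 else 0) - real (card S) / real (Suc N)"
    proof -
      have "real (Suc k) / real (Suc N) * real (card S) - real k / real (Suc N) * real (card S) =
          real (card S) / real (Suc N)"
        by (simp add: add_divide_distrib algebra_simps del: of_nat_Suc) (simp add: add_divide_distrib algebra_simps)
      moreover have "real (min (card S) (Suc k)) - real (min (card S) k) = (if k < card S then 1 else 0)"
        by (auto simp: min_def)
      ultimately show ?thesis unfolding hyp_coeff_def N by linarith
    qed
    then have "of_real (hyp_coeff (Suc k) S - hyp_coeff k S) = g (card S)"
      by (simp add: g_def)
    then show "of_real (hyp_coeff (Suc k) S - hyp_coeff k S) * pd w S = g (card S) * pd w S" by simp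
  qed
  also have "\<dots> = (\<Sum>j<N. g (card (set (take (Suc j) w))) * (y j - y (Suc j)))"
    unfolding sum_prefix_diff[OF finite_E w] by (simp add: len N y_def)
  also have "\<dots> = (\<Sum>j<N. g (Suc j) * (y j - y (Suc j)))"
    using ws len N by (intro sum.cong) (auto simp: distinct_card)
  also have "\<dots> = (\<Sum>j<N. (if k \<le> j then 1 else 0) * (y j - y (Suc j))) -
      (\<Sum>j<N. of_nat (Suc j) * (y j - y (Suc j))) / of_nat (Suc N)"
    unfolding sum_divide_distrib sum_subtractf[symmetric]
    by (rule sum.cong) (auto simp: g_def left_diff_distrib less_Suc_eq_le)
  also have "(\<Sum>j<N. (if k \<le> j then 1 else 0) * (y j - y (Suc j))) = (\<Sum>j\<in>{k..<N}. y j - y (Suc j))"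
    by (rule sum.mono_neutral_cong_right) auto
  also have "\<dots> = - (\<Sum>j\<in>{k..<N}. y (Suc j) - y j)" by (simp flip: sum_negf)
  also have "\<dots> = y k - y N" using k N by (subst sum_Suc_diff') auto
  also have "(\<Sum>j<N. of_nat (Suc j) * (y j - y (Suc j))) = (\<Sum>e\<in>E. t e) - of_nat (Suc N) * y N"
  proof -
    have "bij_betw ((!) w) {..<length w} (set w)" by (rule bij_betw_nth[OF ws(2)]) auto
    then have "bij_betw ((!) w) {..N} E" unfolding len N ws(1) lessThan_Suc_atMost .
    then have "(\<Sum>j\<le>N. y j) = (\<Sum>e\<in>E. t e)"
      unfolding y_def by (rule sum.reindex_bij_betw)
    then show ?thesis by (simp only: sum_weighted_diffs)
  qed
  finally show ?thesis
    unfolding N by (simp add: diff_divide_distrib y_def del: of_nat_Suc)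
qed

lemma chow_deg_hyp_Lambda:
  assumes K: "finite K" "K \<subseteq> {..<card E}" and d: "(\<Sum>k\<in>K. d k) = r"
  shows "chow_deg E \<I> (\<Otimes>\<^bsub>chow_ring E \<I>\<^esub>k\<in>K. hyp_Lambda E \<I> k [^]\<^bsub>chow_ring E \<I>\<^esub> d k) =
    Re ((-1) ^ (card E + r + 1) * localize (\<lambda>w. \<Prod>k\<in>K. t (w ! k) ^ d k))"
proof -
  interpret A: cring "chow_ring E \<I>" by (rule cring_chow_ring)
  define l where "l = (\<lambda>k. hyp_form (Suc k) - hyp_form k)"
  have l_over: "l k \<in> rpoly_over flats" for k
    unfolding l_def by (intro rpoly_over_diff hyp_form_over)
  have l_hom: "homogeneous 1 (l k)" for k
    unfolding l_def by (intro homogeneous_diff hyp_form_homogeneous)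
  let ?p = "\<Prod>k\<in>K. l k ^ d k"
  have "(\<Otimes>\<^bsub>chow_ring E \<I>\<^esub>k\<in>K. hyp_Lambda E \<I> k [^]\<^bsub>chow_ring E \<I>\<^esub> d k) =
      (\<Otimes>\<^bsub>chow_ring E \<I>\<^esub>k\<in>K. cls (l k ^ d k))"
  proof (rule A.finprod_cong'[OF refl])
    show "(\<lambda>k. cls (l k ^ d k)) \<in> K \<rightarrow> carrier (chow_ring E \<I>)"
      by (intro Pi_I cls_closed rpoly_over_power l_over)
    show "hyp_Lambda E \<I> k [^]\<^bsub>chow_ring E \<I>\<^esub> d k = cls (l k ^ d k)" if "k \<in> K" for k
    proof -
      have "hyp_Lambda E \<I> k = cls (l k)" using K(2) that hyp_Lambda_eq[of k] by (auto simp: l_def)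
      then show ?thesis using cls_power[OF l_over, of k "d k"] by simp
    qed
  qed
  also have "\<dots> = cls ?p"
    using K(1) l_over by (intro cls_prod[symmetric] rpoly_over_power) auto
  finally have prod: "(\<Otimes>\<^bsub>chow_ring E \<I>\<^esub>k\<in>K. hyp_Lambda E \<I> k [^]\<^bsub>chow_ring E \<I>\<^esub> d k) = cls ?p" .
  have hom: "homogeneous r ?p"
    using homogeneous_prod[OF K(1), of d "\<lambda>k. l k ^ d k"] homogeneous_power[OF l_hom] d by simp
  then have "?p \<in> flat_forms r"
    using l_over by (auto simp: flat_forms_def intro!: rpoly_over_prod rpoly_over_power)
  then have deg: "chow_deg E \<I> (cls ?p) = Re ((-1) ^ (card E + r + 1) * localize (\<lambda>w. rpoly_eval (pd w) ?p))"
    using chow_deg_cls[OF top_functional_localize rk_E] lin_ext_top_weight[OF hom] by simp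
  let ?c = "\<lambda>k S. of_real (hyp_coeff (Suc k) S - hyp_coeff k S) :: complex"
  \<comment> \<open>The mean of \<open>t\<close> is the shift that turns the value of the completed
    linear form into \<open>t (w ! k)\<close>.\<close>
  let ?b = "\<lambda>k::nat. (\<Sum>e\<in>E. t e) / of_nat (card E)"
  have eval: "rpoly_eval f (l k) = (\<Sum>S\<in>flats. ?c k S * f S)" for f k
  proof -
    have "rpoly_eval f (l k) = rpoly_eval f (hyp_form (Suc k)) - rpoly_eval f (hyp_form k)"
      unfolding l_def rpoly_eval_def by (rule lin_ext_diff)
    then show ?thesis
      by (simp add: rpoly_eval_hyp_form left_diff_distrib sum_subtractf)
  qed
  obtain ks where ks: "length ks = sum d K"
      "\<And>h :: nat \<Rightarrow> complex. prod_list (map h ks) = (\<Prod>k\<in>K. h k ^ d k)"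
    using exponents_to_list[OF K(1), of d] by auto
  have "localize (\<lambda>w. rpoly_eval (pd w) ?p) =
      localize (\<lambda>w. 1 * prod_list (map (\<lambda>k. \<Sum>S\<in>flats. ?c k S * pd w S) ks))"
    unfolding ks(2) rpoly_eval_prod rpoly_eval_power eval by simp
  also have "\<dots> = localize (\<lambda>w. 1 * prod_list (map (\<lambda>k. ?b k + (\<Sum>S\<in>proper_subsets E. ?c k S * pd w S)) ks))"
    using ks(1) d by (intro localize_complete_factors[of 0] poly_family.const) auto
  also have "\<dots> = localize (\<lambda>w. \<Prod>k\<in>K. t (w ! k) ^ d k)"
    unfolding ks(2)
  proof (rule localize_cong)
    fix w assume w: "w \<in> permutations_of_set E"
    have "(?b k + (\<Sum>S\<in>proper_subsets E. ?c k S * pd w S)) ^ d k = t (w ! k) ^ d k" if "k \<in> K" for k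
      using sum_hyp_coeff_pd[OF w, of k] K(2) that by (intro arg_cong[of _ _ "\<lambda>x. x ^ d k"]) auto
    then show "1 * (\<Prod>k\<in>K. (?b k + (\<Sum>S\<in>proper_subsets E. ?c k S * pd w S)) ^ d k) =
        (\<Prod>k\<in>K. t (w ! k) ^ d k)"
      by (simp only: mult_1_left cong: prod.cong)
  qed
  finally show ?thesis unfolding prod deg by simp
qed

end


section \<open>Constant terms\<close>

abbreviation roots_of_unity :: "nat \<Rightarrow> complex set" where
  "roots_of_unity M \<equiv> {z. z ^ M = 1}"

text \<open>Multiplication by a primitive root permutes the roots and multiplies the sum by
  \<open>\<zeta> ^ k\<close>, which differs from 1 unless \<open>M\<close> divides
  \<open>k\<close>.\<close>

lemma sum_power_roots_of_unity:
  assumes "0 < M"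
  shows "(\<Sum>z\<in>roots_of_unity M. z ^ k) = (if M dvd k then of_nat M else 0)"
proof (cases "M dvd k")
  case True
  then obtain l where "k = M * l" by auto
  then have "(\<Sum>z\<in>roots_of_unity M. z ^ k) = (\<Sum>z\<in>roots_of_unity M. 1)"
    by (intro sum.cong) (auto simp: power_mult)
  then show ?thesis using True card_roots_unity_eq[OF assms] by simp
next
  case False
  define \<zeta> where "\<zeta> = cis (2 * pi * real 1 / real M)"
  have bij: "bij_betw (\<lambda>k. cis (2 * pi * real k / real M)) {..<M} (roots_of_unity M)"
    by (rule bij_betw_roots_unity[OF assms])
  have \<zeta>M: "\<zeta> ^ M = 1"
    using assms by (simp add: \<zeta>_def DeMoivre)
  let ?j = "k mod M"
  have j: "0 < ?j" "?j < M" using False assms by (auto simp: dvd_eq_mod_eq_0)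
  have "\<zeta> ^ k = \<zeta> ^ (M * (k div M) + ?j)" by simp
  also have "\<dots> = \<zeta> ^ ?j" by (simp only: power_add power_mult \<zeta>M) simp
  also have "\<dots> = cis (2 * pi * real ?j / real M)" by (simp add: \<zeta>_def DeMoivre mult_ac)
  also have "\<dots> \<noteq> cis (2 * pi * real 0 / real M)"
    using bij_betw_imp_inj_on[OF bij] j assms by (metis inj_on_def lessThan_iff less_irrefl)
  finally have neq: "\<zeta> ^ k \<noteq> 1" by simp
  have "bij_betw (\<lambda>z. \<zeta> * z) (roots_of_unity M) (roots_of_unity M)"
  proof (rule bij_betwI[of _ _ _ "\<lambda>z. z / \<zeta>"])
    have "\<zeta> \<noteq> 0" by (simp add: \<zeta>_def)
    then show "\<zeta> * z / \<zeta> = z" "\<zeta> * (z / \<zeta>) = z" for z by simp_all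
  qed (auto simp: power_mult_distrib power_divide \<zeta>M)
  then have "(\<Sum>z\<in>roots_of_unity M. (\<zeta> * z) ^ k) = (\<Sum>z\<in>roots_of_unity M. z ^ k)"
    by (rule sum.reindex_bij_betw)
  then have "\<zeta> ^ k * (\<Sum>z\<in>roots_of_unity M. z ^ k) = (\<Sum>z\<in>roots_of_unity M. z ^ k)"
    by (simp add: power_mult_distrib sum_distrib_left)
  then show ?thesis using neq False by simp
qed

text \<open>On these points \<open>u = U z\<close> satisfies \<open>u ^ M = U ^ M\<close>. Thus
  \<open>1 / (u - 1)\<close> is a finite geometric sum over a constant and \<open>1 / u ^ i\<close>
  is a positive power over a constant; averaging then keeps only the exponents divisible by
  \<open>M\<close>.\<close>

lemma sum_roots_of_unity_geometric:
  fixes U :: real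
  assumes "0 < U" "U \<noteq> 1" "i < M" "s \<le> i + M"
  shows "(\<Sum>z\<in>roots_of_unity M. (of_real U * z) ^ s / ((of_real U * z) ^ i * (of_real U * z - 1))) =
    of_nat M * of_real (if s \<le> i then 1 / (U ^ M - 1) else U ^ M / (U ^ M - 1))"
proof -
  have M: "0 < M" using assms(3) by simp
  define p where "p = s + (M - i)"
  \<comment> \<open>Among the \<open>M\<close> consecutive exponents \<open>p + j\<close> exactly
    one is divisible by \<open>M\<close>, namely \<open>q\<close>, attained at
    \<open>j0\<close>.\<close>
  define j0 where "j0 = (if s \<le> i then i - s else M - (s - i))"
  define q where "q = (if s \<le> i then M else 2 * M)"
  have j0: "j0 < M" "p + j0 = q" "M dvd q"
    using assms(3,4) by (auto simp: j0_def p_def q_def)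
  have UM: "U ^ M \<noteq> 1" using assms(1,2) M power_eq_1_iff[of U M] by (auto simp: power_eq_1_iff)
  have UMc: "(of_real U ^ M :: complex) \<noteq> 1" by (metis UM of_real_1 of_real_eq_iff of_real_power)
  have uniq: "M dvd p + j \<longleftrightarrow> j = j0" if "j < M" for j
  proof
    assume "M dvd p + j"
    then have "int M dvd int (p + j) - int (p + j0)" using j0 by (metis dvd_diff int_dvd_int_iff)
    then have "int M dvd int j - int j0" by simp
    then have "\<bar>int M\<bar> \<le> \<bar>int j - int j0\<bar>" if "j \<noteq> j0"
      by (intro dvd_imp_le_int) (use that in auto)
    then show "j = j0" using that j0(1) by linarith
  qed (use j0 in auto)
  have summand: "(of_real U * z) ^ s / ((of_real U * z) ^ i * (of_real U * z - 1)) =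
      (\<Sum>j<M. of_real U ^ (p + j) * z ^ (p + j)) / (of_real U ^ M * (of_real U ^ M - 1))"
    if z: "z \<in> roots_of_unity M" for z :: complex
  proof -
    define u where "u = of_real U * z"
    have uM: "u ^ M = of_real U ^ M" using z by (simp add: u_def power_mult_distrib)
    have u1: "u \<noteq> 1" using uM UMc by auto
    have u0: "u \<noteq> 0" using z M assms(1) by (auto simp: u_def power_0_left)
    have "(u - 1) * (\<Sum>j<M. u ^ j) = u ^ M - 1" by (simp add: power_diff_1_eq)
    then have geo: "1 / (u - 1) = (\<Sum>j<M. u ^ j) / (u ^ M - 1)"
      using u1 UMc uM by (simp add: field_simps)
    have "u ^ i * u ^ (M - i) = u ^ M" using assms(3) by (simp flip: power_add)
    then have inv: "1 / u ^ i = u ^ (M - i) / u ^ M"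
      using u0 by (simp add: field_simps)
    have "u ^ s / (u ^ i * (u - 1)) = u ^ s * (1 / u ^ i) * (1 / (u - 1))" by simp
    also have "\<dots> = u ^ p * (\<Sum>j<M. u ^ j) / (u ^ M * (u ^ M - 1))"
      unfolding geo inv by (simp add: p_def power_add)
    also have "u ^ p * (\<Sum>j<M. u ^ j) = (\<Sum>j<M. of_real U ^ (p + j) * z ^ (p + j))"
      by (simp add: sum_distrib_left u_def power_mult_distrib power_add mult_ac)
    finally show ?thesis by (simp add: u_def[symmetric] uM)
  qed
  have "(\<Sum>z\<in>roots_of_unity M. (of_real U * z) ^ s / ((of_real U * z) ^ i * (of_real U * z - 1))) =
      (\<Sum>z\<in>roots_of_unity M. \<Sum>j<M. of_real U ^ (p + j) * z ^ (p + j)) / (of_real U ^ M * (of_real U ^ M - 1))"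
    unfolding sum_divide_distrib[symmetric] using summand by (simp add: sum_divide_distrib)
  also have "(\<Sum>z\<in>roots_of_unity M. \<Sum>j<M. of_real U ^ (p + j) * z ^ (p + j)) =
      (\<Sum>j<M. of_real U ^ (p + j) * (\<Sum>z\<in>roots_of_unity M. z ^ (p + j)))"
    by (subst sum.swap) (simp add: sum_distrib_left)
  also have "\<dots> = (\<Sum>j<M. if j = j0 then of_real U ^ q * of_nat M else 0)"
    using uniq j0(2) by (intro sum.cong) (auto simp: sum_power_roots_of_unity[OF M])
  also have "\<dots> = of_real U ^ q * of_nat M" using j0(1) by simp
  also have "of_real U ^ q * of_nat M / (of_real U ^ M * (of_real U ^ M - 1) :: complex) =
      of_nat M * of_real (if s \<le> i then 1 / (U ^ M - 1) else U ^ M / (U ^ M - 1))"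
    using assms(1) by (auto simp: q_def mult_2 power_add)
  finally show ?thesis .
qed

text \<open>The consecutive ratios range independently over the roots of unity, and one coordinate
  remains free; it accounts for the factor \<open>M\<close>. In the induction,
  \<open>y \<mapsto> a / y\<close> permutes the roots.\<close>

lemma sum_torus_prod:
  assumes "0 < M"
  shows "(\<Sum>z\<in>PiE {..n} (\<lambda>_. roots_of_unity M). \<Prod>i<n. h i (z i / z (Suc i))) =
    (of_nat M :: complex) * (\<Prod>i<n. \<Sum>y\<in>roots_of_unity M. h i y)"
proof (induction n)
  case 0
  have "card (PiE {..0::nat} (\<lambda>_. roots_of_unity M)) = M"
    by (simp add: card_PiE card_roots_unity_eq[OF assms])
  then show ?case by simp
next
  case (Suc n)
  let ?R = "roots_of_unity M" and ?P = "PiE {..n} (\<lambda>_. roots_of_unity M)"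
  have shift: "(\<Sum>y\<in>?R. h n (a / y)) = (\<Sum>y\<in>?R. h n y)" if "a \<in> ?R" for a
  proof (rule sum.reindex_bij_witness[of _ "\<lambda>y. a / y" "\<lambda>y. a / y"])
    have "a \<noteq> 0" using that assms by (auto simp: power_0_left)
    then show "a / (a / y) = y" for y by simp
    then show "a / (a / y) = y" for y .
  qed (use that in \<open>auto simp: power_divide\<close>)
  have "{..Suc n} = insert (Suc n) {..n}" by auto
  then have "(\<Sum>z\<in>PiE {..Suc n} (\<lambda>_. ?R). \<Prod>i<Suc n. h i (z i / z (Suc i))) =
      (\<Sum>z\<in>(\<lambda>(y, g). g(Suc n := y)) ` (?R \<times> ?P). \<Prod>i<Suc n. h i (z i / z (Suc i)))"
    by (simp only: PiE_insert_eq)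
  also have "\<dots> = (\<Sum>(y, g)\<in>?R \<times> ?P. \<Prod>i<Suc n. h i ((g(Suc n := y)) i / (g(Suc n := y)) (Suc i)))"
    by (subst sum.reindex) (auto intro: inj_combinator simp: split_beta)
  also have "\<dots> = (\<Sum>(y, g)\<in>?R \<times> ?P. (\<Prod>i<n. h i (g i / g (Suc i))) * h n (g n / y))"
    by (intro sum.cong) auto
  also have "\<dots> = (\<Sum>g\<in>?P. \<Sum>y\<in>?R. (\<Prod>i<n. h i (g i / g (Suc i))) * h n (g n / y))"
    by (subst sum.swap) (simp add: sum.cartesian_product)
  also have "\<dots> = (\<Sum>g\<in>?P. (\<Prod>i<n. h i (g i / g (Suc i))) * (\<Sum>y\<in>?R. h n y))"
    unfolding sum_distrib_left[symmetric] by (intro sum.cong refl) (subst shift, auto)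
  also have "\<dots> = of_nat M * (\<Prod>i<n. \<Sum>y\<in>?R. h i y) * (\<Sum>y\<in>?R. h n y)"
    unfolding sum_distrib_right[symmetric] Suc.IH ..
  finally show ?case by (simp add: mult.assoc)
qed

text \<open>Relabelling coordinates. Outside \<open>{..n}\<close> the functions are undefined and
  \<open>w\<close> is the identity, so extensionality is preserved.\<close>

lemma sum_torus_permute:
  assumes "w permutes {..n}"
  shows "(\<Sum>z\<in>PiE {..n} (\<lambda>_. R). f (\<lambda>i. z (w i))) = (\<Sum>z\<in>PiE {..n} (\<lambda>_. R). f z)"
proof (rule sum.reindex_bij_witness[of _ "\<lambda>z i. z (inv_into UNIV w i)" "\<lambda>z i. z (w i)"])
  have w': "inv_into UNIV w permutes {..n}" using assms by (rule permutes_inv)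
  show "(\<lambda>i. z (w (inv_into UNIV w i))) = z" "(\<lambda>i. z (inv_into UNIV w (w i))) = z" for z
    using permutes_inverses[OF assms] by simp_all
  have "(\<lambda>i. z (v i)) \<in> PiE {..n} (\<lambda>_. R)" if "z \<in> PiE {..n} (\<lambda>_. R)" "v permutes {..n}" for z v
    using that permutes_in_image[OF that(2)] permutes_not_in[OF that(2)]
    by (auto simp: PiE_iff extensional_def)
  then show "(\<lambda>i. z (w i)) \<in> PiE {..n} (\<lambda>_. R)" "(\<lambda>i. z (inv_into UNIV w i)) \<in> PiE {..n} (\<lambda>_. R)"
    if "z \<in> PiE {..n} (\<lambda>_. R)" for z
    using that assms w' by blast+
qed simp

text \<open>Both sides of the fraction have degree \<open>n\<close>, so it depends only on the
  ratios. Rewriting each \<open>y i\<close> through the next one accumulates exponents: the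
  numerator puts the partial sum of \<open>c\<close> on the ratio at \<open>i\<close>, and the
  denominator puts \<open>i\<close> on it because \<open>i\<close> earlier factors pass
  through.\<close>

lemma monomial_over_diffs:
  fixes y :: "nat \<Rightarrow> 'f::field" and c :: "nat \<Rightarrow> nat"
  assumes "\<And>i. i \<le> n \<Longrightarrow> y i \<noteq> 0" "(\<Sum>k\<le>n. c k) = n"
  shows "(\<Prod>k\<le>n. y k ^ c k) / (\<Prod>i<n. y i - y (Suc i)) =
    (\<Prod>i<n. (y i / y (Suc i)) ^ (\<Sum>j\<le>i. c j) / ((y i / y (Suc i)) ^ i * (y i / y (Suc i) - 1)))"
proof -
  have num: "(\<Prod>k\<le>N. y k ^ c k) = y N ^ (\<Sum>k\<le>N. c k) * (\<Prod>i<N. (y i / y (Suc i)) ^ (\<Sum>j\<le>i. c j))"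
    if "N \<le> n" for N
    using that
  proof (induction N)
    case (Suc N)
    have "y N ^ (\<Sum>k\<le>N. c k) = y (Suc N) ^ (\<Sum>k\<le>N. c k) * (y N / y (Suc N)) ^ (\<Sum>k\<le>N. c k)"
      using assms(1)[OF Suc.prems] by (simp flip: power_mult_distrib)
    then show ?case using Suc by (simp add: power_add mult_ac)
  qed simp
  have den: "(\<Prod>i<N. y i - y (Suc i)) =
      y N ^ N * (\<Prod>i<N. (y i / y (Suc i)) ^ i * (y i / y (Suc i) - 1))" if "N \<le> n" for N
    using that
  proof (induction N)
    case (Suc N)
    have "y N - y (Suc N) = y (Suc N) * (y N / y (Suc N) - 1)"
      "y N ^ N = y (Suc N) ^ N * (y N / y (Suc N)) ^ N"
      using assms(1)[OF Suc.prems] by (simp_all add: algebra_simps flip: power_mult_distrib)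
    then show ?case using Suc by (simp add: mult_ac)
  qed simp
  show ?thesis
    unfolding num[OF order_refl] den[OF order_refl] assms(2)
    using assms(1)[OF order_refl] by (simp add: prod_dividef)
qed

text \<open>With \<open>P\<close> for \<open>s \<le> i\<close>, these limits are the constant terms
  of \<open>u ^ s / (u ^ i * (u - 1))\<close>, expanded at 0 if \<open>U < 1\<close> and at infinity
  otherwise.\<close>

lemma geometric_average_limit:
  fixes U :: real
  assumes "0 < U" "U \<noteq> 1"
  shows "(\<lambda>M. if P then 1 / (U ^ M - 1) else U ^ M / (U ^ M - 1)) \<longlonglongrightarrow>
    (if P then (if U < 1 then -1 else 0) else (if U < 1 then 0 else 1))"
proof (cases "U < 1")
  case True
  then have "(\<lambda>M. U ^ M) \<longlonglongrightarrow> 0" using assms by (intro LIMSEQ_power_zero) auto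
  then have "(\<lambda>M. 1 / (U ^ M - 1)) \<longlonglongrightarrow> 1 / (0 - 1)" "(\<lambda>M. U ^ M / (U ^ M - 1)) \<longlonglongrightarrow> 0 / (0 - 1)"
    by (intro tendsto_divide tendsto_diff tendsto_const; simp)+
  then show ?thesis using True by auto
next
  case False
  define V where "V = 1 / U"
  have V: "0 < V" "V < 1" using False assms by (auto simp: V_def)
  then have "(\<lambda>M. V ^ M) \<longlonglongrightarrow> 0" by (intro LIMSEQ_power_zero) auto
  then have lim: "(\<lambda>M. V ^ M / (1 - V ^ M)) \<longlonglongrightarrow> 0 / (1 - 0)" "(\<lambda>M. 1 / (1 - V ^ M)) \<longlonglongrightarrow> 1 / (1 - 0)"
    by (intro tendsto_divide tendsto_diff tendsto_const; simp)+
  have "1 / (U ^ M - 1) = V ^ M / (1 - V ^ M)" "U ^ M / (U ^ M - 1) = 1 / (1 - V ^ M)" for M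
    using assms(1) by (auto simp: V_def power_divide divide_simps)
  then show ?thesis using False lim by auto
qed

text \<open>Postnikov's constant term extraction: averaging over \<open>t j = z j / 2 ^ j\<close> with \<open>z j\<close> ranging
  over the \<open>M\<close>-th roots of unity, and then letting \<open>M\<close> tend to infinity, picks the constant term of
  the expansion in the region where \<open>t 0\<close> dominates \<open>t 1\<close>, which dominates \<open>t 2\<close>, and so on.\<close>

lemma constant_term:
  fixes c :: "(nat \<Rightarrow> nat) \<Rightarrow> nat \<Rightarrow> nat" and D :: real
  assumes D: "\<And>t :: nat \<Rightarrow> complex. inj_on t {..n} \<Longrightarrow> (\<And>i. i \<le> n \<Longrightarrow> t i \<noteq> 0) \<Longrightarrow>
      Re (\<Sum>w | w permutes {..n}. (\<Prod>k\<le>n. t (w k) ^ c w k) / (\<Prod>i<n. t (w i) - t (w (Suc i)))) = D"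
    and c: "\<And>w. w permutes {..n} \<Longrightarrow> (\<Sum>k\<le>n. c w k) = n"
  shows "D = (\<Sum>w | w permutes {..n} \<and> Des n w = {i. i < n \<and> (\<Sum>j\<le>i. c w j) < i + 1}.
    (-1) ^ card (Des n w))"
proof -
  let ?W = "{w. w permutes {..n}}"
  define s where "s = (\<lambda>w i. \<Sum>j\<le>i. c w j)"
  \<comment> \<open>The modulus of \<open>t (w i) / t (w (Suc i))\<close> at the chosen points; it
    is less than 1 exactly at a descent.\<close>
  define U where "U = (\<lambda>w i. 2 ^ w (Suc i) / 2 ^ w i :: real)"
  define A where "A = (\<lambda>w i M. if s w i \<le> i then 1 / (U w i ^ M - 1) else U w i ^ M / (U w i ^ M - 1))"
  define \<epsilon> where "\<epsilon> = (\<lambda>w i. if s w i \<le> i then (if U w i < 1 then -1 else 0)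
      else (if U w i < 1 then 0 else 1) :: real)"
  have fin: "finite ?W" by (rule finite_permutations) simp
  have U_pos: "0 < U w i" for w i by (simp add: U_def)
  have U_less: "U w i < 1 \<longleftrightarrow> w (Suc i) < w i" for w i
    by (simp add: U_def)
  have U_neq: "U w i \<noteq> 1" if "w permutes {..n}" for w i
  proof -
    have "w (Suc i) \<noteq> w i" using permutes_inj[OF that] by (metis injD n_not_Suc_n)
    then show ?thesis by (simp add: U_def)
  qed
  \<comment> \<open>An exact identity, since \<open>D\<close> is the value at every point that
    enters the average. The bound \<open>n < M\<close> keeps all exponents in the range of
    \<open>sum_roots_of_unity_geometric\<close>.\<close>
  have avg: "D = (\<Sum>w\<in>?W. \<Prod>i<n. A w i M)" if M: "n < M" for M
  proof -
    let ?R = "roots_of_unity M" and ?P = "PiE {..n} (\<lambda>_. roots_of_unity M)"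
    have M0: "0 < M" using M by simp
    define T where "T = (\<lambda>z j. z j / 2 ^ j :: complex)"
    define g where "g = (\<lambda>w i y. (of_real (U w i) * y) ^ s w i /
        ((of_real (U w i) * y) ^ i * (of_real (U w i) * y - 1)) :: complex)"
    have norm_R: "norm y = 1" if "y \<in> ?R" for y :: complex
    proof -
      have "norm y ^ M = 1" using that by (simp flip: norm_power)
      then show ?thesis using M0 power_eq_1_iff[of "norm y" M] by (auto simp: power_eq_1_iff)
    qed
    have card: "card ?P = M ^ Suc n"
      by (simp add: card_PiE card_roots_unity_eq[OF M0])
    have eval: "(\<Sum>w\<in>?W. (\<Prod>k\<le>n. T z (w k) ^ c w k) / (\<Prod>i<n. T z (w i) - T z (w (Suc i)))) =
        (\<Sum>w\<in>?W. \<Prod>i<n. g w i (z (w i) / z (w (Suc i))))" if z: "z \<in> ?P" for z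
    proof (rule sum.cong[OF refl])
      fix w assume "w \<in> ?W"
      then have w: "w permutes {..n}" by simp
      have nz: "T z (w i) \<noteq> 0" if "i \<le> n" for i
      proof -
        have "w i \<in> {..n}" using permutes_in_image[OF w] that by simp
        then have "norm (z (w i)) = 1" using z norm_R by (auto simp: PiE_iff)
        then show ?thesis by (auto simp: T_def)
      qed
      have u: "T z (w i) / T z (w (Suc i)) = of_real (U w i) * (z (w i) / z (w (Suc i)))" for i
        by (simp add: T_def U_def)
      show "(\<Prod>k\<le>n. T z (w k) ^ c w k) / (\<Prod>i<n. T z (w i) - T z (w (Suc i))) =
          (\<Prod>i<n. g w i (z (w i) / z (w (Suc i))))"
        using monomial_over_diffs[of n "\<lambda>k. T z (w k)" "c w", OF nz c[OF w]]
        by (simp only: u g_def s_def)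
    qed
    have D_z: "Re (\<Sum>w\<in>?W. \<Prod>i<n. g w i (z (w i) / z (w (Suc i)))) = D" if z: "z \<in> ?P" for z
    proof -
      \<comment> \<open>The powers of 2 separate the moduli, so the points are distinct and nonzero
        for every choice of roots of unity.\<close>
      have norm: "norm (T z i) = 1 / 2 ^ i" if "i \<le> n" for i
        using z norm_R that by (auto simp: T_def PiE_iff norm_divide norm_power)
      have "inj_on (T z) {..n}"
      proof (rule inj_onI)
        fix i j assume "i \<in> {..n}" "j \<in> {..n}" "T z i = T z j"
        then have "1 / 2 ^ i = (1 / 2 ^ j :: real)" using norm by (metis atMost_iff)
        then show "i = j" by simp
      qed
      moreover have "T z i \<noteq> 0" if "i \<le> n" for i using norm[OF that] by auto
      ultimately show ?thesis using D[of "T z"] eval[OF z] by simp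
    qed
    have "of_nat (M ^ Suc n) * D = (\<Sum>z\<in>?P. Re (\<Sum>w\<in>?W. \<Prod>i<n. g w i (z (w i) / z (w (Suc i)))))"
    proof -
      have "(\<Sum>z\<in>?P. Re (\<Sum>w\<in>?W. \<Prod>i<n. g w i (z (w i) / z (w (Suc i))))) = (\<Sum>z\<in>?P. D)"
        by (rule sum.cong[OF refl D_z])
      then show ?thesis using card by simp
    qed
    also have "\<dots> = Re (\<Sum>w\<in>?W. \<Sum>z\<in>?P. \<Prod>i<n. g w i (z (w i) / z (w (Suc i))))"
      by (subst sum.swap) simp
    also have "(\<Sum>w\<in>?W. \<Sum>z\<in>?P. \<Prod>i<n. g w i (z (w i) / z (w (Suc i)))) =
        (\<Sum>w\<in>?W. of_real (of_nat (M ^ Suc n) * (\<Prod>i<n. A w i M)))"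
    proof (rule sum.cong[OF refl])
      fix w assume "w \<in> ?W"
      then have w: "w permutes {..n}" by simp
      have "(\<Sum>z\<in>?P. \<Prod>i<n. g w i (z (w i) / z (w (Suc i)))) =
          (\<Sum>z\<in>?P. \<Prod>i<n. g w i (z i / z (Suc i)))"
        by (rule sum_torus_permute[OF w, of "\<lambda>z. \<Prod>i<n. g w i (z i / z (Suc i))"])
      also have "\<dots> = of_nat M * (\<Prod>i<n. \<Sum>y\<in>?R. g w i y)"
        by (rule sum_torus_prod[OF M0])
      also have "(\<Prod>i<n. \<Sum>y\<in>?R. g w i y) = (\<Prod>i<n. of_nat M * of_real (A w i M))"
      proof (rule prod.cong[OF refl])
        fix i assume i: "i \<in> {..<n}"
        have "s w i \<le> (\<Sum>k\<le>n. c w k)"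
          unfolding s_def using i by (intro sum_mono2) auto
        then have "s w i \<le> i + M" using c[OF w] M by simp
        then show "(\<Sum>y\<in>?R. g w i y) = of_nat M * of_real (A w i M)"
          unfolding g_def A_def using i M
          by (intro sum_roots_of_unity_geometric U_pos U_neq[OF w]) auto
      qed
      finally show "(\<Sum>z\<in>?P. \<Prod>i<n. g w i (z (w i) / z (w (Suc i)))) =
          of_real (of_nat (M ^ Suc n) * (\<Prod>i<n. A w i M))"
        by (simp add: prod.distrib mult.assoc)
    qed
    also have "Re \<dots> = of_nat (M ^ Suc n) * (\<Sum>w\<in>?W. \<Prod>i<n. A w i M)"
      by (simp only: Re_sum Re_complex_of_real sum_distrib_left)
    finally show ?thesis using M0 by simp
  qed
  have "(\<lambda>M. \<Sum>w\<in>?W. \<Prod>i<n. A w i M) \<longlonglongrightarrow> (\<Sum>w\<in>?W. \<Prod>i<n. \<epsilon> w i)"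
    unfolding A_def \<epsilon>_def using U_pos U_neq
    by (intro tendsto_sum tendsto_prod geometric_average_limit) auto
  moreover have "(\<lambda>M. \<Sum>w\<in>?W. \<Prod>i<n. A w i M) \<longlonglongrightarrow> D"
    by (rule tendsto_eventually) (use avg in \<open>auto simp: eventually_at_top_dense intro!: exI[of _ n]\<close>)
  ultimately have "D = (\<Sum>w\<in>?W. \<Prod>i<n. \<epsilon> w i)" by (metis LIMSEQ_unique)
  also have "\<dots> = (\<Sum>w\<in>?W. if Des n w = {i. i < n \<and> s w i < i + 1} then (-1) ^ card (Des n w) else 0)"
  proof (rule sum.cong[OF refl])
    fix w
    \<comment> \<open>A factor survives only where the descent condition agrees with
      \<open>s w i \<le> i\<close>; surviving descents give -1, surviving ascents give 1.\<close>
    have \<epsilon>: "\<epsilon> w i = (if i \<in> Des n w \<longleftrightarrow> s w i < i + 1 then (if i \<in> Des n w then -1 else 1) else 0)"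
      if "i < n" for i
      using that by (auto simp: \<epsilon>_def U_less Des_def)
    show "(\<Prod>i<n. \<epsilon> w i) = (if Des n w = {i. i < n \<and> s w i < i + 1} then (-1) ^ card (Des n w) else 0)"
    proof (cases "Des n w = {i. i < n \<and> s w i < i + 1}")
      case True
      then have "(\<Prod>i<n. \<epsilon> w i) = (\<Prod>i<n. if i \<in> Des n w then -1 else 1)"
        using \<epsilon> by (intro prod.cong) auto
      also have "\<dots> = (\<Prod>i\<in>Des n w. -1)"
        by (rule prod.mono_neutral_cong_right) (auto simp: Des_def)
      finally show ?thesis using True by simp
    next
      case False
      then obtain i where i: "i < n" "i \<in> Des n w \<longleftrightarrow> \<not> s w i < i + 1"
        unfolding Des_def by blast
      then have "\<epsilon> w i = 0" using \<epsilon> by auto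
      then have "(\<Prod>i<n. \<epsilon> w i) = 0" using i(1) by auto
      then show ?thesis using False by simp
    qed
  qed
  also have "\<dots> = (\<Sum>w | w permutes {..n} \<and> Des n w = {i. i < n \<and> s w i < i + 1}. (-1) ^ card (Des n w))"
    by (subst sum.inter_filter[OF fin, symmetric]) simp
  finally show ?thesis unfolding s_def .
qed


section \<open>The degree formula\<close>

lemma inv_diffs_eq_prod:
  "inv_diffs t xs = 1 / (\<Prod>i<length xs - 1. t (xs ! i) - t (xs ! Suc i))"
proof (induction t xs rule: inv_diffs.induct)
  case (3 t x y ys)
  then show ?case by (simp add: prod.lessThan_Suc_shift del: prod.lessThan_Suc)
qed auto

lemma (in weighted_matroid) nonbasis_prod_eq_prod:
  "nonbasis_prod X xs = (\<Prod>i<length xs. if spans (X \<union> set (take i xs)) (xs ! i) then t (xs ! i) else 1)"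
proof (induction xs arbitrary: X)
  case (Cons x xs)
  show ?case
    unfolding length_Cons prod.lessThan_Suc_shift by (simp add: Cons cong: if_cong)
qed simp

text \<open>Surjectivity follows from injectivity by counting both sides.\<close>

lemma bij_betw_permutes_lists:
  "bij_betw (\<lambda>w. map w [0..<Suc n]) {w. w permutes {..n}} (permutations_of_set {..n})"
proof -
  let ?f = "\<lambda>w. map w [0..<Suc n]"
  have inj: "inj_on ?f {w. w permutes {..n}}"
  proof (rule inj_onI)
    fix v w assume vw: "v \<in> {w. w permutes {..n}}" "w \<in> {w. w permutes {..n}}" "?f v = ?f w"
    have "v i = w i" for i
    proof (cases "i \<le> n")
      case True
      then show ?thesis using vw(3) by (auto simp: map_eq_conv simp del: upt_Suc)
    next
      case False
      then have "i \<notin> {..n}" by simp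
      then have "v i = i" "w i = i" using vw(1,2) by (auto intro: permutes_not_in)
      then show ?thesis by simp
    qed
    then show "v = w" by auto
  qed
  have "?f ` {w. w permutes {..n}} \<subseteq> permutations_of_set {..n}"
  proof (rule image_subsetI)
    fix w assume "w \<in> {w. w permutes {..n}}"
    then have w: "w permutes {..n}" by simp
    have "set [0..<Suc n] = {..n}" by auto
    then show "?f w \<in> permutations_of_set {..n}"
      using permutes_image[OF w] permutes_inj_on[OF w]
      by (intro permutations_of_setI) (auto simp: distinct_map simp del: upt_Suc)
  qed
  moreover have "card (?f ` {w. w permutes {..n}}) = card (permutations_of_set {..n})"
    unfolding card_image[OF inj] using card_permutations[of "{..n}" "Suc n"] by simp
  ultimately have "?f ` {w. w permutes {..n}} = permutations_of_set {..n}"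
    by (intro card_subset_eq) auto
  then show ?thesis using inj by (simp add: bij_betw_def)
qed

text \<open>The closure changes exactly when the next letter is not yet spanned. Each such letter
  raises the rank of the prefix by one, so the number of these positions is the total rank.\<close>

lemma
  fixes n :: nat
  assumes matroid: "matroid {0..n} \<I>" and w: "w permutes {0..n}"
  shows K_set_iff: "i \<le> n \<Longrightarrow>
      i \<in> K_set n \<I> w \<longleftrightarrow> mrank \<I> (insert (w i) (w ` {..<i})) \<noteq> mrank \<I> (w ` {..<i})"
    and card_K_set: "card (K_set n \<I> w) = mrank \<I> {0..n}"
proof -
  define E where "E = {0..n}"
  note E = E_def
  interpret finite_matroid E \<I> using matroid unfolding E by (rule finite_matroid.intro)
  have K: "i \<in> K_set n \<I> w \<longleftrightarrow> \<not> spans (w ` {..<i}) (w i)" if i: "i \<le> n" for i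
  proof -
    let ?X = "w ` {..<i}"
    have ins: "w ` {..i} = insert (w i) ?X" by (auto simp: le_less)
    have wE: "w i \<in> E" using permutes_in_image[OF w, of i] i E by simp
    have "mclosure E \<I> ?X = mclosure E \<I> (insert (w i) ?X) \<longleftrightarrow> spans ?X (w i)"
    proof
      assume "mclosure E \<I> ?X = mclosure E \<I> (insert (w i) ?X)"
      moreover have "w i \<in> mclosure E \<I> (insert (w i) ?X)" using wE by (simp add: mem_mclosure_iff)
      ultimately have "w i \<in> mclosure E \<I> ?X" by (simp only:)
      then show "spans ?X (w i)" by (simp only: mem_mclosure_iff)
    next
      assume "spans ?X (w i)"
      then show "mclosure E \<I> ?X = mclosure E \<I> (insert (w i) ?X)"
        using spans_insert_spanned by (auto simp: mem_mclosure_iff)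
    qed
    moreover have "i \<in> K_set n \<I> w \<longleftrightarrow> mclosure E \<I> ?X \<noteq> mclosure E \<I> (insert (w i) ?X)"
      using i unfolding K_set_def E ins[symmetric] by simp
    ultimately show ?thesis by simp
  qed
  then show "i \<le> n \<Longrightarrow> i \<in> K_set n \<I> w \<longleftrightarrow> \<not> spans (w ` {..<i}) (w i)" .
  have "card (K_set n \<I> w \<inter> {..<i}) = rk (w ` {..<i})" if "i \<le> Suc n" for i
    using that
  proof (induction i)
    case 0
    show ?case by (simp add: rk_empty)
  next
    case (Suc i)
    have "w ` {..<Suc i} = insert (w i) (w ` {..<i})" by (simp add: lessThan_Suc)
    moreover have "K_set n \<I> w \<inter> {..<Suc i} =
        (if i \<in> K_set n \<I> w then insert i (K_set n \<I> w \<inter> {..<i}) else K_set n \<I> w \<inter> {..<i})"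
      by (auto simp: less_Suc_eq)
    ultimately show ?case
      using Suc K[of i] rk_insert_cases[of "w i" "w ` {..<i}"] by auto
  qed
  from this[of "Suc n"] have "card (K_set n \<I> w \<inter> {..n}) = rk (w ` {..n})"
    by (simp add: lessThan_Suc_atMost)
  moreover have "K_set n \<I> w \<inter> {..n} = K_set n \<I> w" by (auto simp: K_set_def)
  moreover have "w ` {..n} = E" using permutes_image[OF w] E by (simp add: atLeast0AtMost)
  ultimately show "card (K_set n \<I> w) = rk {0..n}" by (simp add: E)
qed

theorem theorem6p9:
  fixes n r :: nat and \<I> :: "nat set set" and d :: "nat \<Rightarrow> nat"
  assumes "matroid {0..n} \<I>"
    and "loopless {0..n} \<I>"
    and "mrank \<I> {0..n} = r + 1"
    and "(\<Sum>i=0..n. d i) = r"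
  shows "chow_deg {0..n} \<I>
      (\<Otimes>\<^bsub>chow_ring {0..n} \<I>\<^esub>k\<in>{0..n}.
         hyp_Lambda {0..n} \<I> k [^]\<^bsub>chow_ring {0..n} \<I>\<^esub> d k) =
    (\<Sum>w | w permutes {0..n} \<and> Des n w = I_prime n d (K_set n \<I> w).
       (-1) ^ (n - r + card (Des n w)))"
proof -
  let ?E = "{0..n}"
  \<comment> \<open>The extra power outside \<open>K_set\<close> comes from
    \<open>nonbasis_prod\<close>, which contributes \<open>t (w k)\<close> there.\<close>
  define c where "c = (\<lambda>w k. if k \<in> K_set n \<I> w then d k else d k + 1)"
  let ?deg = "chow_deg ?E \<I> (\<Otimes>\<^bsub>chow_ring ?E \<I>\<^esub>k\<in>?E. hyp_Lambda ?E \<I> k [^]\<^bsub>chow_ring ?E \<I>\<^esub> d k)"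
  have E: "?E = {..n}" by auto
  have sum_c: "(\<Sum>k\<le>n. c w k) = n \<and> r \<le> n" if "w permutes {..n}" for w
  proof -
    have w: "w permutes ?E" using that E by simp
    have K: "K_set n \<I> w \<subseteq> {..n}" "card (K_set n \<I> w) = r + 1"
      using card_K_set[OF assms(1) w] assms(3) by (auto simp: K_set_def)
    have "(\<Sum>k\<le>n. c w k) = (\<Sum>k\<le>n. d k + (if k \<in> {..n} - K_set n \<I> w then 1 else 0))"
      by (rule sum.cong) (auto simp: c_def)
    also have "\<dots> = r + card ({..n} - K_set n \<I> w)"
    proof -
      have "(\<Sum>k\<le>n. if k \<in> {..n} - K_set n \<I> w then 1 else 0 :: nat) = (\<Sum>k\<in>{..n} - K_set n \<I> w. 1)"
        by (rule sum.mono_neutral_cong_right) auto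
      then show ?thesis using assms(4) unfolding sum.distrib E by simp
    qed
    also have "card ({..n} - K_set n \<I> w) = Suc n - (r + 1)"
      using K finite_subset[OF K(1)] by (subst card_Diff_subset) auto
    moreover have "r + 1 \<le> Suc n" using K card_mono[OF finite_atMost K(1)] by simp
    ultimately show ?thesis by simp
  qed
  \<comment> \<open>The identity serves as a permutation at which \<open>sum_c\<close> can be read
    off; without \<open>r \<le> n\<close> the natural subtraction \<open>n - r\<close> would be
    truncated.\<close>
  then have rn: "r \<le> n" using permutes_id by blast
  have sign: "(-1 :: complex) ^ (card ?E + r + 1) = (-1) ^ (n - r)"
  proof -
    have "card ?E + r + 1 = (n - r) + 2 * (r + 1)" using rn by simp
    then show ?thesis by (simp only: power_add power_mult) simp
  qed
  \<comment> \<open>The right-hand side does not involve \<open>t\<close>; it is the common value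
    \<open>D\<close> in \<open>constant_term\<close>.\<close>
  have deg: "Re (\<Sum>w | w permutes {..n}. (\<Prod>k\<le>n. t (w k) ^ c w k) / (\<Prod>i<n. t (w i) - t (w (Suc i)))) =
      (-1) ^ (n - r) * ?deg" if t: "inj_on t {..n}" for t :: "nat \<Rightarrow> complex"
  proof -
    interpret L: complex_localization ?E \<I> t r
      by unfold_locales (use t E assms in auto)
    have bij: "bij_betw (\<lambda>w. map w [0..<Suc n]) {w. w permutes {..n}} (permutations_of_set ?E)"
      unfolding E by (rule bij_betw_permutes_lists)
    have "L.localize (\<lambda>w. \<Prod>k\<in>?E. t (w ! k) ^ d k) =
        (\<Sum>w | w permutes {..n}. (\<Prod>k\<le>n. t (w k) ^ c w k) / (\<Prod>i<n. t (w i) - t (w (Suc i))))"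
      unfolding L.localize_def sum.reindex_bij_betw[OF bij, symmetric]
    proof (rule sum.cong[OF refl])
      fix w assume "w \<in> {w. w permutes {..n}}"
      then have w: "w permutes ?E" using E by simp
      let ?xs = "map w [0..<Suc n]"
      have nth: "?xs ! i = w i" if "i \<le> n" for i
        using that by (simp add: nth_append del: upt_Suc)
      have prefix: "set (take i ?xs) = w ` {..<i}" if "i \<le> n" for i
        using that by (simp add: take_map lessThan_atLeast0 del: upt_Suc)
      have diffs: "inv_diffs t ?xs = 1 / (\<Prod>i<n. t (w i) - t (w (Suc i)))"
        unfolding inv_diffs_eq_prod using nth by (simp del: upt_Suc)
      have "L.nonbasis_prod {} ?xs = (\<Prod>k\<le>n. if k \<in> K_set n \<I> w then 1 else t (w k))"
        unfolding L.nonbasis_prod_eq_prod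
        using nth prefix K_set_iff[OF assms(1) w]
        by (auto simp: lessThan_Suc_atMost simp del: upt_Suc intro!: prod.cong)
      then have "L.nonbasis_prod {} ?xs * (\<Prod>k\<in>?E. t (?xs ! k) ^ d k) = (\<Prod>k\<le>n. t (w k) ^ c w k)"
        using nth unfolding E
        by (auto simp: c_def simp del: upt_Suc simp flip: prod.distrib intro!: prod.cong)
      then show "L.nonbasis_prod {} ?xs * inv_diffs t ?xs * (\<Prod>k\<in>?E. t (?xs ! k) ^ d k) =
          (\<Prod>k\<le>n. t (w k) ^ c w k) / (\<Prod>i<n. t (w i) - t (w (Suc i)))"
        unfolding diffs by (simp add: mult_ac)
    qed
    moreover have "?deg = Re ((-1) ^ (n - r) * L.localize (\<lambda>w. \<Prod>k\<in>?E. t (w ! k) ^ d k))"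
      unfolding sign[symmetric] using assms(4) by (intro L.chow_deg_hyp_Lambda) auto
    moreover have "Re ((-1) ^ (n - r) * x) = (-1) ^ (n - r) * Re x" for x
      by (cases "even (n - r)") auto
    ultimately show ?thesis by (simp flip: power_add mult.assoc)
  qed
  have "(-1) ^ (n - r) * ?deg =
      (\<Sum>w | w permutes {..n} \<and> Des n w = {i. i < n \<and> (\<Sum>j\<le>i. c w j) < i + 1}. (-1) ^ card (Des n w))"
    by (rule constant_term[of n c]) (use deg sum_c in auto)
  also have "\<dots> = (\<Sum>w | w permutes ?E \<and> Des n w = I_prime n d (K_set n \<I> w). (-1) ^ card (Des n w))"
    by (simp add: I_prime_def c_def E)
  \<comment> \<open>The sign is its own inverse, so multiplying by it once more moves it to the sum
    over permutations.\<close>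
  finally have "(-1) ^ (n - r) * ((-1) ^ (n - r) * ?deg) = (-1) ^ (n - r) *
      (\<Sum>w | w permutes ?E \<and> Des n w = I_prime n d (K_set n \<I> w). (-1) ^ card (Des n w))" by simp
  moreover have "(-1) ^ (n - r) * ((-1) ^ (n - r) * x) = x" for x :: real
    by (simp flip: mult.assoc power_add)
  ultimately show ?thesis by (simp add: power_add sum_distrib_left)
qed

end
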